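(* Let $X_1,\ldots,X_n$ be i.i.d. real random variables with common density $f\in\mathbb{L}_\infty(\mathbb{R})$. Let $f_0$ be some given bounded density and $K=[\underline\mu,\overline\mu]\times[\underline\sigma,\overline\sigma]$, where $\underline\mu,\overline\mu,\underline\sigma,\overline\sigma$ are real numbers with $\underline\sigma>0$. Suppose that: $(h_1)$ There exists a constant $C_{f_0}>0$ such that for all $x,y$ in the support of $f$, $(\mu,\sigma)\in K$, $(\mu',\sigma')\in K$, $$\left|f_0\left(\frac{x-\mu}{\sigma}\right)-f_0\left(\frac{y-\mu'}{\sigma'}\right)\right|\le C_{f_0}\left|\frac{x-\mu}{\sigma}-\frac{y-\mu'}{\sigma'}\right|.$$ $(h_2)$ There exist $\nu>0$ and $c>0$ such that for all integers $k\ge2$, $\mathbb{E}(|X_i|^k)\le\frac{k!}{2}\nu c^{k-2}$. Assume that $n\ge3$ and $n^2\big((\overline\mu-\underline\mu)\wedge(\overline\sigma-\underline\sigma)\big)\ge2$. Let $\alpha\in\,]0,1[$ and let $\tilde T_\alpha=\sup_{m\in\mathcal{M}}(\tilde T_m(X_1,\ldots,X_n)-\tilde q_{m,\alpha})$ be the test statistic defined in the context, with $\tilde q_{m,\alpha}=t_m(u_\alpha)$. Choose $\mathcal{D}_1\subset\{2^J,\ 0\le J\le\log_2(n^2)\}$ and $\mathcal{D}_2=\{2^J,\ 0\le J\le\log_2(n^2/\log^3n)\}$. Let $\beta\in\,]0,1[$. For all $s>0$, $M>0$, $R>0$, there exists a positive constant $C=C(\underline\mu,\overline\mu,\underline\sigma,\overline\sigma,\|f_0\|_\infty,C_{f_0},M,\nu,c,\alpha,\beta,s)$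 such that, if $f$ belongs to the set $\tilde{\mathcal{B}}_s(R,M)$ and satisfies $$\inf_{(\mu,\sigma)\in K}\left\|f-\frac1\sigma f_0\left(\frac{\cdot-\mu}{\sigma}\right)\right\|_2^2>C\left(R^{2/(4s+1)}\left(\frac{\sqrt{\log n}}{n}\right)^{4s/(4s+1)}+R^2\left(\frac{(\log n)^3}{n^2}\right)^{2s}+\frac{\log n}{n}\right),$$ then $$\mathbb{P}_f(\tilde T_\alpha\le0)\le\beta.$$
   Context: Notation: $\|\cdot\|_2$ is the usual norm of $\mathbb{L}_2(\mathbb{R})$ (Lebesgue measure); $\|g\|_\infty=\sup_{x\in\mathbb{R}}|g(x)|$; $a\wedge b=\min(a,b)$; $\sigma f(\sigma\cdot+\mu)$ is the function $x\mapsto\sigma f(\sigma x+\mu)$; $\mathbb{P}_g$ denotes the law of $(X_1,\ldots,X_n)$ when the $X_i$ are i.i.d. with density $g$. The null hypothesis is "$f\in\mathcal{F}$" with $\mathcal{F}=\{\frac1\sigma f_0(\frac{\cdot-\mu}{\sigma}),(\mu,\sigma)\in K\}$. Let $\mathbb{D}_1=\mathbb{N}^*=\{1,2,\ldots\}$ and $\mathbb{D}_2=\{2^J,\ J\in\mathbb{N}\}$. (i) For $D\in\mathbb{D}_1$ and $k\in\mathbb{Z}$, $I_{D,k}=\sqrt D\,\mathbb{I}_{[k/D,(k+1)/D[}$. For $m=(1,D)$, $$\hat T_m(x_1,\ldots,x_n)=\frac{1}{n(n-1)}\sum_{k\in\mathbb{Z}}\sum_{i\ne j=1}^n I_{D,k}(x_i)I_{D,k}(x_j)+\|f_0\|_2^2-\frac2n\sum_{i=1}^n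 f_0(x_i).$$ (ii) $(\varphi,\psi)$ is a fixed pair of compactly supported orthonormal wavelets such that for all $J\in\mathbb{N}$, $\{\varphi_{J,k}=2^{J/2}\varphi(2^J\cdot-k),k\in\mathbb{Z}\}\cup\{\psi_{j,k}=2^{j/2}\psi(2^j\cdot-k),j\in\mathbb{N},j\ge J,k\in\mathbb{Z}\}$ is an orthonormal basis of $\mathbb{L}_2(\mathbb{R})$, and the scaling function $\varphi$ is Lipschitz: $|\varphi(x)-\varphi(y)|\le C_\varphi|x-y|$ for all $x,y\in\mathbb{R}$. For $D=2^J\in\mathbb{D}_2$, $S_{(2,D)}$ is the closed subspace of $\mathbb{L}_2(\mathbb{R})$ with orthonormal basis $\{\varphi_{J,k},k\in\mathbb{Z}\}$, $\Pi_{S_{(2,D)}}$ is the orthogonal projection onto it, and for $m=(2,D)$, $$\hat T_m(x_1,\ldots,x_n)=\frac{1}{n(n-1)}\sum_{k\in\mathbb{Z}}\sum_{i\ne j=1}^n\varphi_{J,k}(x_i)\varphi_{J,k}(x_j)+\|f_0\|_2^2-\frac2n\sum_{i=1}^n f_0(x_i).$$ Let $\mathcal{M}=\{(l,D),\ l\in\{1,2\},\ D\in\mathcal{D}_l\}$. For $m\in\mathcal{M}$, $$\tilde T_m(X_1,\ldots,X_n)=\inf_{(\mu,\sigma)\in K}\hat T_m\left(\frac{X_1-\mu}{\sigma},\ldots,\frac{X_n-\mu}{\sigma}\right).$$ For $u\in\,]0,1[$, $t_m(u)$ is the $(1-u)$ quantile of the law of $\hat T_m(X_1,\ldots,X_n)$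 under $\mathbb{P}_{f_0}$, and $$u_\alpha=\sup\left\{u\in\,]0,1[,\ \mathbb{P}_{f_0}\left(\sup_{m\in\mathcal{M}}(\hat T_m(X_1,\ldots,X_n)-t_m(u))>0\right)\le\alpha\right\}.$$ Classes. For $s,R,M>0$, $$\tilde{\mathcal{B}}_s(R,M)=\{f\in\mathbb{L}_2(\mathbb{R}),\ \|f\|_\infty\le M,\ \forall D\in\mathbb{D}_2,\ \forall(\mu,\sigma)\in K,\ \|\sigma f(\sigma\cdot+\mu)-\Pi_{S_{(2,D)}}(\sigma f(\sigma\cdot+\mu))\|_2^2\le R^2\sigma^{1+2s}D^{-2s}\}.$$ The constant $C$ depends only on the quantities displayed as its arguments (in particular not on $n$, $R$ or otherwise on $f$), and possibly on the choice of $\varphi$. *)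

theory Defs
  imports "HOL-Probability.Probability"
begin

section \<open>Functions on the real line\<close>

text \<open>
  The space of square integrable functions is represented by genuine (Borel) functions rather
  than by classes modulo equality almost everywhere.
\<close>

definition L2 :: "(real \<Rightarrow> real) set" where
  "L2 = {g \<in> borel_measurable borel. integrable lborel (\<lambda>x. (g x)\<^sup>2)}"

definition l2_norm :: "(real \<Rightarrow> real) \<Rightarrow> real" where
  "l2_norm g = sqrt (LINT x|lborel. (g x)\<^sup>2)"

definition l2_inner :: "(real \<Rightarrow> real) \<Rightarrow> (real \<Rightarrow> real) \<Rightarrow> real" where
  "l2_inner g h = (LINT x|lborel. g x * h x)"

text \<open>A true supremum (not an essential one), with value \<open>\<infinity>\<close> for unbounded functions.\<close>

definition sup_norm :: "(real \<Rightarrow> real) \<Rightarrow> ereal" where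
  "sup_norm g = (SUP x. ereal \<bar>g x\<bar>)"

definition supp :: "(real \<Rightarrow> real) \<Rightarrow> real set" where
  "supp g = closure (support_on UNIV g)"

definition is_density :: "(real \<Rightarrow> real) \<Rightarrow> bool" where
  "is_density g \<longleftrightarrow>
     g \<in> borel_measurable borel \<and> (\<forall>x. 0 \<le> g x) \<and> (\<integral>\<^sup>+x. ennreal (g x) \<partial>lborel) = 1"

section \<open>Orthonormal bases and projections in the space of square integrable functions\<close>

definition L2_closed_span :: "'i set \<Rightarrow> ('i \<Rightarrow> real \<Rightarrow> real) \<Rightarrow> (real \<Rightarrow> real) set" where
  "L2_closed_span I e =
     {g \<in> L2. \<forall>\<epsilon>>0. \<exists>F a. finite F \<and> F \<subseteq> I \<and> l2_norm (\<lambda>x. g x - (\<Sum>i\<in>F. a i * e i x)) < \<epsilon>}"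

definition orthonormal_family :: "'i set \<Rightarrow> ('i \<Rightarrow> real \<Rightarrow> real) \<Rightarrow> bool" where
  "orthonormal_family I e \<longleftrightarrow>
     (\<forall>i\<in>I. e i \<in> L2) \<and> (\<forall>i\<in>I. \<forall>j\<in>I. l2_inner (e i) (e j) = (if i = j then 1 else 0))"

definition orthonormal_basis_L2 :: "'i set \<Rightarrow> ('i \<Rightarrow> real \<Rightarrow> real) \<Rightarrow> bool" where
  "orthonormal_basis_L2 I e \<longleftrightarrow> orthonormal_family I e \<and> L2_closed_span I e = L2"

text \<open>
  The orthogonal projection onto a closed subspace is determined only up to equality almost
  everywhere; an arbitrary representative is chosen.
\<close>

definition orth_proj :: "(real \<Rightarrow> real) set \<Rightarrow> (real \<Rightarrow> real) \<Rightarrow> real \<Rightarrow> real" where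
  "orth_proj S g = (SOME p. p \<in> S \<and> (\<forall>h\<in>S. l2_inner (\<lambda>x. g x - p x) h = 0))"

section \<open>Histograms and wavelets\<close>

definition hist :: "nat \<Rightarrow> int \<Rightarrow> real \<Rightarrow> real" where
  "hist D k x =
     sqrt (real D) * indicator {real_of_int k / real D ..< (real_of_int k + 1) / real D} x"

text \<open>For \<open>D = 2 ^ J\<close> this is the function \<open>2\<^sup>J\<^sup>/\<^sup>2 h (2\<^sup>J x - k)\<close>.\<close>

definition dilate :: "(real \<Rightarrow> real) \<Rightarrow> nat \<Rightarrow> int \<Rightarrow> real \<Rightarrow> real" where
  "dilate h D k x = sqrt (real D) * h (real D * x - real_of_int k)"

definition wavelet_pair :: "(real \<Rightarrow> real) \<Rightarrow> (real \<Rightarrow> real) \<Rightarrow> bool" where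
  "wavelet_pair \<phi> \<psi> \<longleftrightarrow>
     compact (supp \<phi>) \<and> compact (supp \<psi>) \<and>
     (\<exists>C. C-lipschitz_on UNIV \<phi>) \<and>
     (\<forall>J::nat. orthonormal_basis_L2 ((UNIV :: int set) <+> ({J..} \<times> (UNIV :: int set)))
        (case_sum (\<lambda>k. dilate \<phi> (2 ^ J) k) (\<lambda>(j, k). dilate \<psi> (2 ^ j) k)))"

definition S2 :: "(real \<Rightarrow> real) \<Rightarrow> nat \<Rightarrow> (real \<Rightarrow> real) set" where
  "S2 \<phi> D = L2_closed_span (UNIV :: int set) (dilate \<phi> D)"

text \<open>
  A model is a pair \<open>m = (l, D)\<close>: histograms of step \<open>1 / D\<close> for \<open>l = 1\<close>, and the
  scaling functions at the dyadic level \<open>D\<close> for \<open>l = 2\<close>.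
\<close>

type_synonym model = "nat \<times> nat"

definition basis_fun :: "(real \<Rightarrow> real) \<Rightarrow> model \<Rightarrow> int \<Rightarrow> real \<Rightarrow> real" where
  "basis_fun \<phi> m k = (if fst m = 1 then hist (snd m) k else dilate \<phi> (snd m) k)"

definition dyadic_upto :: "real \<Rightarrow> nat set" where
  "dyadic_upto b = {2 ^ J | J::nat. real J \<le> log 2 b}"

definition models :: "nat set \<Rightarrow> nat set \<Rightarrow> model set" where
  "models D1 D2 = ({1} \<times> D1) \<union> ({2} \<times> D2)"

section \<open>The test\<close>

text \<open>A sample of size \<open>n\<close> is a function on \<open>nat\<close> of which only the values on \<open>{1..n}\<close> matter.\<close>

definition dens_measure :: "(real \<Rightarrow> real) \<Rightarrow> real measure" where
  "dens_measure g = density lborel (\<lambda>x. ennreal (g x))"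

definition sample_law :: "nat \<Rightarrow> (real \<Rightarrow> real) \<Rightarrow> (nat \<Rightarrow> real) measure" where
  "sample_law n g = (\<Pi>\<^sub>M i\<in>{1..n}. dens_measure g)"

text \<open>For compactly supported \<open>\<phi>\<close>, only finitely many terms of the sum over \<open>k\<close> are nonzero.\<close>

definition T_hat ::
  "(real \<Rightarrow> real) \<Rightarrow> (real \<Rightarrow> real) \<Rightarrow> nat \<Rightarrow> model \<Rightarrow> (nat \<Rightarrow> real) \<Rightarrow> real" where
  "T_hat \<phi> f0 n m x =
     1 / (real n * (real n - 1)) *
       (\<Sum>\<^sub>\<infinity>k\<in>(UNIV :: int set). \<Sum>i\<in>{1..n}. \<Sum>j\<in>{1..n} - {i}. basis_fun \<phi> m k (x i) * basis_fun \<phi> m k (x j))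
     + (l2_norm f0)\<^sup>2 - 2 / real n * (\<Sum>i\<in>{1..n}. f0 (x i))"

definition T_tilde ::
  "(real \<Rightarrow> real) \<Rightarrow> (real \<Rightarrow> real) \<Rightarrow> (real \<times> real) set \<Rightarrow> nat \<Rightarrow> model \<Rightarrow> (nat \<Rightarrow> real) \<Rightarrow> ereal" where
  "T_tilde \<phi> f0 K n m x = (INF (\<mu>, \<sigma>)\<in>K. ereal (T_hat \<phi> f0 n m (\<lambda>i. (x i - \<mu>) / \<sigma>)))"

text \<open>
  The quantile is extended real valued, so that it has a meaning (namely \<open>-\<infinity>\<close>) at
  \<open>p = 0\<close>, which is reached below if the supremum defining \<open>u_alpha\<close> equals \<open>1\<close>.
\<close>

definition quantile :: "real measure \<Rightarrow> real \<Rightarrow> ereal" where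
  "quantile N p = (INF t\<in>{t. p \<le> cdf N t}. ereal t)"

definition t_quant :: "(real \<Rightarrow> real) \<Rightarrow> (real \<Rightarrow> real) \<Rightarrow> nat \<Rightarrow> model \<Rightarrow> real \<Rightarrow> ereal" where
  "t_quant \<phi> f0 n m u = quantile (distr (sample_law n f0) borel (T_hat \<phi> f0 n m)) (1 - u)"

definition u_alpha :: "(real \<Rightarrow> real) \<Rightarrow> (real \<Rightarrow> real) \<Rightarrow> nat \<Rightarrow> model set \<Rightarrow> real \<Rightarrow> real" where
  "u_alpha \<phi> f0 n Ms \<alpha> =
     Sup {u. 0 < u \<and> u < 1 \<and>
       measure (sample_law n f0)
         {x \<in> space (sample_law n f0).
            (SUP m\<in>Ms. ereal (T_hat \<phi> f0 n m x) - t_quant \<phi> f0 n m u) > 0} \<le> \<alpha>}"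

definition T_alpha ::
  "(real \<Rightarrow> real) \<Rightarrow> (real \<Rightarrow> real) \<Rightarrow> (real \<times> real) set \<Rightarrow> nat \<Rightarrow> model set \<Rightarrow> real
     \<Rightarrow> (nat \<Rightarrow> real) \<Rightarrow> ereal" where
  "T_alpha \<phi> f0 K n Ms \<alpha> x =
     (SUP m\<in>Ms. T_tilde \<phi> f0 K n m x - t_quant \<phi> f0 n m (u_alpha \<phi> f0 n Ms \<alpha>))"

section \<open>Smoothness classes\<close>

definition B_class ::
  "(real \<Rightarrow> real) \<Rightarrow> (real \<times> real) set \<Rightarrow> real \<Rightarrow> real \<Rightarrow> real \<Rightarrow> (real \<Rightarrow> real) set" where
  "B_class \<phi> K s R M =
     {f \<in> L2. sup_norm f \<le> ereal M \<and>
        (\<forall>J::nat. \<forall>(\<mu>, \<sigma>)\<in>K.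
           let D = 2 ^ J; g = (\<lambda>x. \<sigma> * f (\<sigma> * x + \<mu>)) in
           (l2_norm (\<lambda>x. g x - orth_proj (S2 \<phi> D) g x))\<^sup>2
             \<le> R\<^sup>2 * \<sigma> powr (1 + 2 * s) * real D powr (- 2 * s))}"

end

theory Submission
  imports Defs
begin

text \<open>
  For one wavelet model \<open>D\<close>, the statistic is a degenerate U-statistic of order two plus a linear
  term plus \<open>\<parallel>g - f\<^sub>0\<parallel>\<^sup>2 - \<parallel>g - \<Pi> g\<parallel>\<^sup>2\<close>, where \<open>g\<close> is the density of the standardized sample. The
  kernel of the U-statistic comes from the reproducing kernel of the projection \<open>\<Pi>\<close>; therefore the
  conditional variances of its martingale increments are bounded by the U-statistic itself, and a
  Freedman type inequality can be bootstrapped: with \<open>l\<close> of order \<open>ln n\<close>, the normalized U-statistic is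
  of order \<open>sqrt (D l) / n + l / n\<close> outside an event of probability \<open>O(n exp (- l))\<close>, as long as
  \<open>D (ln n)\<^sup>3 \<le> n\<^sup>2\<close>. The linear term is absorbed by Bernstein's inequality.

  Under \<open>f\<^sub>0\<close> this bounds the quantile, because \<open>u\<^sub>\<alpha>\<close> is at least \<open>\<alpha>\<close> divided by the number of models. Under
  \<open>f\<close> the bound holds simultaneously on a polynomially fine grid of \<open>K\<close>, and extends to \<open>K\<close> because
  \<open>\<phi>\<close> and \<open>f\<^sub>0\<close> are Lipschitz and the sample is bounded by a power of \<open>n\<close>. It remains to balance
  \<open>R\<^sup>2 D powr (- 2 s)\<close> against \<open>sqrt (D ln n) / n\<close>.
\<close>

section \<open>Concentration for product measures\<close>

text \<open>\<open>T_alpha\<close> is a supremum over models, so non-rejection keeps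
  \<open>T_tilde\<close> below the quantile for each single model. The power thus rests on one
  well-chosen wavelet level, and the other models matter through their number alone. Each union
  bound (time steps, grid points, models) costs a power of n, which is harmless when
  \<open>l\<close> is a large multiple of \<open>ln n\<close>.

  The almost sure bound on an increment of the U-statistic is of order n times the level, far above
  its typical size. Hence the exponential inequality is proved for truncated increments, and the
  truncation is removed on an event where all increments are small. The conditional variances are
  Gram sums: with \<open>q\<close> the projection of \<open>f\<close>, the centred kernel is the
  inner product of \<open>\<kappa> x - q\<close> and \<open>\<kappa> x' - q\<close>, so a squared
  norm becomes a double sum of \<open>h\<close>, that is a diagonal plus twice the U-statistic of
  the earlier points.

  \<open>T_tilde\<close> is an infimum over a continuum, and its events are not shown to be
  measurable. \<open>whp\<close> therefore asks for a measurable exceptional set, and the conclusion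
  is about outer measure.\<close>

definition whp :: "'a measure \<Rightarrow> real \<Rightarrow> ('a \<Rightarrow> bool) \<Rightarrow> bool" where
  "whp M \<epsilon> Q \<longleftrightarrow> (\<exists>N\<in>sets M. emeasure M N \<le> ennreal \<epsilon> \<and> (\<forall>x\<in>space M - N. Q x))"

lemma whp_mono:
  assumes "whp M \<epsilon> Q" "\<epsilon> \<le> \<delta>" "\<And>x. x \<in> space M \<Longrightarrow> Q x \<Longrightarrow> Q' x"
  shows "whp M \<delta> Q'"
proof -
  obtain N where "N \<in> sets M" "emeasure M N \<le> ennreal \<epsilon>" "\<forall>x\<in>space M - N. Q x"
    using assms(1) by (auto simp: whp_def)
  moreover have "ennreal \<epsilon> \<le> ennreal \<delta>" using assms(2) by (rule ennreal_leI)
  ultimately show ?thesis using assms(3) unfolding whp_def by (metis DiffD1 order_trans)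
qed

lemma whp_conj:
  assumes "whp M \<epsilon> Q" "whp M \<delta> Q'" "0 \<le> \<epsilon>" "0 \<le> \<delta>"
  shows "whp M (\<epsilon> + \<delta>) (\<lambda>x. Q x \<and> Q' x)"
proof -
  obtain N where N: "N \<in> sets M" "emeasure M N \<le> ennreal \<epsilon>" "\<forall>x\<in>space M - N. Q x"
    using assms(1) by (auto simp: whp_def)
  obtain N' where N': "N' \<in> sets M" "emeasure M N' \<le> ennreal \<delta>" "\<forall>x\<in>space M - N'. Q' x"
    using assms(2) by (auto simp: whp_def)
  have "emeasure M (N \<union> N') \<le> emeasure M N + emeasure M N'"
    by (rule emeasure_subadditive) (use N N' in auto)
  also have "\<dots> \<le> ennreal (\<epsilon> + \<delta>)"
    using N(2) N'(2) assms(3,4) by (simp add: ennreal_plus add_mono)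
  finally show ?thesis
    unfolding whp_def using N N' by (intro bexI[of _ "N \<union> N'"]) auto
qed

lemma whp_True: "0 \<le> \<epsilon> \<Longrightarrow> whp M \<epsilon> (\<lambda>x. True)"
  unfolding whp_def by (intro bexI[of _ "{}"]) auto

lemma whp_Ball:
  assumes "finite I" "\<And>i. i \<in> I \<Longrightarrow> whp M \<epsilon> (Q i)" "0 \<le> \<epsilon>"
  shows "whp M (real (card I) * \<epsilon>) (\<lambda>x. \<forall>i\<in>I. Q i x)"
  using assms(1,2)
proof (induction I)
  case empty
  then show ?case by (simp add: whp_True)
next
  case (insert a I)
  have "whp M (\<epsilon> + real (card I) * \<epsilon>) (\<lambda>x. Q a x \<and> (\<forall>i\<in>I. Q i x))"
    by (rule whp_conj) (use insert assms(3) in auto)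
  then show ?case
    by (rule whp_mono) (use insert in \<open>auto simp: algebra_simps\<close>)
qed

lemma whp_AE:
  assumes "AE x in M. Q x" "0 \<le> \<epsilon>"
  shows "whp M \<epsilon> Q"
proof -
  obtain N where "N \<in> null_sets M" "{x\<in>space M. \<not> Q x} \<subseteq> N"
    using assms(1) by (auto simp: eventually_ae_filter)
  then show ?thesis
    unfolding whp_def using assms(2) by (intro bexI[of _ N]) auto
qed

definition trunc1 :: "real \<Rightarrow> real" where
  "trunc1 x = (if \<bar>x\<bar> \<le> 1 then x else 0)"

lemma trunc1_measurable [measurable]: "trunc1 \<in> borel_measurable borel"
  unfolding trunc1_def by measurable

lemma trunc1_minus: "trunc1 (- x) = - trunc1 x"
  by (simp add: trunc1_def)

text \<open>
  Where \<open>\<bar>x\<bar> > 1\<close> the quadratic dominates, so that no almost sure bound on the increments of a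
  martingale is needed for the exponential moments of the truncated increments.
\<close>

lemma exp_trunc1_le: "exp (trunc1 x) \<le> 1 + x + 2 * x\<^sup>2"
proof (cases "\<bar>x\<bar> \<le> 1")
  case True
  have "exp x \<le> 1 + x + x\<^sup>2"
  proof (cases "0 \<le> x")
    case True
    then show ?thesis using exp_bound[of x] \<open>\<bar>x\<bar> \<le> 1\<close> by auto
  next
    case False
    \<comment> \<open>For negative x it is enough to multiply by \<open>1 + y\<close>, which is at
      most \<open>exp y\<close>: the product \<open>(1 - y + y^2) * (1 + y)\<close> equals
      \<open>1 + y^3\<close>.\<close>
    define y where "y = - x"
    have y: "0 < y" using False y_def by auto
    have "exp x * (1 + y) \<le> exp x * exp y"
      by (intro mult_left_mono) (auto simp: exp_ge_add_one_self)
    also have "\<dots> = 1" by (simp add: y_def exp_minus_inverse)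
    also have "1 \<le> (1 - y + y\<^sup>2) * (1 + y)"
      using y by (simp add: algebra_simps power2_eq_square)
    finally have "exp x \<le> 1 - y + y\<^sup>2" using y by simp
    then show ?thesis by (simp add: y_def)
  qed
  then show ?thesis using True by (simp add: trunc1_def) (smt (verit) zero_le_power2)
next
  case False
  have "0 \<le> x + 2 * x\<^sup>2"
  proof (cases "0 \<le> x")
    case True then show ?thesis by simp
  next
    case neg: False
    then have "x * (1 + 2 * x) \<ge> 0" using False by (intro mult_nonpos_nonpos) auto
    then show ?thesis by (simp add: algebra_simps power2_eq_square)
  qed
  then show ?thesis using False by (simp add: trunc1_def)
qed

section \<open>Exponential inequalities for an i.i.d. sample\<close>

locale borel_prob = prob_space P for P :: "real measure" +
  assumes sets_P [simp, measurable_cong]: "sets P = sets borel"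
begin

lemma space_P [simp]: "space P = UNIV"
  using sets_eq_imp_space_eq[OF sets_P] by simp

sublocale PP: product_prob_space "\<lambda>_::nat. P"
  by standard

abbreviation Pn :: "nat \<Rightarrow> (nat \<Rightarrow> real) measure" where
  "Pn n \<equiv> PiM {1..n} (\<lambda>_. P)"

lemma eval_measurable:
  assumes "(\<lambda>(x, y). g x y) \<in> borel_measurable (Pn n \<Otimes>\<^sub>M P)" "j \<in> {1..n}"
  shows "(\<lambda>x. g x (x j)) \<in> borel_measurable (Pn n)"
proof -
  have "(\<lambda>x. (x, x j)) \<in> Pn n \<rightarrow>\<^sub>M Pn n \<Otimes>\<^sub>M P" using assms(2) by measurable
  from measurable_compose[OF this assms(1)] show ?thesis by simp
qed

text \<open>Integrating out the last coordinate multiplies the integrand by at most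
  \<open>exp (- 2 v) * (1 + 2 v)\<close>, which is at most 1. Predictability is encoded without
  filtrations: \<open>d j\<close> and \<open>v j\<close> ignore changes of the coordinates from
  \<open>j\<close> on. Measurability is asked on every \<open>Pn m\<close> with
  \<open>j \<le> Suc m\<close> because the sample space grows along the induction.\<close>

lemma exp_supermartingale:
  fixes d :: "nat \<Rightarrow> (nat \<Rightarrow> real) \<Rightarrow> real \<Rightarrow> real" and v :: "nat \<Rightarrow> (nat \<Rightarrow> real) \<Rightarrow> real"
  assumes measd: "\<And>j m. j \<le> Suc m \<Longrightarrow> (\<lambda>(x, y). d j x y) \<in> borel_measurable (Pn m \<Otimes>\<^sub>M P)"
    and measv: "\<And>j m. j \<le> Suc m \<Longrightarrow> v j \<in> borel_measurable (Pn m)"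
    and adaptd: "\<And>j k x z y. j \<le> k \<Longrightarrow> d j (x(k := z)) y = d j x y"
    and adaptv: "\<And>j k x z. j \<le> k \<Longrightarrow> v j (x(k := z)) = v j x"
    and int: "\<And>j x. integrable P (d j x)" "\<And>j x. (LINT y|P. d j x y) = 0"
    and int2: "\<And>j x. integrable P (\<lambda>y. (d j x y)\<^sup>2)" "\<And>j x. (LINT y|P. (d j x y)\<^sup>2) \<le> v j x"
  shows "(\<integral>\<^sup>+x. ennreal (exp (\<Sum>j\<in>{1..n}. trunc1 (d j x (x j)) - 2 * v j x)) \<partial>Pn n) \<le> 1"
proof (induction n)
  case 0
  then show ?case by (simp add: PiM_empty nn_integral_count_space_finite)
next
  case (Suc n)
  have [measurable]: "(\<lambda>x. d j x (x j)) \<in> borel_measurable (Pn m)" if "j \<in> {1..m}" for j m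
    by (rule eval_measurable[OF measd]) (use that in auto)
  have mv[measurable]: "v j \<in> borel_measurable (Pn m)" if "j \<in> {1..m}" for j m
    using that by (intro measv) auto
  define S where "S m x = (\<Sum>j\<in>{1..m}. trunc1 (d j x (x j)) - 2 * v j x)" for m x
  have S_meas[measurable]: "S m \<in> borel_measurable (Pn m)" for m
    unfolding S_def by measurable
  \<comment> \<open>By adaptedness the first n terms do not see the new coordinate, and the last
    term reads it only as the second argument of \<open>d\<close>.\<close>
  have S_Suc: "S (Suc n) (x(Suc n := y)) = S n x + (trunc1 (d (Suc n) x y) - 2 * v (Suc n) x)" for x y
    by (simp add: S_def adaptd adaptv)
  have ins: "{1..Suc n} = insert (Suc n) {1..n}" by auto
  have step: "(\<integral>\<^sup>+y. ennreal (exp (S n x + (trunc1 (d (Suc n) x y) - 2 * v (Suc n) x))) \<partial>P) \<le> ennreal (exp (S n x))" for x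
  proof -
    let ?d = "d (Suc n) x" and ?v = "v (Suc n) x"
    have "(\<integral>\<^sup>+y. ennreal (exp (S n x + (trunc1 (?d y) - 2 * ?v))) \<partial>P)
        \<le> (\<integral>\<^sup>+y. ennreal (exp (S n x - 2 * ?v) * (1 + ?d y + 2 * (?d y)\<^sup>2)) \<partial>P)"
    proof (intro nn_integral_mono ennreal_leI)
      fix y
      have "exp (S n x + (trunc1 (?d y) - 2 * ?v)) = exp (S n x - 2 * ?v) * exp (trunc1 (?d y))"
        by (simp flip: exp_add add: algebra_simps)
      also have "\<dots> \<le> exp (S n x - 2 * ?v) * (1 + ?d y + 2 * (?d y)\<^sup>2)"
        by (intro mult_left_mono exp_trunc1_le) auto
      finally show "exp (S n x + (trunc1 (?d y) - 2 * ?v)) \<le> exp (S n x - 2 * ?v) * (1 + ?d y + 2 * (?d y)\<^sup>2)" .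
    qed
    also have "\<dots> = ennreal (LINT y|P. exp (S n x - 2 * ?v) * (1 + ?d y + 2 * (?d y)\<^sup>2))"
    proof (rule nn_integral_eq_integral)
      show "integrable P (\<lambda>y. exp (S n x - 2 * ?v) * (1 + ?d y + 2 * (?d y)\<^sup>2))"
        using int(1) int2(1) by auto
      show "AE y in P. 0 \<le> exp (S n x - 2 * ?v) * (1 + ?d y + 2 * (?d y)\<^sup>2)"
        using order_trans[OF exp_ge_zero exp_trunc1_le] by auto
    qed
    also have "(LINT y|P. exp (S n x - 2 * ?v) * (1 + ?d y + 2 * (?d y)\<^sup>2))
       = exp (S n x - 2 * ?v) * (1 + 2 * (LINT y|P. (?d y)\<^sup>2))"
      using int int2 by (simp add: prob_space[unfolded space_P])
    also have "\<dots> \<le> exp (S n x - 2 * ?v) * exp (2 * ?v)"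
      using int2(2)[of "Suc n" x] exp_ge_add_one_self[of "2 * ?v"]
      by (intro mult_left_mono) (auto simp del: exp_ge_add_one_self)
    also have "\<dots> = exp (S n x)" by (simp flip: exp_add)
    finally show ?thesis by (simp add: ennreal_leI)
  qed
  have "(\<integral>\<^sup>+x. ennreal (exp (S (Suc n) x)) \<partial>Pn (Suc n))
     = (\<integral>\<^sup>+x. \<integral>\<^sup>+y. ennreal (exp (S (Suc n) (x(Suc n := y)))) \<partial>P \<partial>Pn n)"
    unfolding ins
    by (intro PP.product_nn_integral_insert) (use S_meas[of "Suc n", measurable] in \<open>simp_all only: ins[symmetric], simp_all\<close>)
  also have "\<dots> \<le> (\<integral>\<^sup>+x. ennreal (exp (S n x)) \<partial>Pn n)"
    unfolding S_Suc by (intro nn_integral_mono step)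
  also have "\<dots> \<le> 1" using Suc by (simp add: S_def)
  finally show ?case by (simp add: S_def)
qed

text \<open>Markov's inequality for the exponential. There is no free parameter: the scale is put
  into \<open>d\<close> by the applications.\<close>

lemma supermartingale_tail:
  fixes d :: "nat \<Rightarrow> (nat \<Rightarrow> real) \<Rightarrow> real \<Rightarrow> real" and v :: "nat \<Rightarrow> (nat \<Rightarrow> real) \<Rightarrow> real"
  assumes measd: "\<And>j m. j \<le> Suc m \<Longrightarrow> (\<lambda>(x, y). d j x y) \<in> borel_measurable (Pn m \<Otimes>\<^sub>M P)"
    and measv: "\<And>j m. j \<le> Suc m \<Longrightarrow> v j \<in> borel_measurable (Pn m)"
    and adaptd: "\<And>j k x z y. j \<le> k \<Longrightarrow> d j (x(k := z)) y = d j x y"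
    and adaptv: "\<And>j k x z. j \<le> k \<Longrightarrow> v j (x(k := z)) = v j x"
    and int: "\<And>j x. integrable P (d j x)" "\<And>j x. (LINT y|P. d j x y) = 0"
    and int2: "\<And>j x. integrable P (\<lambda>y. (d j x y)\<^sup>2)" "\<And>j x. (LINT y|P. (d j x y)\<^sup>2) \<le> v j x"
  shows "whp (Pn n) (exp (- l))
     (\<lambda>x. (\<Sum>j\<in>{1..n}. trunc1 (d j x (x j))) \<le> 2 * (\<Sum>j\<in>{1..n}. v j x) + l)"
proof -
  let ?M = "Pn n"
  define S where "S x = (\<Sum>j\<in>{1..n}. trunc1 (d j x (x j)) - 2 * v j x)" for x
  have [measurable]: "(\<lambda>x. d j x (x j)) \<in> borel_measurable ?M" if "j \<in> {1..n}" for j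
    by (rule eval_measurable[OF measd]) (use that in auto)
  have [measurable]: "v j \<in> borel_measurable ?M" if "j \<in> {1..n}" for j
    using that by (intro measv) auto
  have [measurable]: "S \<in> borel_measurable ?M"
    unfolding S_def by measurable
  let ?N = "{x \<in> space ?M. 1 \<le> ennreal (exp (-l)) * ennreal (exp (S x))}"
  have "emeasure ?M ?N \<le> ennreal (exp (-l)) * (\<integral>\<^sup>+x. ennreal (exp (S x)) * indicator (space ?M) x \<partial>?M)"
    by (rule nn_integral_Markov_inequality) measurable
  also have "(\<integral>\<^sup>+x. ennreal (exp (S x)) * indicator (space ?M) x \<partial>?M) = (\<integral>\<^sup>+x. ennreal (exp (S x)) \<partial>?M)"
    by (intro nn_integral_cong) auto
  also have "ennreal (exp (-l)) * \<dots> \<le> ennreal (exp (-l)) * 1"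
    unfolding S_def by (intro mult_left_mono exp_supermartingale assms) auto
  finally have "emeasure ?M ?N \<le> ennreal (exp (-l))" by simp
  moreover have "?N \<in> sets ?M" by measurable
  moreover have "(\<Sum>j\<in>{1..n}. trunc1 (d j x (x j))) \<le> 2 * (\<Sum>j\<in>{1..n}. v j x) + l"
    if "x \<in> space ?M - ?N" for x
  proof -
    have "\<not> 1 \<le> ennreal (exp (-l)) * ennreal (exp (S x))" using that by auto
    then have "\<not> 1 \<le> exp (-l) * exp (S x)" by (simp flip: ennreal_mult ennreal_1)
    then have "exp (S x - l) < 1" by (simp add: exp_diff exp_minus field_simps)
    then have "S x < l" by simp
    then show ?thesis by (simp add: S_def sum_subtractf sum_distrib_left)
  qed
  ultimately show ?thesis unfolding whp_def by blast
qed

text \<open>Apply the martingale bound to the increments \<open>r * Z\<close>, set to zero off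
  \<open>J\<close>; since \<open>r * b \<le> 1\<close> the truncation does nothing. The parameter
  \<open>r\<close> stays free because it is tuned differently for the increments of the U-statistic
  and for the linear term.\<close>

lemma bernstein:
  assumes [measurable]: "Z \<in> borel_measurable borel"
    and Zb: "\<And>y. \<bar>Z y\<bar> \<le> b" and mean: "(LINT y|P. Z y) = 0"
    and var: "(LINT y|P. (Z y)\<^sup>2) \<le> v" and "0 < r" "r * b \<le> 1" "J \<subseteq> {1..n}"
  shows "whp (Pn n) (exp (- l))
     (\<lambda>x. (\<Sum>i\<in>J. Z (x i)) \<le> 2 * r * (real n * v) + l / r)"
proof -
  let ?d = "\<lambda>j (x :: nat \<Rightarrow> real) y. if j \<in> J then r * Z y else 0"
  have b0: "0 \<le> b" using Zb[of 0] by linarith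
  have Z2: "(Z y)\<^sup>2 \<le> b\<^sup>2" for y using Zb[of y] b0 by (metis abs_le_square_iff abs_of_nonneg)
  have "0 \<le> (LINT y|P. (Z y)\<^sup>2)" by simp
  then have v0: "0 \<le> v" using var by linarith
  have i1: "integrable P Z" by (rule integrable_const_bound[of _ b]) (use Zb in auto)
  have i2: "integrable P (\<lambda>y. (Z y)\<^sup>2)" by (rule integrable_const_bound[of _ "b\<^sup>2"]) (use Z2 in auto)
  have "whp (Pn n) (exp (- l))
     (\<lambda>x. (\<Sum>j\<in>{1..n}. trunc1 (?d j x (x j))) \<le> 2 * (\<Sum>j\<in>{1..n}. r\<^sup>2 * v) + l)"
  proof (rule supermartingale_tail)
    fix j :: nat and x :: "nat \<Rightarrow> real"
    show "integrable P (?d j x)" using i1 by (cases "j \<in> J") auto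
    show "(LINT y|P. ?d j x y) = 0" using mean by (cases "j \<in> J") auto
    show "integrable P (\<lambda>y. (?d j x y)\<^sup>2)" using i2 by (cases "j \<in> J") (auto simp: power_mult_distrib)
    show "(LINT y|P. (?d j x y)\<^sup>2) \<le> r\<^sup>2 * v"
      using var v0 by (cases "j \<in> J") (auto simp: power_mult_distrib mult_left_mono)
  qed auto
  then show ?thesis
  proof (rule whp_mono)
    fix x assume *: "(\<Sum>j\<in>{1..n}. trunc1 (?d j x (x j))) \<le> 2 * (\<Sum>j\<in>{1..n}. r\<^sup>2 * v) + l"
    have tr: "trunc1 (r * Z y) = r * Z y" for y
    proof -
      have "\<bar>r * Z y\<bar> \<le> r * b" using Zb[of y] \<open>0 < r\<close> by (simp add: abs_mult)
      then show ?thesis using assms(6) by (simp add: trunc1_def)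
    qed
    have "(\<Sum>j\<in>{1..n}. trunc1 (?d j x (x j))) = (\<Sum>j\<in>{1..n}. if j \<in> J then r * Z (x j) else 0)"
      by (intro sum.cong) (auto simp: tr, simp add: trunc1_def)
    also have "\<dots> = (\<Sum>j\<in>{1..n} \<inter> J. r * Z (x j))"
      by (simp add: sum.inter_restrict)
    also have "{1..n} \<inter> J = J" using assms(7) by auto
    finally have "r * (\<Sum>j\<in>J. Z (x j)) \<le> 2 * real n * (r\<^sup>2 * v) + l"
      using * by (simp add: sum_distrib_left)
    then have "(\<Sum>j\<in>J. Z (x j)) \<le> (2 * real n * (r\<^sup>2 * v) + l) / r"
      using \<open>0 < r\<close> by (simp add: pos_le_divide_eq mult.commute)
    also have "\<dots> = 2 * r * (real n * v) + l / r"
      using \<open>0 < r\<close> by (simp add: field_simps power2_eq_square)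
    finally show "(\<Sum>i\<in>J. Z (x i)) \<le> 2 * r * (real n * v) + l / r" .
  qed simp
qed

lemma bernstein_abs:
  assumes [measurable]: "Z \<in> borel_measurable borel"
    and Zb: "\<And>y. \<bar>Z y\<bar> \<le> b" and mean: "(LINT y|P. Z y) = 0"
    and var: "(LINT y|P. (Z y)\<^sup>2) \<le> v" and "0 < r" "r * b \<le> 1" "J \<subseteq> {1..n}"
  shows "whp (Pn n) (2 * exp (- l))
     (\<lambda>x. \<bar>\<Sum>i\<in>J. Z (x i)\<bar> \<le> 2 * r * (real n * v) + l / r)"
proof -
  have "whp (Pn n) (exp (- l) + exp (- l))
     (\<lambda>x. (\<Sum>i\<in>J. Z (x i)) \<le> 2 * r * (real n * v) + l / r \<and>
          (\<Sum>i\<in>J. - Z (x i)) \<le> 2 * r * (real n * v) + l / r)"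
    by (intro whp_conj bernstein[where b=b]) (use assms in auto)
  then show ?thesis
    by (rule whp_mono) (auto simp: sum_negf abs_le_iff)
qed

text \<open>Fubini with the coordinate \<open>j\<close> integrated last. It permits freezing
  \<open>x j\<close> at a value \<open>y\<close>, so that a sum over the other coordinates becomes a
  sum of independent variables.\<close>

lemma whp_decouple:
  fixes Q :: "real \<Rightarrow> (nat \<Rightarrow> real) \<Rightarrow> bool"
  assumes [measurable]: "Measurable.pred (P \<Otimes>\<^sub>M Pn n) (\<lambda>(y, x). Q y x)"
    and j: "j \<in> {1..n}" and indep: "\<And>x y z. Q y (x(j := z)) = Q y x"
    and whp: "\<And>y. whp (Pn n) \<epsilon> (Q y)"
  shows "whp (Pn n) \<epsilon> (\<lambda>x. Q (x j) x)"
proof -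
  let ?M = "Pn n" and ?M' = "PiM ({1..n} - {j}) (\<lambda>_. P)"
  let ?f = "\<lambda>y x. indicator {x. \<not> Q y x} x :: ennreal"
  have ins: "{1..n} = insert j ({1..n} - {j})" using j by auto
  have indep': "?f y (x(j := z)) = ?f y x" for x y z by (simp add: indep indicator_def)
  have m0: "Measurable.pred ?M (Q y)" for y
    using measurable_compose[OF _ assms(1), of "\<lambda>x. (y, x)" ?M] by simp
  have m1: "Measurable.pred ?M (\<lambda>x. Q (x j) x)"
  proof -
    have "(\<lambda>x. (x j, x)) \<in> ?M \<rightarrow>\<^sub>M P \<Otimes>\<^sub>M ?M" using j by measurable
    from measurable_compose[OF this assms(1)] show ?thesis by simp
  qed
  have m2: "?f y \<in> borel_measurable ?M" for y
    using m0[of y] by measurable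
  have m3: "(\<lambda>x. ?f (x j) x) \<in> borel_measurable ?M"
    using m1 by (simp add: indicator_def)
  have le: "(\<integral>\<^sup>+x. ?f y x \<partial>?M') \<le> ennreal \<epsilon>" for y
  proof -
    have "(\<integral>\<^sup>+x. ?f y x \<partial>?M') = (\<integral>\<^sup>+z. \<integral>\<^sup>+x. ?f y (x(j := z)) \<partial>?M' \<partial>P)"
      unfolding indep' by (simp add: emeasure_space_1[unfolded space_P])
    also have "\<dots> = (\<integral>\<^sup>+x. ?f y x \<partial>PiM (insert j ({1..n} - {j})) (\<lambda>_. P))"
      by (subst PP.product_nn_integral_insert_rev) (use m2[of y] ins in auto)
    also have "\<dots> = (\<integral>\<^sup>+x. ?f y x \<partial>?M)" using ins by simp
    also have "\<dots> = (\<integral>\<^sup>+x. indicator {x\<in>space ?M. \<not> Q y x} x \<partial>?M)"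
      by (intro nn_integral_cong) (auto simp: indicator_def)
    also have "\<dots> = emeasure ?M {x\<in>space ?M. \<not> Q y x}"
      using m0[of y] by (intro nn_integral_indicator sets.sets_Collect_neg) (simp add: pred_def)
    also have "\<dots> \<le> ennreal \<epsilon>"
    proof -
      obtain N where N: "N \<in> sets ?M" "emeasure ?M N \<le> ennreal \<epsilon>" "\<forall>x\<in>space ?M - N. Q y x"
        using whp[of y] by (auto simp: whp_def)
      have "emeasure ?M {x\<in>space ?M. \<not> Q y x} \<le> emeasure ?M N"
        by (intro emeasure_mono) (use N in auto)
      then show ?thesis using N by simp
    qed
    finally show ?thesis .
  qed
  have "emeasure ?M {x\<in>space ?M. \<not> Q (x j) x} = (\<integral>\<^sup>+x. indicator {x\<in>space ?M. \<not> Q (x j) x} x \<partial>?M)"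
    using m1 by (intro nn_integral_indicator[symmetric] sets.sets_Collect_neg) (simp add: pred_def)
  also have "\<dots> = (\<integral>\<^sup>+x. ?f (x j) x \<partial>?M)"
    by (intro nn_integral_cong) (auto simp: indicator_def)
  also have "\<dots> = (\<integral>\<^sup>+x. ?f (x j) x \<partial>PiM (insert j ({1..n} - {j})) (\<lambda>_. P))"
    using ins by simp
  also have "\<dots> = (\<integral>\<^sup>+z. \<integral>\<^sup>+x. ?f z (x(j := z)) \<partial>?M' \<partial>P)"
    by (subst PP.product_nn_integral_insert_rev) (use m3 ins in auto)
  also have "\<dots> \<le> (\<integral>\<^sup>+z. ennreal \<epsilon> \<partial>P)"
    unfolding indep' by (intro nn_integral_mono le)
  also have "\<dots> = ennreal \<epsilon>" by (simp add: emeasure_space_1[unfolded space_P])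
  finally show ?thesis
    unfolding whp_def using m1 by (intro bexI[of _ "{x\<in>space ?M. \<not> Q (x j) x}"]) auto
qed

end

section \<open>U-statistics of reproducing kernels\<close>

lemma integrable_mult_bounded:
  fixes u v :: "'a \<Rightarrow> real"
  assumes "integrable M u" "v \<in> borel_measurable M" "\<And>x. \<bar>v x\<bar> \<le> c"
  shows "integrable M (\<lambda>x. u x * v x)"
proof (rule Bochner_Integration.integrable_bound)
  show "integrable M (\<lambda>x. c * u x)" using assms(1) by simp
  show "AE x in M. norm (u x * v x) \<le> norm (c * u x)"
  proof (rule AE_I2)
    fix x
    have "\<bar>u x\<bar> * \<bar>v x\<bar> \<le> \<bar>u x\<bar> * \<bar>c\<bar>" using assms(3)[of x] by (intro mult_left_mono) auto
    then show "norm (u x * v x) \<le> norm (c * u x)" by (simp add: abs_mult mult.commute)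
  qed
qed (use assms in auto)

lemma lborel_Fubini_bounded:
  fixes w :: "real \<Rightarrow> real \<Rightarrow> real"
  assumes [measurable]: "(\<lambda>(x, y). w x y) \<in> borel_measurable (borel \<Otimes>\<^sub>M borel)"
    and u: "integrable lborel u" and v: "integrable lborel v"
    and le: "\<And>x y. \<bar>w x y\<bar> \<le> u x * v y"
  shows "(LINT y|lborel. LINT x|lborel. w x y) = (LINT x|lborel. LINT y|lborel. w x y)"
proof -
  note [measurable] = borel_measurable_integrable[OF u] borel_measurable_integrable[OF v]
  have "integrable (lborel \<Otimes>\<^sub>M lborel) (\<lambda>p. u (fst p) * v (snd p))"
  proof (rule lborel_pair.Fubini_integrable)
    show "integrable lborel (\<lambda>x. LINT y|lborel. norm (u (fst (x, y)) * v (snd (x, y))))"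
      using u by (simp add: abs_mult)
    show "AE x in lborel. integrable lborel (\<lambda>y. u (fst (x, y)) * v (snd (x, y)))"
      using v by simp
  qed measurable
  then have "integrable (lborel \<Otimes>\<^sub>M lborel) (\<lambda>(x, y). w x y)"
    by (rule Bochner_Integration.integrable_bound)
      (use le in \<open>auto intro!: AE_I2 order_trans[OF le] abs_ge_self\<close>)
  then show ?thesis by (rule lborel_pair.Fubini_integral)
qed

section \<open>Square integrable functions and closed spans\<close>

lemma is_density_integrable:
  assumes "is_density g" shows "integrable lborel g" "(LINT x|lborel. g x) = 1"
proof -
  have [measurable]: "g \<in> borel_measurable borel" and g: "\<And>x. 0 \<le> g x" "(\<integral>\<^sup>+x. ennreal (g x) \<partial>lborel) = 1"
    using assms by (auto simp: is_density_def)
  show "integrable lborel g"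
    using g by (intro integrableI_nonneg) auto
  show "(LINT x|lborel. g x) = 1"
    using g by (simp add: integral_eq_nn_integral)
qed

lemma L2_iff: "u \<in> L2 \<longleftrightarrow> u \<in> borel_measurable borel \<and> integrable lborel (\<lambda>x. (u x)\<^sup>2)"
  by (simp add: L2_def)

lemma L2_mult_integrable:
  assumes "u \<in> L2" "v \<in> L2"
  shows "integrable lborel (\<lambda>x. u x * v x)"
proof (rule Bochner_Integration.integrable_bound)
  show "integrable lborel (\<lambda>x. (u x)\<^sup>2 + (v x)\<^sup>2)" using assms by (simp add: L2_iff)
  show "AE x in lborel. norm (u x * v x) \<le> norm ((u x)\<^sup>2 + (v x)\<^sup>2)"
  proof (rule AE_I2)
    fix x
    have "2 * (\<bar>u x\<bar> * \<bar>v x\<bar>) \<le> (u x)\<^sup>2 + (v x)\<^sup>2"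
      using zero_le_power2[of "\<bar>u x\<bar> - \<bar>v x\<bar>"] by (simp add: power2_eq_square algebra_simps)
    moreover have "0 \<le> \<bar>u x\<bar> * \<bar>v x\<bar>" by simp
    ultimately have "\<bar>u x\<bar> * \<bar>v x\<bar> \<le> (u x)\<^sup>2 + (v x)\<^sup>2" by linarith
    then show "norm (u x * v x) \<le> norm ((u x)\<^sup>2 + (v x)\<^sup>2)" by (simp add: abs_mult)
  qed
qed (use assms in \<open>auto simp: L2_iff\<close>)

lemma L2_cmult: "u \<in> L2 \<Longrightarrow> (\<lambda>x. c * u x) \<in> L2"
  by (auto simp: L2_iff power_mult_distrib)

lemma L2_add:
  assumes "u \<in> L2" "v \<in> L2" shows "(\<lambda>x. u x + v x) \<in> L2"
proof -
  have "integrable lborel (\<lambda>x. (u x)\<^sup>2 + 2 * (u x * v x) + (v x)\<^sup>2)"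
    using L2_mult_integrable[OF assms] assms by (simp add: L2_iff)
  moreover have "(\<lambda>x. (u x)\<^sup>2 + 2 * (u x * v x) + (v x)\<^sup>2) = (\<lambda>x. (u x + v x)\<^sup>2)"
    by (simp add: power2_eq_square algebra_simps fun_eq_iff)
  ultimately show ?thesis using assms by (simp add: L2_iff borel_measurable_add)
qed

lemma L2_diff:
  assumes "u \<in> L2" "v \<in> L2" shows "(\<lambda>x. u x - v x) \<in> L2"
  using L2_add[OF assms(1) L2_cmult[OF assms(2), of "-1"]] by simp

lemma L2_sum:
  assumes "\<And>k. k \<in> F \<Longrightarrow> u k \<in> L2" shows "(\<lambda>x. \<Sum>k\<in>F. c k * u k x) \<in> L2"
  using assms
proof (induction F rule: infinite_finite_induct)
  case (insert k F)
  then show ?case using L2_add[OF L2_cmult, of "u k" _ "c k"] by simp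
qed (simp_all add: L2_iff)

lemma l2_norm_sq: "(l2_norm u)\<^sup>2 = (LINT x|lborel. (u x)\<^sup>2)"
  by (simp add: l2_norm_def)

text \<open>Pointwise, the square of \<open>t \<bar>u\<bar> - \<bar>v\<bar>\<close> is nonnegative.
  The free weight \<open>t\<close> does the work of the Cauchy-Schwarz inequality in the density
  argument that follows.\<close>

lemma abs_inner_le:
  assumes "u \<in> L2" "v \<in> L2" "0 < t"
  shows "\<bar>LINT x|lborel. u x * v x\<bar> \<le> t * (l2_norm u)\<^sup>2 + (l2_norm v)\<^sup>2 / t"
proof -
  have "\<bar>LINT x|lborel. u x * v x\<bar> \<le> (LINT x|lborel. \<bar>u x * v x\<bar>)" by (rule integral_abs_bound)
  also have "\<dots> \<le> (LINT x|lborel. t * (u x)\<^sup>2 + (v x)\<^sup>2 / t)"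
  proof (rule integral_mono)
    show "integrable lborel (\<lambda>x. \<bar>u x * v x\<bar>)" using L2_mult_integrable[OF assms(1,2)] by simp
    show "integrable lborel (\<lambda>x. t * (u x)\<^sup>2 + (v x)\<^sup>2 / t)" using assms by (simp add: L2_iff)
    fix x
    define p where "p = \<bar>u x\<bar>" define r where "r = \<bar>v x\<bar>"
    have p0: "0 \<le> p * r" by (simp add: p_def r_def)
    have "0 \<le> (t * p - r)\<^sup>2 / t" using assms(3) by simp
    also have "(t * p - r)\<^sup>2 / t = t * p\<^sup>2 - 2 * (p * r) + r\<^sup>2 / t"
      using assms(3) by (simp add: field_simps power2_eq_square)
    finally have "p * r \<le> t * p\<^sup>2 + r\<^sup>2 / t" using p0 by linarith
    then show "\<bar>u x * v x\<bar> \<le> t * (u x)\<^sup>2 + (v x)\<^sup>2 / t" by (simp add: p_def r_def abs_mult)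
  qed
  also have "\<dots> = t * (l2_norm u)\<^sup>2 + (l2_norm v)\<^sup>2 / t"
    using assms by (simp add: L2_iff l2_norm_sq)
  finally show ?thesis .
qed

text \<open>Replace \<open>u\<close> by a finite combination at distance less than \<open>t\<close>;
  the combination is orthogonal to \<open>r\<close>, and the weighted inequality with the same
  \<open>t\<close> bounds the rest by a multiple of \<open>t\<close>.\<close>

lemma inner_closed_span_eq_0:
  assumes r: "r \<in> L2" and e: "\<And>k. k \<in> I \<Longrightarrow> e k \<in> L2"
    and o: "\<And>k. k \<in> I \<Longrightarrow> (LINT x|lborel. r x * e k x) = 0"
    and u: "u \<in> L2_closed_span I e"
  shows "(LINT x|lborel. r x * u x) = 0"
proof -
  have le: "\<bar>LINT x|lborel. r x * u x\<bar> \<le> t * ((l2_norm r)\<^sup>2 + 1)" if t: "0 < t" for t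
  proof -
    obtain F c where F: "finite F" "F \<subseteq> I" "l2_norm (\<lambda>x. u x - (\<Sum>i\<in>F. c i * e i x)) < t"
      using u t by (auto simp: L2_closed_span_def)
    define S where "S x = (\<Sum>i\<in>F. c i * e i x)" for x
    have uL: "u \<in> L2" using u by (simp add: L2_closed_span_def)
    have SL: "S \<in> L2" unfolding S_def by (rule L2_sum) (use F e in auto)
    have "(LINT x|lborel. r x * S x) = (LINT x|lborel. (\<Sum>i\<in>F. c i * (r x * e i x)))"
      by (simp add: S_def sum_distrib_left mult_ac)
    also have "\<dots> = (\<Sum>i\<in>F. c i * (LINT x|lborel. r x * e i x))"
      using F L2_mult_integrable[OF r e] by (subst Bochner_Integration.integral_sum) (auto intro: integrable_mult_right)
    also have "\<dots> = 0" using F o by (intro sum.neutral) auto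
    finally have "(LINT x|lborel. r x * u x) = (LINT x|lborel. r x * (u x - S x))"
      using L2_mult_integrable[OF r uL] L2_mult_integrable[OF r SL] by (simp add: right_diff_distrib)
    also have "\<bar>\<dots>\<bar> \<le> t * (l2_norm r)\<^sup>2 + (l2_norm (\<lambda>x. u x - S x))\<^sup>2 / t"
      by (rule abs_inner_le[OF r L2_diff[OF uL SL] t])
    also have "(l2_norm (\<lambda>x. u x - S x))\<^sup>2 \<le> t\<^sup>2"
      using F(3) by (intro power_mono) (auto simp: S_def l2_norm_def)
    finally show ?thesis using t by (simp add: divide_right_mono power2_eq_square distrib_left)
  qed
  show ?thesis
  proof (rule ccontr)
    assume ne: "(LINT x|lborel. r x * u x) \<noteq> 0"
    define m where "m = (l2_norm r)\<^sup>2 + 1"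
    have m: "0 < m" by (simp add: m_def add_nonneg_pos)
    \<comment> \<open>This choice of \<open>t\<close> makes the inner product at most half of its
      own absolute value.\<close>
    have "\<bar>LINT x|lborel. r x * u x\<bar> \<le> \<bar>LINT x|lborel. r x * u x\<bar> / (2 * m) * m"
      using le[of "\<bar>LINT x|lborel. r x * u x\<bar> / (2 * m)"] ne m by (simp add: m_def)
    then show False using ne m by simp
  qed
qed

section \<open>Bounded densities and reproducing kernels\<close>

locale bounded_density =
  fixes f :: "real \<Rightarrow> real" and G :: real
  assumes dens: "is_density f" and f_le: "\<And>x. f x \<le> G"
begin

lemma f_meas [measurable]: "f \<in> borel_measurable borel" and f_ge: "0 \<le> f x"
  using dens by (auto simp: is_density_def)

lemma f_int: "integrable lborel f" "(LINT x|lborel. f x) = 1"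
  using is_density_integrable[OF dens] by auto

lemma f_abs: "\<bar>f x\<bar> \<le> G" using f_ge f_le by (simp add: abs_of_nonneg)

lemma G_pos: "0 < G"
proof (rule ccontr)
  assume "\<not> 0 < G"
  then have "f = (\<lambda>x. 0)" using f_ge f_le by (metis ext dual_order.trans linorder_not_less order_antisym_conv)
  then show False using f_int(2) by simp
qed

sublocale borel_prob "dens_measure f"
proof (intro borel_prob.intro prob_spaceI borel_prob_axioms.intro)
  show "emeasure (dens_measure f) (space (dens_measure f)) = 1"
    using dens by (simp add: dens_measure_def emeasure_density is_density_def)
  show "sets (dens_measure f) = sets borel" by (simp add: dens_measure_def)
qed

lemma integral_dens:
  "u \<in> borel_measurable borel \<Longrightarrow> (LINT x|dens_measure f. u x) = (LINT x|lborel. f x * u x)"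
  unfolding dens_measure_def by (subst integral_density) (auto simp: f_ge)

lemma f_sq_int: "integrable lborel (\<lambda>x. (f x)\<^sup>2)"
  unfolding power2_eq_square by (rule integrable_mult_bounded[OF f_int(1) _ f_abs]) auto

lemma f_L2: "f \<in> L2"
  using f_sq_int by (simp add: L2_iff)

lemma integral_f_mult_le:
  assumes "integrable lborel u" "\<And>x. 0 \<le> u x"
  shows "(LINT x|lborel. f x * u x) \<le> G * (LINT x|lborel. u x)"
proof -
  have [measurable]: "u \<in> borel_measurable borel" using borel_measurable_integrable[OF assms(1)] by simp
  have i: "integrable lborel (\<lambda>x. f x * u x)"
    using integrable_mult_bounded[of lborel u f G] assms(1) f_abs by (simp add: mult.commute)
  have "(LINT x|lborel. f x * u x) \<le> (LINT x|lborel. G * u x)"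
    by (rule integral_mono) (use i assms f_le in \<open>auto intro!: mult_right_mono\<close>)
  then show ?thesis by simp
qed

end

text \<open>Symmetry and \<open>k_repro\<close> are those of the kernel of an orthogonal projection.
  Two sizes are kept apart: the uniform bound \<open>A\<close>, which will grow with the level, and
  the bound \<open>B\<close> on the L1 norms of the rows, which will not.\<close>

locale repro_kernel = bounded_density f G for f G +
  fixes \<kappa> :: "real \<Rightarrow> real \<Rightarrow> real" and A B :: real
  assumes k_meas: "(\<lambda>(x, y). \<kappa> x y) \<in> borel_measurable (borel \<Otimes>\<^sub>M borel)"
    and k_sym: "\<kappa> x y = \<kappa> y x"
    and A_pos: "0 < A" and k_le: "\<bar>\<kappa> x y\<bar> \<le> A"
    and k_int: "integrable lborel (\<kappa> x)"
    and k_L1: "(LINT y|lborel. \<bar>\<kappa> x y\<bar>) \<le> B"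
    and k_repro: "(LINT z|lborel. \<kappa> x z * \<kappa> z y) = \<kappa> x y"
begin

lemma k_meas2 [measurable]:
  assumes "u \<in> borel_measurable M" "v \<in> borel_measurable M"
  shows "(\<lambda>x. \<kappa> (u x) (v x)) \<in> borel_measurable M"
proof -
  have "(\<lambda>x. (u x, v x)) \<in> M \<rightarrow>\<^sub>M borel \<Otimes>\<^sub>M borel" using assms by measurable
  from measurable_compose[OF this k_meas] show ?thesis by simp
qed

lemma B_nonneg: "0 \<le> B"
  by (rule order_trans[OF Bochner_Integration.integral_nonneg k_L1]) auto

text \<open>The projection of \<open>f\<close>; that it is the orthogonal projection onto the
  wavelet space is shown later.\<close>

definition q :: "real \<Rightarrow> real" where "q y = (LINT x|lborel. f x * \<kappa> x y)"

lemma q_meas [measurable]: "q \<in> borel_measurable borel"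
  unfolding q_def by measurable

text \<open>The bound uses the rows in L1 and \<open>f \<le> G\<close> instead of \<open>A\<close>,
  and is therefore uniform over levels.\<close>

lemma q_abs: "\<bar>q y\<bar> \<le> G * B"
proof -
  have k: "integrable lborel (\<lambda>x. \<bar>\<kappa> x y\<bar>)" using k_int[of y] by (simp add: k_sym[of _ y])
  have "\<bar>q y\<bar> \<le> (LINT x|lborel. \<bar>f x * \<kappa> x y\<bar>)"
    unfolding q_def by (rule integral_abs_bound)
  also have "\<dots> = (LINT x|lborel. f x * \<bar>\<kappa> x y\<bar>)" by (simp add: abs_mult f_ge)
  also have "\<dots> \<le> G * (LINT x|lborel. \<bar>\<kappa> x y\<bar>)" by (rule integral_f_mult_le[OF k]) auto
  also have "\<dots> \<le> G * B"
    using k_L1[of y] G_pos by (intro mult_left_mono) (auto simp: k_sym[of _ y])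
  finally show ?thesis .
qed

text \<open>Fubini and the L1 bound on the rows. The function \<open>u\<close> is arbitrary because
  the lemma also serves for the tail of a density when its projection is approximated by finite
  sums.\<close>

lemma kernel_operator_L1:
  assumes u: "integrable lborel u" "\<And>x. 0 \<le> u x"
  shows "integrable lborel (\<lambda>y. LINT x|lborel. u x * \<kappa> x y)"
    and "(LINT y|lborel. \<bar>LINT x|lborel. u x * \<kappa> x y\<bar>) \<le> B * (LINT x|lborel. u x)"
proof -
  have [measurable]: "u \<in> borel_measurable borel" using borel_measurable_integrable[OF u(1)] by simp
  have i: "integrable lborel (\<lambda>x. u x * (LINT y|lborel. \<bar>\<kappa> x y\<bar>))"
    by (rule integrable_mult_bounded[OF u(1), where c=B]) (use k_L1 in auto)
  have p: "integrable (lborel \<Otimes>\<^sub>M lborel) (\<lambda>(x, y). u x * \<kappa> x y)"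
  proof (rule lborel_pair.Fubini_integrable)
    show "integrable lborel (\<lambda>x. LINT y|lborel. norm (case (x, y) of (x, y) \<Rightarrow> u x * \<kappa> x y))"
      using i by (simp add: abs_mult u)
    show "AE x in lborel. integrable lborel (\<lambda>y. case (x, y) of (x, y) \<Rightarrow> u x * \<kappa> x y)"
      using k_int by simp
  qed measurable
  from lborel_pair.integrable_snd[OF p] show 1: "integrable lborel (\<lambda>y. LINT x|lborel. u x * \<kappa> x y)" by simp
  have p': "integrable (lborel \<Otimes>\<^sub>M lborel) (\<lambda>(x, y). u x * \<bar>\<kappa> x y\<bar>)"
    using integrable_abs[OF p] by (simp add: case_prod_unfold abs_mult u)
  have "(LINT y|lborel. \<bar>LINT x|lborel. u x * \<kappa> x y\<bar>) \<le> (LINT y|lborel. LINT x|lborel. u x * \<bar>\<kappa> x y\<bar>)"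
  proof (rule integral_mono)
    show "integrable lborel (\<lambda>y. \<bar>LINT x|lborel. u x * \<kappa> x y\<bar>)" using 1 by simp
    show "integrable lborel (\<lambda>y. LINT x|lborel. u x * \<bar>\<kappa> x y\<bar>)"
      using lborel_pair.integrable_snd[OF p'] by simp
    fix y
    have "\<bar>LINT x|lborel. u x * \<kappa> x y\<bar> \<le> (LINT x|lborel. \<bar>u x * \<kappa> x y\<bar>)" by (rule integral_abs_bound)
    then show "\<bar>LINT x|lborel. u x * \<kappa> x y\<bar> \<le> (LINT x|lborel. u x * \<bar>\<kappa> x y\<bar>)" by (simp add: abs_mult u)
  qed
  also have "\<dots> = (LINT x|lborel. LINT y|lborel. u x * \<bar>\<kappa> x y\<bar>)"
    by (rule lborel_pair.Fubini_integral[OF p'])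
  also have "\<dots> = (LINT x|lborel. u x * (LINT y|lborel. \<bar>\<kappa> x y\<bar>))" by simp
  also have "\<dots> \<le> (LINT x|lborel. u x * B)"
    by (rule integral_mono[OF i]) (use u k_L1 in \<open>auto intro: mult_left_mono\<close>)
  also have "\<dots> = B * (LINT x|lborel. u x)" by simp
  finally show "(LINT y|lborel. \<bar>LINT x|lborel. u x * \<kappa> x y\<bar>) \<le> B * (LINT x|lborel. u x)" .
qed

lemma q_int: "integrable lborel q"
  using kernel_operator_L1(1)[OF f_int(1) f_ge] by (simp add: q_def[abs_def])

lemma q_L2: "q \<in> L2"
  unfolding L2_iff power2_eq_square using integrable_mult_bounded[OF q_int _ q_abs] by simp

text \<open>The kernel operator is self-adjoint. With a row of the kernel for \<open>u\<close> this
  yields idempotence (\<open>k_q\<close>), and with \<open>q\<close> itself it identifies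
  \<open>\<theta>\<close> with the squared norm of \<open>q\<close>.\<close>

lemma q_adjoint:
  assumes u: "integrable lborel u"
  shows "(LINT y|lborel. u y * q y) = (LINT x|lborel. f x * (LINT y|lborel. \<kappa> x y * u y))"
proof -
  have [measurable]: "u \<in> borel_measurable borel" using borel_measurable_integrable[OF u] by simp
  have "(LINT y|lborel. u y * q y) = (LINT y|lborel. LINT x|lborel. u y * (f x * \<kappa> x y))"
    by (simp add: q_def)
  also have "\<dots> = (LINT x|lborel. LINT y|lborel. u y * (f x * \<kappa> x y))"
  proof (rule lborel_Fubini_bounded[of "\<lambda>x y. u y * (f x * \<kappa> x y)" f "\<lambda>y. A * \<bar>u y\<bar>"])
    show "\<bar>u y * (f x * \<kappa> x y)\<bar> \<le> f x * (A * \<bar>u y\<bar>)" for x y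
    proof -
      have "\<bar>u y * (f x * \<kappa> x y)\<bar> = (f x * \<bar>u y\<bar>) * \<bar>\<kappa> x y\<bar>"
        by (simp add: abs_mult f_ge)
      also have "\<dots> \<le> (f x * \<bar>u y\<bar>) * A" by (intro mult_left_mono k_le mult_nonneg_nonneg f_ge) auto
      finally show ?thesis by (simp add: mult_ac)
    qed
  qed (use f_int u in auto)
  also have "\<dots> = (LINT x|lborel. f x * (LINT y|lborel. \<kappa> x y * u y))"
    by (simp add: mult_ac)
  finally show ?thesis .
qed

lemma k_q: "(LINT y|lborel. \<kappa> x y * q y) = q x"
  using q_adjoint[OF k_int[of x]] by (simp only: k_sym[of x] k_repro q_def)

definition \<theta> :: real where "\<theta> = (LINT x|lborel. f x * q x)"

lemma q_sq: "(LINT y|lborel. (q y)\<^sup>2) = \<theta>"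
  using q_adjoint[OF q_int] by (simp add: power2_eq_square k_q \<theta>_def)

lemma f_bdd_int: "u \<in> borel_measurable borel \<Longrightarrow> (\<And>x. \<bar>u x\<bar> \<le> c) \<Longrightarrow> integrable lborel (\<lambda>x. f x * u x)"
  by (rule integrable_mult_bounded[OF f_int(1)]) auto

lemma f_bdd_integral_abs_le:
  assumes [measurable]: "u \<in> borel_measurable borel" and u: "\<And>x. \<bar>u x\<bar> \<le> c"
  shows "\<bar>LINT x|lborel. f x * u x\<bar> \<le> c"
proof -
  have "\<bar>LINT x|lborel. f x * u x\<bar> \<le> (LINT x|lborel. \<bar>f x * u x\<bar>)"
    by (rule integral_abs_bound)
  also have "\<dots> \<le> (LINT x|lborel. f x * c)"
  proof (rule integral_mono)
    show "integrable lborel (\<lambda>x. \<bar>f x * u x\<bar>)" using f_bdd_int[of u c] u by auto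
    show "integrable lborel (\<lambda>x. f x * c)" using f_int by auto
    show "\<bar>f x * u x\<bar> \<le> f x * c" for x
      using u[of x] by (simp add: abs_mult f_ge mult_left_mono)
  qed
  also have "\<dots> = c" using f_int by simp
  finally show ?thesis .
qed

lemma \<theta>_nonneg: "0 \<le> \<theta>" by (simp flip: q_sq)

lemma \<theta>_le: "\<theta> \<le> G * B"
  using f_bdd_integral_abs_le[OF q_meas q_abs] by (simp add: \<theta>_def)

text \<open>The degenerate part of \<open>\<kappa>\<close> in the Hoeffding decomposition under
  \<open>f\<close>.\<close>

definition h :: "real \<Rightarrow> real \<Rightarrow> real" where "h x y = \<kappa> x y - q x - q y + \<theta>"

text \<open>A uniform bound on \<open>h\<close>: \<open>A\<close> for the kernel, and
  \<open>G * B\<close> for each of the two values of \<open>q\<close> and for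
  \<open>\<theta>\<close>.\<close>

definition H :: real where "H = A + 3 * (G * B)"

lemma h_meas [measurable]:
  assumes [measurable]: "u \<in> borel_measurable M" "v \<in> borel_measurable M"
  shows "(\<lambda>x. h (u x) (v x)) \<in> borel_measurable M"
  unfolding h_def by measurable

lemma GB_nonneg: "0 \<le> G * B" using G_pos B_nonneg by simp

lemma H_pos: "0 < H" using A_pos GB_nonneg by (simp add: H_def)

lemma h_abs: "\<bar>h x y\<bar> \<le> H"
  using k_le[of x y] q_abs[of x] q_abs[of y] \<theta>_nonneg \<theta>_le by (auto simp: h_def H_def)

lemma h_sym: "h x y = h y x" by (simp add: h_def k_sym)

lemma f_k: "(LINT y|lborel. f y * \<kappa> x y) = q x"
  by (simp add: q_def k_sym[of x])

lemma f_h: "(LINT y|lborel. f y * h x y) = 0"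
proof -
  have i: "integrable lborel (\<lambda>y. f y * \<kappa> x y)" "integrable lborel (\<lambda>y. f y * q y)"
    using f_bdd_int[of "\<kappa> x" A] k_le f_bdd_int[of q "G * B"] q_abs by auto
  have "(LINT y|lborel. f y * h x y) = (LINT y|lborel. f y * \<kappa> x y - f y * q x - f y * q y + f y * \<theta>)"
    by (simp add: h_def algebra_simps)
  also have "\<dots> = q x - q x - \<theta> + \<theta>"
    using i f_int by (simp add: f_k \<theta>_def)
  finally show ?thesis by simp
qed

text \<open>Expanding the product, the reproducing property and idempotence of the projection
  evaluate all four terms. So \<open>h\<close> is a Gram kernel with respect to Lebesgue
  measure.\<close>

lemma kq_prod:
  "integrable lborel (\<lambda>y. (\<kappa> x y - q y) * (\<kappa> x' y - q y))"
  "(LINT y|lborel. (\<kappa> x y - q y) * (\<kappa> x' y - q y)) = h x x'"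
proof -
  have b: "\<bar>\<kappa> x' y - q y\<bar> \<le> A + G * B" for x' y
    using k_le[of x' y] q_abs[of y] by linarith
  show "integrable lborel (\<lambda>y. (\<kappa> x y - q y) * (\<kappa> x' y - q y))"
    by (rule integrable_mult_bounded[OF _ _ b]) (use k_int q_int in auto)
  have i: "integrable lborel (\<lambda>y. \<kappa> x y * \<kappa> y x')" "integrable lborel (\<lambda>y. \<kappa> x y * q y)"
      "integrable lborel (\<lambda>y. \<kappa> x' y * q y)" "integrable lborel (\<lambda>y. (q y)\<^sup>2)"
    unfolding power2_eq_square
    by (rule integrable_mult_bounded[OF k_int _ k_le], simp,
        (rule integrable_mult_bounded[OF k_int _ q_abs], simp)+,
        rule integrable_mult_bounded[OF q_int _ q_abs], simp)
  have "(LINT y|lborel. (\<kappa> x y - q y) * (\<kappa> x' y - q y))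
      = (LINT y|lborel. \<kappa> x y * \<kappa> y x' - \<kappa> x y * q y - \<kappa> x' y * q y + (q y)\<^sup>2)"
    by (simp add: k_sym[of x'] algebra_simps power2_eq_square)
  also have "\<dots> = \<kappa> x x' - q x - q x' + \<theta>"
    using i by (simp add: k_repro k_q q_sq)
  finally show "(LINT y|lborel. (\<kappa> x y - q y) * (\<kappa> x' y - q y)) = h x x'" by (simp add: h_def)
qed

text \<open>
  The left-hand side is the conditional variance of an increment of the U-statistic, the right-hand
  side is, up to its diagonal, the U-statistic itself. This is where the reproducing property enters.
\<close>

lemma h_sum_sq_le:
  assumes "finite I"
  shows "(LINT y|lborel. f y * (\<Sum>i\<in>I. h (x i) y)\<^sup>2) \<le> G * (\<Sum>i\<in>I. \<Sum>i'\<in>I. h (x i) (x i'))"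
proof -
  define F where "F y = (\<Sum>i\<in>I. \<kappa> (x i) y - q y)" for y
  have [measurable]: "F \<in> borel_measurable borel" unfolding F_def by measurable
  have b: "\<bar>\<kappa> x' y - q y\<bar> \<le> A + G * B" for x' y
    using k_le[of x' y] q_abs[of y] by linarith
  have Fb: "\<bar>F y\<bar> \<le> real (card I) * (A + G * B)" for y
    unfolding F_def by (rule order_trans[OF sum_abs]) (use sum_bounded_above[of I _ "A + G * B"] b in simp)
  have Fb2: "\<bar>(F y)\<^sup>2\<bar> \<le> (real (card I) * (A + G * B))\<^sup>2" for y
    using Fb[of y] by (simp add: abs_le_square_iff[symmetric])
  \<comment> \<open>The mean of \<open>F\<close> under \<open>f\<close>. Hence the integral to be
    bounded is the variance of \<open>F\<close>, which is at most its second moment; then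
    \<open>f \<le> G\<close> passes to Lebesgue measure, where the Gram identity applies.\<close>
  define e where "e = (\<Sum>i\<in>I. q (x i) - \<theta>)"
  have hF: "(\<Sum>i\<in>I. h (x i) y) = F y - e" for y
    by (simp add: F_def e_def h_def sum_subtractf sum.distrib)
  have iF: "integrable lborel (\<lambda>y. f y * F y)" "integrable lborel (\<lambda>y. f y * (F y)\<^sup>2)"
    by (rule f_bdd_int[OF _ Fb], simp) (rule f_bdd_int[OF _ Fb2], simp)
  have "(LINT y|lborel. f y * F y) = e"
  proof -
    have "(LINT y|lborel. f y * F y) = (\<Sum>i\<in>I. LINT y|lborel. f y * \<kappa> (x i) y - f y * q y)"
    proof -
      have "integrable lborel (\<lambda>y. f y * \<kappa> (x i) y - f y * q y)" for i
        using f_bdd_int[of "\<kappa> (x i)" A] k_le f_bdd_int[of q "G * B"] q_abs by auto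
      then show ?thesis
        by (simp add: F_def sum_distrib_left right_diff_distrib Bochner_Integration.integral_sum)
    qed
    also have "\<dots> = e"
      unfolding e_def
    proof (intro sum.cong refl)
      fix i
      show "(LINT y|lborel. f y * \<kappa> (x i) y - f y * q y) = q (x i) - \<theta>"
        using f_bdd_int[of "\<kappa> (x i)" A] k_le f_bdd_int[of q "G * B"] q_abs by (simp add: f_k \<theta>_def)
    qed
    finally show ?thesis .
  qed
  then have "(LINT y|lborel. f y * (\<Sum>i\<in>I. h (x i) y)\<^sup>2) = (LINT y|lborel. f y * (F y)\<^sup>2) - e\<^sup>2"
  proof -
    have "(LINT y|lborel. f y * (\<Sum>i\<in>I. h (x i) y)\<^sup>2)
       = (LINT y|lborel. f y * (F y)\<^sup>2 - 2 * e * (f y * F y) + e\<^sup>2 * f y)"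
      unfolding hF by (simp add: power2_eq_square algebra_simps)
    also have "\<dots> = (LINT y|lborel. f y * (F y)\<^sup>2) - e\<^sup>2"
      using iF f_int \<open>(LINT y|lborel. f y * F y) = e\<close> by (simp add: power2_eq_square)
    finally show ?thesis .
  qed
  also have "\<dots> \<le> (LINT y|lborel. f y * (F y)\<^sup>2)" by simp
  also have "\<dots> \<le> G * (LINT y|lborel. (F y)\<^sup>2)"
  proof (rule integral_f_mult_le)
    show "integrable lborel (\<lambda>y. (F y)\<^sup>2)"
      using kq_prod(1) by (simp add: F_def power2_eq_square sum_product)
  qed auto
  also have "(LINT y|lborel. (F y)\<^sup>2) = (\<Sum>i\<in>I. \<Sum>i'\<in>I. h (x i) (x i'))"
    using kq_prod by (simp add: F_def power2_eq_square sum_product Bochner_Integration.integral_sum)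
  finally show ?thesis .
qed

definition U :: "nat \<Rightarrow> (nat \<Rightarrow> real) \<Rightarrow> real" where
  "U j x = (\<Sum>i\<in>{1..j}. \<Sum>k\<in>{1..<i}. h (x k) (x i))"

lemma U_Suc: "U (Suc j) x = U j x + (\<Sum>k\<in>{1..j}. h (x k) (x (Suc j)))"
proof -
  have e: "{1..<Suc j} = {1..j}" by auto
  show ?thesis by (simp only: U_def sum.cl_ivl_Suc e) simp
qed

text \<open>The identity that closes the bootstrap: the quadratic form bounding the variance of the
  next increment is a diagonal, at most \<open>j * H\<close>, plus twice the current value of the
  U-statistic.\<close>

lemma double_sum_U:
  "(\<Sum>i\<in>{1..j}. \<Sum>k\<in>{1..j}. h (x i) (x k)) = (\<Sum>i\<in>{1..j}. h (x i) (x i)) + 2 * U j x"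
proof (induction j)
  case 0 then show ?case by (simp add: U_def)
next
  case (Suc j)
  have "(\<Sum>i\<in>{1..Suc j}. \<Sum>k\<in>{1..Suc j}. h (x i) (x k))
     = (\<Sum>i\<in>{1..j}. \<Sum>k\<in>{1..j}. h (x i) (x k)) + 2 * (\<Sum>k\<in>{1..j}. h (x k) (x (Suc j))) + h (x (Suc j)) (x (Suc j))"
  proof -
    have "(\<Sum>k\<in>{1..j}. h (x (Suc j)) (x k)) = (\<Sum>k\<in>{1..j}. h (x k) (x (Suc j)))"
      by (intro sum.cong h_sym refl)
    then show ?thesis by (simp add: sum.distrib)
  qed
  then show ?case using Suc by (simp add: U_Suc)
qed

end

lemma abs_square_le: "\<bar>x :: real\<bar> \<le> c \<Longrightarrow> \<bar>x\<^sup>2\<bar> \<le> c\<^sup>2"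
  using power_mono[of "\<bar>x\<bar>" c 2] by simp

section \<open>Deviation of the degenerate U-statistic\<close>

context repro_kernel
begin

lemma sample_law_f: "sample_law n f = Pn n"
  by (simp add: sample_law_def)

text \<open>With \<open>x j\<close> frozen at \<open>y\<close>, the terms \<open>h (x k) y\<close>
  are independent, centred, bounded by \<open>H\<close>, and have variance at most
  \<open>G * H\<close>, so Bernstein's inequality applies.\<close>

lemma increment_dev:
  assumes "0 < l" "j \<in> {1..n}"
  shows "whp (sample_law n f) (2 * exp (- l))
     (\<lambda>x. \<bar>\<Sum>k\<in>{1..<j}. h (x k) (x j)\<bar> \<le> 3 * sqrt (n * G * H * l) + l * H)"
  unfolding sample_law_f
proof (rule whp_decouple[where j=j and Q="\<lambda>y x. \<bar>\<Sum>k\<in>{1..<j}. h (x k) y\<bar> \<le> 3 * sqrt (n * G * H * l) + l * H"])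
  have n: "0 < real n" using assms by auto
  define w where "w = n * G * H"
  have w: "0 < w" using n G_pos H_pos by (simp add: w_def)
  \<comment> \<open>The \<open>H\<close> in the denominator ensures \<open>r * H \<le> 1\<close>.
    The other summand is the order \<open>sqrt (w / l)\<close> that balances \<open>2 r w\<close>
    with \<open>l / r\<close>; each of them is then controlled by multiples of
    \<open>sqrt (w l)\<close>, up to \<open>l * H\<close>.\<close>
  define r where "r = 1 / (H + sqrt (w / l))"
  have sw: "0 < sqrt (w / l)" using w assms by simp
  have r: "0 < r" "r * H \<le> 1" using H_pos sw by (auto simp: r_def simp del: real_sqrt_gt_0_iff intro!: add_pos_pos divide_le_eq_1_pos[THEN iffD2] less_imp_le[OF sw, simplified])
  have bd: "2 * r * (real n * (G * H)) + l / r \<le> 3 * sqrt (n * G * H * l) + l * H"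
  proof -
    have "r * w \<le> 1 / sqrt (w / l) * w"
      unfolding r_def using H_pos sw w by (intro mult_right_mono divide_left_mono mult_pos_pos add_pos_pos) auto
    also have "\<dots> = sqrt (w * l)"
      using w assms by (simp add: real_sqrt_divide real_sqrt_mult field_simps)
    finally have 1: "r * w \<le> sqrt (w * l)" .
    have "l / r = l * H + l * sqrt (w / l)" by (simp add: r_def algebra_simps)
    also have "l * sqrt (w / l) = sqrt (w * l)"
      using w assms by (simp add: real_sqrt_divide real_sqrt_mult field_simps)
    finally have 2: "l / r = l * H + sqrt (w * l)" .
    show ?thesis using 1 2 by (simp add: w_def mult_ac)
  qed
  show "whp (Pn n) (2 * exp (- l))
     (\<lambda>x. \<bar>\<Sum>k\<in>{1..<j}. h (x k) y\<bar> \<le> 3 * sqrt (n * G * H * l) + l * H)" for y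
  proof (rule whp_mono[OF bernstein_abs[where Z = "\<lambda>x. h x y" and b = H and v = "G * H" and r = r and J = "{1..<j}"]])
    show "(LINT x|dens_measure f. h x y) = 0"
      by (subst integral_dens) (simp_all add: h_sym[of _ y] f_h)
    \<comment> \<open>The Gram bound for a single point gives \<open>G * h y y\<close>, one factor
      of \<open>H\<close> instead of two.\<close>
    have "(LINT x|dens_measure f. (h x y)\<^sup>2) = (LINT x|lborel. f x * (\<Sum>i\<in>{0::nat}. h y x)\<^sup>2)"
      by (subst integral_dens) (simp_all add: h_sym[of _ y])
    also have "\<dots> \<le> G * h y y"
      using h_sum_sq_le[of "{0::nat}" "\<lambda>_. y"] by simp
    also have "\<dots> \<le> G * H" using h_abs[of y y] G_pos by (intro mult_left_mono) auto
    finally show "(LINT x|dens_measure f. (h x y)\<^sup>2) \<le> G * H" .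
  qed (use r h_abs assms bd in auto)
  show "Measurable.pred (dens_measure f \<Otimes>\<^sub>M Pn n)
     (\<lambda>(y, x). \<bar>\<Sum>k\<in>{1..<j}. h (x k) y\<bar> \<le> 3 * sqrt (n * G * H * l) + l * H)"
  proof -
    have "(\<lambda>p. h (snd p k) (fst p)) \<in> borel_measurable (dens_measure f \<Otimes>\<^sub>M Pn n)"
      if "k \<in> {1..<j}" for k
    proof -
      have "(\<lambda>p. snd p k) \<in> dens_measure f \<Otimes>\<^sub>M Pn n \<rightarrow>\<^sub>M dens_measure f"
        by (rule measurable_compose[OF measurable_snd measurable_component_singleton]) (use that assms in auto)
      then have "(\<lambda>p. snd p k) \<in> dens_measure f \<Otimes>\<^sub>M Pn n \<rightarrow>\<^sub>M borel"
        by (simp only: measurable_cong_sets[OF refl sets_P])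
      then show ?thesis by (intro h_meas) auto
    qed
    then show ?thesis unfolding case_prod_beta by measurable
  qed
qed (use assms in \<open>auto intro!: arg_cong2[where f="(\<le>)"] arg_cong[where f=abs] sum.cong\<close>)

text \<open>The sign \<open>s\<close> gives both tails. Increments after time \<open>j\<close> are
  set to zero, so that every partial sum \<open>U j\<close> is controlled on the common sample space
  of size \<open>n\<close>, as the induction over \<open>j\<close> requires.\<close>

lemma U_supermartingale:
  assumes "0 < b" "\<bar>s\<bar> = 1"
  shows "whp (sample_law n f) (exp (- l))
     (\<lambda>x. (\<Sum>i\<in>{1..n}. if i \<le> j then trunc1 (s * (\<Sum>k\<in>{1..<i}. h (x k) (x i)) / b) else 0)
        \<le> 2 * (\<Sum>i\<in>{1..n}. if i \<le> j then G * (\<Sum>k\<in>{1..<i}. \<Sum>k'\<in>{1..<i}. h (x k) (x k')) / b\<^sup>2 else 0) + l)"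
proof -
  have comp: "(\<lambda>p. fst p k) \<in> Pn m \<Otimes>\<^sub>M dens_measure f \<rightarrow>\<^sub>M borel"
    if "k \<in> {1..<i}" "i \<le> Suc m" for k i m :: nat
  proof -
    have "(\<lambda>p. fst p k) \<in> Pn m \<Otimes>\<^sub>M dens_measure f \<rightarrow>\<^sub>M dens_measure f"
      by (rule measurable_compose[OF measurable_fst measurable_component_singleton]) (use that in auto)
    then show ?thesis by (simp only: measurable_cong_sets[OF refl sets_P])
  qed
  have comp': "(\<lambda>x. x k) \<in> Pn m \<rightarrow>\<^sub>M borel"
    if "k \<in> {1..<i}" "i \<le> Suc m" for k i m :: nat
  proof -
    have "(\<lambda>x. x k) \<in> Pn m \<rightarrow>\<^sub>M dens_measure f"
      by (rule measurable_component_singleton) (use that in auto)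
    then show ?thesis by (simp only: measurable_cong_sets[OF refl sets_P])
  qed
  define d where "d i x y = (if i \<le> j then s * (\<Sum>k\<in>{1..<i}. h (x k) y) / b else 0)" for i x y
  define v where "v i x = (if i \<le> j then G * (\<Sum>k\<in>{1..<i}. \<Sum>k'\<in>{1..<i}. h (x k) (x k')) / b\<^sup>2 else 0)" for i x
  have Sb: "\<bar>\<Sum>k\<in>{1..<i}. h (x k) y\<bar> \<le> real (card {1..<i}) * H" for i y and x :: "nat \<Rightarrow> real"
    by (rule order_trans[OF sum_abs]) (use sum_bounded_above[of "{1..<i}" _ H] h_abs in simp)
  have Sb2: "\<bar>(\<Sum>k\<in>{1..<i}. h (x k) y)\<^sup>2\<bar> \<le> (real (card {1..<i}) * H)\<^sup>2" for i y and x :: "nat \<Rightarrow> real"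
    by (rule abs_square_le[OF Sb])
  have s2: "s\<^sup>2 = 1" using power2_abs[of s] assms(2) by simp
  have d2: "(d i x y)\<^sup>2 = (if i \<le> j then (\<Sum>k\<in>{1..<i}. h (x k) y)\<^sup>2 / b\<^sup>2 else 0)" for i x y
    by (simp add: d_def power_mult_distrib power_divide s2)
  have "whp (Pn n) (exp (- l))
     (\<lambda>x. (\<Sum>i\<in>{1..n}. trunc1 (d i x (x i))) \<le> 2 * (\<Sum>i\<in>{1..n}. v i x) + l)"
  proof (rule supermartingale_tail)
    fix i m :: nat assume "i \<le> Suc m"
    then show "(\<lambda>(x, y). d i x y) \<in> borel_measurable (Pn m \<Otimes>\<^sub>M dens_measure f)"
      unfolding d_def case_prod_beta
      by (cases "i \<le> j") (auto intro!: borel_measurable_sum borel_measurable_divide borel_measurable_times h_meas comp)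
    show "v i \<in> borel_measurable (Pn m)"
      unfolding v_def[abs_def] using \<open>i \<le> Suc m\<close>
      by (cases "i \<le> j") (auto intro!: borel_measurable_sum borel_measurable_divide borel_measurable_times h_meas comp')
  next
    fix i and x :: "nat \<Rightarrow> real"
    show "integrable (dens_measure f) (d i x)"
    proof -
      have "integrable (dens_measure f) (\<lambda>y. \<Sum>k\<in>{1..<i}. h (x k) y)"
        by (rule integrable_const_bound[of _ "real (card {1..<i}) * H"]) (use Sb in auto)
      then show ?thesis by (cases "i \<le> j") (simp_all add: d_def[abs_def])
    qed
    have "integrable (dens_measure f) (h (x k))" for k
      by (rule integrable_const_bound[of _ H]) (use h_abs in auto)
    then show "(LINT y|dens_measure f. d i x y) = 0"
      by (cases "i \<le> j") (simp_all add: d_def[abs_def] integral_dens f_h)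
    have i2: "integrable (dens_measure f) (\<lambda>y. (\<Sum>k\<in>{1..<i}. h (x k) y)\<^sup>2)"
      by (rule integrable_const_bound[of _ "(real (card {1..<i}) * H)\<^sup>2"]) (use Sb2 in auto)
    then show "integrable (dens_measure f) (\<lambda>y. (d i x y)\<^sup>2)"
      by (cases "i \<le> j") (simp_all add: d2)
    show "(LINT y|dens_measure f. (d i x y)\<^sup>2) \<le> v i x"
    proof (cases "i \<le> j")
      case True
      have "(LINT y|dens_measure f. (\<Sum>k\<in>{1..<i}. h (x k) y)\<^sup>2) \<le> G * (\<Sum>k\<in>{1..<i}. \<Sum>k'\<in>{1..<i}. h (x k) (x k'))"
        by (subst integral_dens) (use h_sum_sq_le[of "{1..<i}" x] in auto)
      then show ?thesis using True \<open>0 < b\<close> by (simp add: d2 v_def divide_right_mono)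
    qed (simp add: d2 v_def)
  next
    fix i k :: nat and x :: "nat \<Rightarrow> real" and z y :: real assume "i \<le> k"
    then show "d i (x(k := z)) y = d i x y"
      by (auto simp: d_def intro!: sum.cong)
  next
    fix i k :: nat and x :: "nat \<Rightarrow> real" and z :: real assume "i \<le> k"
    then show "v i (x(k := z)) = v i x"
      by (auto simp: v_def intro!: sum.cong)
  qed
  moreover have "trunc1 (d i x y) = (if i \<le> j then trunc1 (s * (\<Sum>k\<in>{1..<i}. h (x k) y) / b) else 0)" for i x y
    by (simp add: d_def trunc1_def)
  ultimately show ?thesis unfolding sample_law_f v_def by (simp only:)
qed

text \<open>An explicit bound for the threshold \<open>T\<close> of the next proof. The first term
  is the Gaussian one; the next two come from the size of the increments and the last from the
  feedback of the U-statistic into its own variance.\<close>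

definition U_bound :: "nat \<Rightarrow> real \<Rightarrow> real" where
  "U_bound n l = 6 * n * sqrt (G * H * l) + 6 * l * sqrt (n * G * H * l) + 2 * l\<^sup>2 * H + 16 * G * n * l"

theorem U_dev:
  assumes "0 < l" "1 \<le> n"
  shows "whp (sample_law n f) (4 * real n * exp (- l)) (\<lambda>x. \<bar>U n x\<bar> \<le> U_bound n l)"
proof -
  have n: "0 < real n" using assms by auto
  define b0 where "b0 = 3 * sqrt (n * G * H * l) + l * H"
  \<comment> \<open>Each summand has one purpose: \<open>b0\<close> makes the truncation inactive,
    \<open>8 * G * n\<close> keeps the feedback coefficient \<open>4 * G * n / b\<close> at most
    1/2, and the last one balances \<open>n^2 G H / b\<close> with \<open>l b\<close>.\<close>
  define b where "b = b0 + 8 * G * n + n * sqrt (G * H / l)"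
  have nn: "0 \<le> b0" "0 < 8 * G * n" "0 < n * sqrt (G * H / l)"
    using n G_pos H_pos assms by (auto simp: b0_def)
  then have b: "0 < b" "b0 \<le> b" "8 * G * n \<le> b" "n * sqrt (G * H / l) \<le> b" by (auto simp: b_def)
  \<comment> \<open>The solution of \<open>t = 2 G n^2 H / b + l b + t / 2\<close>.\<close>
  define T where "T = 4 * G * n\<^sup>2 * H / b + 2 * l * b"
  have T0: "0 \<le> T" using b n G_pos H_pos assms by (simp add: T_def)
  have T_le: "T \<le> U_bound n l"
  proof -
    have "4 * G * n\<^sup>2 * H / b \<le> 4 * G * n\<^sup>2 * H / (n * sqrt (G * H / l))"
      using b nn n G_pos H_pos by (intro divide_left_mono mult_pos_pos[OF b(1) nn(3)]) auto
    also have "\<dots> = 4 * n * (G * H / sqrt (G * H / l))"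
      using n by (simp add: power2_eq_square)
    also have "G * H / sqrt (G * H / l) = sqrt (G * H * l)"
    proof -
      have "G * H / sqrt (G * H / l) = (G * H / sqrt (G * H)) * sqrt l"
        using assms by (simp add: real_sqrt_divide)
      also have "G * H / sqrt (G * H) = sqrt (G * H)" using G_pos H_pos by (intro real_div_sqrt) auto
      finally show ?thesis by (simp add: real_sqrt_mult)
    qed
    finally have 1: "4 * G * n\<^sup>2 * H / b \<le> 4 * n * sqrt (G * H * l)" .
    have "l * sqrt (G * H / l) = sqrt (G * H) * (l / sqrt l)"
      by (simp add: real_sqrt_divide)
    also have "\<dots> = sqrt (G * H * l)" using assms by (simp add: real_div_sqrt real_sqrt_mult)
    finally have 2: "l * (n * sqrt (G * H / l)) = n * sqrt (G * H * l)" by simp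
    have "2 * l * b = 6 * l * sqrt (n * G * H * l) + 2 * l\<^sup>2 * H + 16 * G * n * l + 2 * (l * (n * sqrt (G * H / l)))"
      by (simp add: b_def b0_def algebra_simps power2_eq_square)
    then show ?thesis using 1 2 by (simp add: T_def U_bound_def)
  qed
  let ?D = "\<lambda>x i. \<Sum>k\<in>{1..<i}. h (x k) (x i)"
  let ?S = "\<lambda>x i. \<Sum>k\<in>{1..<i}. \<Sum>k'\<in>{1..<i}. h (x k) (x k')"
  let ?E = "\<lambda>s j x. (\<Sum>i\<in>{1..n}. if i \<le> j then trunc1 (s * ?D x i / b) else 0)
        \<le> 2 * (\<Sum>i\<in>{1..n}. if i \<le> j then G * ?S x i / b\<^sup>2 else 0) + l"
  \<comment> \<open>For each \<open>j\<close> the two-sided increment bound costs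
    \<open>2 exp (- l)\<close>, and each sign of the partial sum another
    \<open>exp (- l)\<close>.\<close>
  have "whp (sample_law n f) (2 * exp (- l) + (exp (- l) + exp (- l)))
      (\<lambda>x. \<bar>?D x j\<bar> \<le> b0 \<and> ?E 1 j x \<and> ?E (-1) j x)" if "j \<in> {1..n}" for j
    by (intro whp_conj increment_dev[OF assms(1) that, folded b0_def] U_supermartingale) (use b in auto)
  then have "whp (sample_law n f) (4 * exp (- l)) (\<lambda>x. \<bar>?D x j\<bar> \<le> b0 \<and> ?E 1 j x \<and> ?E (-1) j x)"
    if "j \<in> {1..n}" for j using that by simp
  then have "whp (sample_law n f) (real (card {1..n}) * (4 * exp (- l)))
      (\<lambda>x. \<forall>j\<in>{1..n}. \<bar>?D x j\<bar> \<le> b0 \<and> ?E 1 j x \<and> ?E (-1) j x)"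
    by (intro whp_Ball) auto
  then show ?thesis
  proof (rule whp_mono)
    fix x assume *: "\<forall>j\<in>{1..n}. \<bar>?D x j\<bar> \<le> b0 \<and> ?E 1 j x \<and> ?E (-1) j x"
    have tr: "trunc1 (?D x i / b) = ?D x i / b" if "i \<in> {1..n}" for i
    proof -
      have "\<bar>?D x i\<bar> \<le> b" using * that b by force
      then show ?thesis using b by (simp add: trunc1_def)
    qed
    have sum_le: "(\<Sum>i\<in>{1..n}. if i \<le> j then g i else 0) = sum g {1..j}" if "j \<le> n" for g :: "nat \<Rightarrow> real" and j
      by (rule sum.mono_neutral_cong_right) (use that in auto)
    text \<open>
      The variance term at step \<open>j\<close> is controlled by \<open>U i x\<close> with \<open>i < j\<close>; \<open>T\<close> solves the resulting
      recursive inequality.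
    \<close>
    have key: "\<bar>U j x\<bar> \<le> T" if "j \<le> n" for j
      using that
    proof (induction j rule: less_induct)
      case (less j)
      show ?case
      proof (cases "j = 0")
        case True then show ?thesis using T0 by (simp add: U_def)
      next
        case False
        then have j: "j \<in> {1..n}" using less.prems by auto
        have S_le: "?S x i \<le> n * H + 2 * T" if i: "i \<in> {1..j}" for i
        proof -
          obtain m where m: "i = Suc m" using i by (cases i) auto
          have e: "{1..<i} = {1..m}" using m by auto
          have "?S x i = (\<Sum>k\<in>{1..m}. h (x k) (x k)) + 2 * U m x"
            unfolding e by (rule double_sum_U)
          also have "(\<Sum>k\<in>{1..m}. h (x k) (x k)) \<le> real (card {1..m}) * H"
            by (rule sum_bounded_above) (use h_abs abs_le_D1 in blast)
          also have "\<dots> \<le> n * H" using H_pos m i less.prems by (intro mult_right_mono) auto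
          also have "U m x \<le> T" using less.IH[of m] m i less.prems by auto
          finally show ?thesis by simp
        qed
        have V: "2 * (\<Sum>i\<in>{1..n}. if i \<le> j then G * ?S x i / b\<^sup>2 else 0) \<le> 2 * (n * (G * (n * H + 2 * T) / b\<^sup>2))"
        proof -
          have "(\<Sum>i\<in>{1..n}. if i \<le> j then G * ?S x i / b\<^sup>2 else 0) = (\<Sum>i\<in>{1..j}. G * ?S x i / b\<^sup>2)"
            by (rule sum_le[OF less.prems])
          also have "\<dots> \<le> real (card {1..j}) * (G * (n * H + 2 * T) / b\<^sup>2)"
            by (intro sum_bounded_above divide_right_mono mult_left_mono S_le) (use G_pos in auto)
          also have "\<dots> \<le> n * (G * (n * H + 2 * T) / b\<^sup>2)"
            using less.prems T0 G_pos H_pos by (intro mult_right_mono) auto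
          finally show ?thesis by simp
        qed
        have Uj: "U j x / b = (\<Sum>i\<in>{1..n}. if i \<le> j then trunc1 (?D x i / b) else 0)"
        proof -
          have "(\<Sum>i\<in>{1..n}. if i \<le> j then trunc1 (?D x i / b) else 0) = (\<Sum>i\<in>{1..n}. if i \<le> j then ?D x i / b else 0)"
            by (intro sum.cong refl) (simp only: tr)
          also have "\<dots> = (\<Sum>i\<in>{1..j}. ?D x i / b)" by (rule sum_le[OF less.prems])
          finally show ?thesis by (simp add: U_def sum_divide_distrib)
        qed
        have Uj': "- (U j x / b) = (\<Sum>i\<in>{1..n}. if i \<le> j then trunc1 (-1 * ?D x i / b) else 0)"
          unfolding Uj by (subst sum_negf[symmetric], intro sum.cong refl) (simp add: trunc1_minus)
        have "\<bar>U j x / b\<bar> \<le> 2 * (n * (G * (n * H + 2 * T) / b\<^sup>2)) + l"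
        proof -
          from * j have "?E 1 j x" "?E (-1) j x" by blast+
          from this(1) have "U j x / b \<le> 2 * (\<Sum>i\<in>{1..n}. if i \<le> j then G * ?S x i / b\<^sup>2 else 0) + l"
            by (simp only: mult_1 Uj)
          moreover from \<open>?E (-1) j x\<close>
          have "- (U j x / b) \<le> 2 * (\<Sum>i\<in>{1..n}. if i \<le> j then G * ?S x i / b\<^sup>2 else 0) + l"
            by (simp only: Uj')
          ultimately
          show ?thesis using V by linarith
        qed
        then have "\<bar>U j x\<bar> \<le> b * (2 * (n * (G * (n * H + 2 * T) / b\<^sup>2)) + l)"
          using b(1) mult_left_mono[of "\<bar>U j x / b\<bar>" _ b] by (simp add: abs_divide)
        also have "\<dots> = 2 * G * n\<^sup>2 * H / b + l * b + (4 * G * n / b) * T"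
          using b(1) by (simp add: field_simps power2_eq_square)
        also have "\<dots> \<le> 2 * G * n\<^sup>2 * H / b + l * b + (1 / 2) * T"
          using b(1,3) T0 by (intro add_left_mono mult_right_mono) (auto simp: pos_divide_le_eq)
        also have "\<dots> = T" using b(1) by (simp add: T_def field_simps)
        finally show ?thesis .
      qed
    qed
    show "\<bar>U n x\<bar> \<le> U_bound n l" using key[OF order_refl] T_le by linarith
  qed simp
qed

text \<open>The statistic for the untransformed sample and a candidate density \<open>w\<close>. Its
  mean is \<open>\<theta> - 2 <f, w> + \<parallel>w\<parallel>^2\<close>, which equals the squared
  distance of \<open>f\<close> and \<open>w\<close> minus \<open>bias\<close>.\<close>

definition stat :: "(real \<Rightarrow> real) \<Rightarrow> nat \<Rightarrow> (nat \<Rightarrow> real) \<Rightarrow> real" where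
  "stat w n x = 1 / (real n * (real n - 1)) * (\<Sum>i\<in>{1..n}. \<Sum>j\<in>{1..n} - {i}. \<kappa> (x i) (x j))
     + (LINT y|lborel. (w y)\<^sup>2) - 2 / real n * (\<Sum>i\<in>{1..n}. w (x i))"

definition bias :: real where "bias = (LINT y|lborel. (f y - q y)\<^sup>2)"

lemma bias_eq: "bias = (LINT y|lborel. (f y)\<^sup>2) - \<theta>"
proof -
  have i: "integrable lborel (\<lambda>y. f y * q y)" by (rule f_bdd_int[OF _ q_abs]) simp
  have i2: "integrable lborel (\<lambda>y. (q y)\<^sup>2)" using q_L2 by (simp add: L2_iff)
  have "bias = (LINT y|lborel. (f y)\<^sup>2 - 2 * (f y * q y) + (q y)\<^sup>2)"
    unfolding bias_def by (intro Bochner_Integration.integral_cong) (auto simp: power2_eq_square algebra_simps)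
  also have "\<dots> = (LINT y|lborel. (f y)\<^sup>2) - \<theta>"
    using i i2 f_sq_int by (simp add: q_sq \<theta>_def)
  finally show ?thesis .
qed

text \<open>The Hoeffding decomposition leaves \<open>U\<close> and a linear sum of the centred
  function \<open>q - w\<close>. The variance of the latter is at most
  \<open>2 G (dd + bias)\<close>, proportional to the quantity being estimated, so a fraction of
  \<open>dd + bias\<close> absorbs it at a cost of order \<open>l / n\<close>.\<close>

theorem stat_dev:
  assumes l: "0 < l" and n: "2 \<le> n"
    and [measurable]: "w \<in> borel_measurable borel" and wb: "\<And>y. \<bar>w y\<bar> \<le> W"
    and w2: "integrable lborel (\<lambda>y. (w y)\<^sup>2)"
    and dd: "dd = (LINT y|lborel. (f y - w y)\<^sup>2)"
  shows "whp (sample_law n f) ((4 * real n + 2) * exp (- l))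
     (\<lambda>x. \<bar>stat w n x - (dd - bias)\<bar>
         \<le> 2 * U_bound n l / (real n * (real n - 1)) + (dd + bias) / 4 + (4 * (G * B + W) + 64 * G) * l / n)"
proof -
  have W0: "0 \<le> W" using wb[of 0] by linarith
  have n0: "0 < real n" "0 < real n - 1" using n by auto
  have iw: "integrable lborel (\<lambda>y. f y * w y)" by (rule f_bdd_int[OF _ wb]) simp
  have iq: "integrable lborel (\<lambda>y. f y * q y)" by (rule f_bdd_int[OF _ q_abs]) simp
  define fw where "fw = (LINT y|lborel. f y * w y)"
  have fwb: "\<bar>fw\<bar> \<le> W" unfolding fw_def by (rule f_bdd_integral_abs_le[OF _ wb]) simp
  define Z where "Z y = q y - w y - (\<theta> - fw)" for y
  have [measurable]: "Z \<in> borel_measurable borel" unfolding Z_def by measurable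
  define b1 where "b1 = 2 * (G * B + W)"
  have b1: "0 \<le> b1" using GB_nonneg W0 by (simp add: b1_def)
  have Zb: "\<bar>Z y\<bar> \<le> b1" for y
    using q_abs[of y] wb[of y] fwb \<theta>_nonneg \<theta>_le by (auto simp: Z_def b1_def)
  have mean: "(LINT y|dens_measure f. Z y) = 0"
    using iw iq f_int by (simp add: integral_dens Z_def right_diff_distrib flip: \<theta>_def fw_def)
  have ifw2: "integrable lborel (\<lambda>y. (f y - w y)\<^sup>2)"
    using L2_diff[OF f_L2, of w] w2 by (simp add: L2_iff)
  have ifq2: "integrable lborel (\<lambda>y. (f y - q y)\<^sup>2)"
    using L2_diff[OF f_L2 q_L2] by (simp add: L2_iff)
  have dd_eq: "dd = (LINT y|lborel. (f y)\<^sup>2) - 2 * fw + (LINT y|lborel. (w y)\<^sup>2)"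
  proof -
    have "dd = (LINT y|lborel. (f y)\<^sup>2 - 2 * (f y * w y) + (w y)\<^sup>2)"
      unfolding dd by (intro Bochner_Integration.integral_cong) (auto simp: power2_eq_square algebra_simps)
    then show ?thesis using iw w2 f_sq_int by (simp add: fw_def)
  qed
  have var: "(LINT y|dens_measure f. (Z y)\<^sup>2) \<le> G * (2 * (dd + bias))"
  proof -
    define m where "m = \<theta> - fw"
    have iqw: "integrable lborel (\<lambda>y. f y * (q y - w y)\<^sup>2)"
    proof -
      have "\<bar>q y - w y\<bar> \<le> b1" for y using q_abs[of y] wb[of y] GB_nonneg W0 by (auto simp: b1_def)
      then have "\<bar>(q y - w y)\<^sup>2\<bar> \<le> b1\<^sup>2" for y by (rule abs_square_le)
      then show ?thesis by (intro f_bdd_int) auto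
    qed
    have "(LINT y|dens_measure f. (Z y)\<^sup>2) = (LINT y|lborel. f y * (q y - w y)\<^sup>2 - 2 * m * (f y * q y - f y * w y) + m\<^sup>2 * f y)"
      by (subst integral_dens) (auto simp: Z_def m_def power2_eq_square algebra_simps)
    also have "\<dots> = (LINT y|lborel. f y * (q y - w y)\<^sup>2) - m\<^sup>2"
      using iqw iq iw f_int by (simp add: m_def power2_eq_square flip: \<theta>_def fw_def)
    also have "\<dots> \<le> (LINT y|lborel. f y * (q y - w y)\<^sup>2)" by simp
    also have "\<dots> \<le> (LINT y|lborel. f y * (2 * (f y - w y)\<^sup>2 + 2 * (f y - q y)\<^sup>2))"
    proof (rule integral_mono[OF iqw])
      show "integrable lborel (\<lambda>y. f y * (2 * (f y - w y)\<^sup>2 + 2 * (f y - q y)\<^sup>2))"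
        using integrable_mult_bounded[of lborel "\<lambda>y. 2 * (f y - w y)\<^sup>2 + 2 * (f y - q y)\<^sup>2" f G] ifw2 ifq2 f_abs
        by (simp add: mult.commute)
      fix y
      \<comment> \<open>Here \<open>q - w\<close> is the difference of \<open>f - w\<close> and
        \<open>f - q\<close>.\<close>
      have "(q y - w y)\<^sup>2 \<le> 2 * (f y - w y)\<^sup>2 + 2 * (f y - q y)\<^sup>2"
        using zero_le_power2[of "(f y - w y) + (f y - q y)"] by (simp add: power2_eq_square algebra_simps)
      then show "f y * (q y - w y)\<^sup>2 \<le> f y * (2 * (f y - w y)\<^sup>2 + 2 * (f y - q y)\<^sup>2)"
        by (intro mult_left_mono f_ge)
    qed
    also have "\<dots> \<le> G * (LINT y|lborel. 2 * (f y - w y)\<^sup>2 + 2 * (f y - q y)\<^sup>2)"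
      by (rule integral_f_mult_le) (use ifw2 ifq2 in auto)
    also have "\<dots> = G * (2 * (dd + bias))"
      using ifw2 ifq2 by (simp add: dd bias_def)
    finally show ?thesis .
  qed
  have dd0: "0 \<le> dd" "0 \<le> bias" by (auto simp: dd bias_def)
  \<comment> \<open>The Bernstein parameter is \<open>1 / c\<close>: \<open>c \<ge> b1\<close> makes
    it admissible, and \<open>c \<ge> 32 * G\<close> brings the coefficient \<open>8 * G / c\<close>
    of \<open>dd + bias\<close> down to 1/4.\<close>
  define c where "c = b1 + 32 * G"
  have c: "0 < c" "b1 \<le> c" "32 * G \<le> c" using b1 G_pos by (auto simp: c_def)
  have w1: "whp (sample_law n f) (2 * exp (- l))
     (\<lambda>x. \<bar>\<Sum>i\<in>{1..n}. Z (x i)\<bar> \<le> 2 * (1 / c) * (real n * (G * (2 * (dd + bias)))) + l / (1 / c))"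
    unfolding sample_law_f
    by (rule bernstein_abs[OF _ Zb mean var]) (use c in auto)
  have "whp (sample_law n f) (4 * real n * exp (- l) + 2 * exp (- l))
     (\<lambda>x. \<bar>U n x\<bar> \<le> U_bound n l \<and>
        \<bar>\<Sum>i\<in>{1..n}. Z (x i)\<bar> \<le> 2 * (1 / c) * (real n * (G * (2 * (dd + bias)))) + l / (1 / c))"
    by (rule whp_conj[OF U_dev[OF l] w1]) (use n in auto)
  then show ?thesis
  proof (rule whp_mono)
    fix x
    assume *: "\<bar>U n x\<bar> \<le> U_bound n l \<and>
        \<bar>\<Sum>i\<in>{1..n}. Z (x i)\<bar> \<le> 2 * (1 / c) * (real n * (G * (2 * (dd + bias)))) + l / (1 / c)"
    define SZ where "SZ = (\<Sum>i\<in>{1..n}. Z (x i))"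
    define Q where "Q = (\<Sum>i\<in>{1..n}. q (x i))"
    define Sw where "Sw = (\<Sum>i\<in>{1..n}. w (x i))"
    \<comment> \<open>Write \<open>\<kappa>\<close> as \<open>h + q + q - \<theta>\<close> in the
      full double sum and remove the diagonal; the diagonal values of \<open>\<kappa>\<close>
      cancel.\<close>
    have off: "(\<Sum>i\<in>{1..n}. \<Sum>j\<in>{1..n} - {i}. \<kappa> (x i) (x j))
      = 2 * U n x + 2 * (real n - 1) * Q - real n * (real n - 1) * \<theta>"
    proof -
      have "(\<Sum>i\<in>{1..n}. \<Sum>j\<in>{1..n} - {i}. \<kappa> (x i) (x j))
        = (\<Sum>i\<in>{1..n}. (\<Sum>j\<in>{1..n}. \<kappa> (x i) (x j)) - \<kappa> (x i) (x i))"
        by (intro sum.cong) (auto simp: sum_diff1)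
      also have "\<dots> = (\<Sum>i\<in>{1..n}. \<Sum>j\<in>{1..n}. \<kappa> (x i) (x j)) - (\<Sum>i\<in>{1..n}. \<kappa> (x i) (x i))"
        by (simp add: sum_subtractf)
      also have "(\<Sum>i\<in>{1..n}. \<Sum>j\<in>{1..n}. \<kappa> (x i) (x j))
        = (\<Sum>i\<in>{1..n}. \<Sum>j\<in>{1..n}. h (x i) (x j) + q (x i) + q (x j) - \<theta>)"
        by (simp add: h_def)
      also have "\<dots> = (\<Sum>i\<in>{1..n}. h (x i) (x i)) + 2 * U n x + 2 * n * Q - n * n * \<theta>"
        by (simp add: sum.distrib sum_subtractf double_sum_U[simplified] Q_def sum_distrib_left[symmetric])
      also have "(\<Sum>i\<in>{1..n}. h (x i) (x i)) = (\<Sum>i\<in>{1..n}. \<kappa> (x i) (x i)) - 2 * Q + n * \<theta>"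
        by (simp add: h_def sum.distrib sum_subtractf Q_def sum_distrib_left)
      finally show ?thesis by (simp add: algebra_simps)
    qed
    have SZ: "SZ = Q - Sw - n * (\<theta> - fw)"
      by (simp add: SZ_def Z_def sum_subtractf Q_def Sw_def)
    have "stat w n x = 2 * U n x / (real n * (real n - 1)) + 2 / n * Q - \<theta> + (LINT y|lborel. (w y)\<^sup>2) - 2 / n * Sw"
    proof -
      have "1 / (m * a) * (2 * u + 2 * a * v - m * a * t) = 2 * u / (m * a) + 2 / m * v - t"
        if "0 < m" "0 < a" for m a u v t :: real
        using that by (simp add: field_simps)
      from this[OF n0, of "U n x" Q \<theta>] show ?thesis unfolding stat_def off Sw_def by linarith
    qed
    then have st: "stat w n x - (dd - bias) = 2 * U n x / (real n * (real n - 1)) + 2 / n * SZ"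
    proof -
      have "2 / m * (v - sw - m * (t - z)) = 2 / m * v - 2 / m * sw - 2 * t + 2 * z"
        if "0 < m" for m v sw t z :: real
        using that by (simp add: field_simps)
      from this[OF n0(1), of Q Sw \<theta> fw] show ?thesis using \<open>stat w n x = _\<close> unfolding SZ dd_eq bias_eq by linarith
    qed
    have 1: "\<bar>2 * U n x / (real n * (real n - 1))\<bar> \<le> 2 * U_bound n l / (real n * (real n - 1))"
    proof -
      have "\<bar>2 * U n x\<bar> \<le> 2 * U_bound n l" using * by linarith
      then have "\<bar>2 * U n x\<bar> / (real n * (real n - 1)) \<le> 2 * U_bound n l / (real n * (real n - 1))"
        by (rule divide_right_mono) (use n0 in auto)
      then show ?thesis using n0 by (simp only: abs_divide) (simp add: abs_mult)
    qed
    have "\<bar>2 / n * SZ\<bar> \<le> 2 / n * (2 * (1 / c) * (real n * (G * (2 * (dd + bias)))) + l / (1 / c))"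
    proof -
      have "\<bar>2 / n * SZ\<bar> = 2 / n * \<bar>SZ\<bar>" using n0 by (simp only: abs_mult) simp
      also have "\<dots> \<le> 2 / n * (2 * (1 / c) * (real n * (G * (2 * (dd + bias)))) + l / (1 / c))"
        using * n0 unfolding SZ_def by (intro mult_left_mono) auto
      finally show ?thesis .
    qed
    also have "\<dots> = 8 * G / c * (dd + bias) + 2 * c * l / n"
    proof -
      have "2 / m * (2 * (1 / c) * (m * (G * (2 * e))) + l / (1 / c)) = 8 * G / c * e + 2 * c * l / m"
        if "0 < m" for m e :: real
        using that c(1) by (simp add: field_simps)
      from this[OF n0(1), of "dd + bias"] show ?thesis .
    qed
    also have "\<dots> \<le> 1 / 4 * (dd + bias) + 2 * c * l / n"
      using c dd0 by (intro add_right_mono mult_right_mono) (auto simp: field_simps)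
    also have "2 * c = 4 * (G * B + W) + 64 * G" by (simp add: c_def b1_def)
    finally show "\<bar>stat w n x - (dd - bias)\<bar>
         \<le> 2 * U_bound n l / (real n * (real n - 1)) + (dd + bias) / 4 + (4 * (G * B + W) + 64 * G) * l / n"
      unfolding st using 1 by linarith
  qed (simp add: algebra_simps)
qed

end

section \<open>The projection kernel of a scaling function\<close>

lemma infsum_finite_support:
  fixes g :: "'i \<Rightarrow> real"
  assumes "finite F" "\<And>k. k \<notin> F \<Longrightarrow> g k = 0"
  shows "(\<Sum>\<^sub>\<infinity>k\<in>UNIV. g k) = sum g F"
proof -
  have "(\<Sum>\<^sub>\<infinity>k\<in>UNIV. g k) = infsum g F"
    by (rule infsum_cong_neutral) (use assms in auto)
  then show ?thesis using assms by simp
qed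

text \<open>The properties extracted from the wavelet pair: support in \<open>[-a, a]\<close>, a
  bound, a Lipschitz constant, and orthonormality of the integer translates. All later constants
  depend on \<open>\<phi>\<close> through \<open>a\<close>, \<open>\<Phi>\<close> and
  \<open>\<Lambda>\<close>.\<close>

locale scaling_fun =
  fixes \<phi> :: "real \<Rightarrow> real" and a \<Phi> \<Lambda> :: real
  assumes a_pos: "0 < a" and phi_supp: "a < \<bar>x\<bar> \<Longrightarrow> \<phi> x = 0"
    and Phi_pos: "0 < \<Phi>" and phi_le: "\<bar>\<phi> x\<bar> \<le> \<Phi>"
    and Lam_nonneg: "0 \<le> \<Lambda>" and phi_lip: "\<bar>\<phi> x - \<phi> y\<bar> \<le> \<Lambda> * \<bar>x - y\<bar>"
    and orth: "(LINT x|lborel. \<phi> (x - of_int k) * \<phi> (x - of_int l)) = (if k = l then 1 else 0)"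
begin

definition idx :: "real \<Rightarrow> int set" where "idx u = {\<lceil>u - a\<rceil>..\<lfloor>u + a\<rfloor>}"

lemma finite_idx [simp]: "finite (idx u)" by (simp add: idx_def)

lemma notin_idx: "k \<notin> idx u \<Longrightarrow> \<phi> (u - of_int k) = 0"
  by (rule phi_supp) (auto simp: idx_def le_floor_iff ceiling_le_iff)

lemma card_idx: "real (card (idx u)) \<le> 2 * a + 1"
proof -
  have "real_of_int \<lfloor>u + a\<rfloor> - real_of_int \<lceil>u - a\<rceil> + 1 \<le> 2 * a + 1" by linarith
  then show ?thesis using a_pos by (simp add: idx_def)
qed

lemma phi_cont: "continuous_on UNIV \<phi>"
proof -
  have "\<Lambda>-lipschitz_on UNIV \<phi>"
    using phi_lip Lam_nonneg by (intro lipschitz_onI) (auto simp: dist_real_def)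
  then show ?thesis by (rule lipschitz_on_continuous_on)
qed

lemma phi_meas [measurable]: "\<phi> \<in> borel_measurable borel"
  using phi_cont by (rule borel_measurable_continuous_onI)

text \<open>The reproducing kernel of the closed span of the integer translates. The sum is locally
  finite: at most \<open>2 * a + 1\<close> translates (those in \<open>idx u\<close>) can be nonzero
  at \<open>u\<close>.\<close>

definition k1 :: "real \<Rightarrow> real \<Rightarrow> real" where
  "k1 u v = (\<Sum>\<^sub>\<infinity>k\<in>UNIV. \<phi> (u - of_int k) * \<phi> (v - of_int k))"

lemma k1_eq:
  assumes "finite F" "\<And>k. k \<notin> F \<Longrightarrow> \<phi> (u - of_int k) * \<phi> (v - of_int k) = 0"
  shows "k1 u v = (\<Sum>k\<in>F. \<phi> (u - of_int k) * \<phi> (v - of_int k))"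
  unfolding k1_def by (rule infsum_finite_support) (use assms in auto)

lemma k1_idx: "k1 u v = (\<Sum>k\<in>idx u. \<phi> (u - of_int k) * \<phi> (v - of_int k))"
  by (rule k1_eq) (auto simp: notin_idx)

lemma k1_sym: "k1 u v = k1 v u"
  by (simp add: k1_def mult.commute)

definition N :: real where "N = (2 * a + 1) * \<Phi>\<^sup>2"

lemma N_pos: "0 < N" using a_pos Phi_pos by (simp add: N_def)

lemma k1_abs: "\<bar>k1 u v\<bar> \<le> N"
proof -
  have "\<bar>k1 u v\<bar> \<le> (\<Sum>k\<in>idx u. \<bar>\<phi> (u - of_int k) * \<phi> (v - of_int k)\<bar>)"
    unfolding k1_idx by (rule sum_abs)
  also have "\<dots> \<le> real (card (idx u)) * \<Phi>\<^sup>2"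
    unfolding power2_eq_square abs_mult
    by (intro sum_bounded_above mult_mono phi_le) (use Phi_pos in auto)
  also have "\<dots> \<le> N" unfolding N_def by (intro mult_right_mono card_idx) auto
  finally show ?thesis .
qed

lemma k1_far: "2 * a < \<bar>u - v\<bar> \<Longrightarrow> k1 u v = 0"
proof -
  assume *: "2 * a < \<bar>u - v\<bar>"
  have "\<phi> (u - of_int k) * \<phi> (v - of_int k) = 0" for k
    using phi_supp[of "u - of_int k"] phi_supp[of "v - of_int k"] * by (cases "a < \<bar>u - of_int k\<bar>") auto
  then show ?thesis unfolding k1_idx by (intro sum.neutral) blast
qed

text \<open>A Lipschitz constant of \<open>k1\<close> in each argument: the number of active
  translates times that of one summand.\<close>

definition c1 :: real where "c1 = (2 * a + 1) * (\<Phi> * \<Lambda>)"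

lemma c1_nonneg: "0 \<le> c1" using a_pos Phi_pos Lam_nonneg by (simp add: c1_def)

lemma k1_lip1: "\<bar>k1 u v - k1 u v'\<bar> \<le> c1 * \<bar>v - v'\<bar>"
proof -
  have "\<bar>k1 u v - k1 u v'\<bar> = \<bar>\<Sum>k\<in>idx u. \<phi> (u - of_int k) * (\<phi> (v - of_int k) - \<phi> (v' - of_int k))\<bar>"
    by (simp add: k1_idx sum_subtractf right_diff_distrib)
  also have "\<dots> \<le> (\<Sum>k\<in>idx u. \<bar>\<phi> (u - of_int k) * (\<phi> (v - of_int k) - \<phi> (v' - of_int k))\<bar>)"
    by (rule sum_abs)
  also have "\<dots> \<le> real (card (idx u)) * (\<Phi> * (\<Lambda> * \<bar>v - v'\<bar>))"
    unfolding abs_mult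
  proof (intro sum_bounded_above mult_mono phi_le)
    fix k :: int
    show "\<bar>\<phi> (v - of_int k) - \<phi> (v' - of_int k)\<bar> \<le> \<Lambda> * \<bar>v - v'\<bar>"
      using phi_lip[of "v - of_int k" "v' - of_int k"] by simp
  qed (use Phi_pos in auto)
  also have "\<dots> \<le> (2 * a + 1) * (\<Phi> * (\<Lambda> * \<bar>v - v'\<bar>))"
    using Phi_pos Lam_nonneg by (intro mult_right_mono card_idx) auto
  finally show ?thesis by (simp add: c1_def mult_ac)
qed

lemma k1_lip: "\<bar>k1 u v - k1 u' v'\<bar> \<le> c1 * (\<bar>u - u'\<bar> + \<bar>v - v'\<bar>)"
  using k1_lip1[of u v v'] k1_lip1[of v' u u'] by (simp add: k1_sym[of _ v'] distrib_left)

text \<open>Joint measurability comes from Lipschitz continuity, since the active index set varies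
  with the point.\<close>

lemma k1_meas: "(\<lambda>(u, v). k1 u v) \<in> borel_measurable (borel \<Otimes>\<^sub>M borel)"
proof -
  have "(2 * c1)-lipschitz_on UNIV (\<lambda>p. k1 (fst p) (snd p))"
  proof (rule lipschitz_onI)
    fix p p' :: "real \<times> real"
    have "\<bar>k1 (fst p) (snd p) - k1 (fst p') (snd p')\<bar> \<le> c1 * (\<bar>fst p - fst p'\<bar> + \<bar>snd p - snd p'\<bar>)"
      by (rule k1_lip)
    also have "\<dots> \<le> c1 * (2 * dist p p')"
      using dist_fst_le[of p p'] dist_snd_le[of p p'] c1_nonneg
      by (intro mult_left_mono) (auto simp: dist_real_def)
    finally show "dist (k1 (fst p) (snd p)) (k1 (fst p') (snd p')) \<le> 2 * c1 * dist p p'"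
      by (simp add: dist_real_def)
  qed (use c1_nonneg in auto)
  then have "continuous_on UNIV (\<lambda>p. k1 (fst p) (snd p))" by (rule lipschitz_on_continuous_on)
  then have "(\<lambda>p. k1 (fst p) (snd p)) \<in> borel_measurable borel" by (rule borel_measurable_continuous_onI)
  then show ?thesis by (simp add: borel_prod case_prod_beta)
qed

lemma k1_meas2 [measurable]:
  assumes "f \<in> borel_measurable M" "g \<in> borel_measurable M"
  shows "(\<lambda>x. k1 (f x) (g x)) \<in> borel_measurable M"
proof -
  have "(\<lambda>x. (f x, g x)) \<in> M \<rightarrow>\<^sub>M borel \<Otimes>\<^sub>M borel" using assms by measurable
  from measurable_compose[OF this k1_meas] show ?thesis by simp
qed

lemma k1_le_indicator: "\<bar>k1 u v\<bar> \<le> N * indicator {u - 2 * a..u + 2 * a} v"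
  using k1_abs[of u v] k1_far[of u v] by (cases "2 * a < \<bar>u - v\<bar>") (auto simp: indicator_def)

lemma interval_int: "integrable lborel (\<lambda>v. c * indicator {x..y :: real} v :: real)"
  by (intro integrable_mult_right integrable_real_indicator) (simp_all add: emeasure_lborel_Icc_eq)

lemma k1_int: "integrable lborel (k1 u)"
  by (rule Bochner_Integration.integrable_bound[OF interval_int[of N "u - 2 * a" "u + 2 * a"]])
    (use k1_le_indicator[of u] N_pos in auto)

lemma k1_L1: "(LINT v|lborel. \<bar>k1 u v\<bar>) \<le> 4 * a * N"
proof -
  have "(LINT v|lborel. \<bar>k1 u v\<bar>) \<le> (LINT v|lborel. N * indicator {u - 2 * a..u + 2 * a} v)"
    by (rule integral_mono[OF _ interval_int k1_le_indicator]) (use k1_int in auto)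
  also have "\<dots> = 4 * a * N" using a_pos by simp
  finally show ?thesis .
qed

lemma phi_prod_int: "integrable lborel (\<lambda>x. \<phi> (x - of_int k) * \<phi> (x - of_int l))"
proof (rule Bochner_Integration.integrable_bound[OF interval_int[of "\<Phi>\<^sup>2" "of_int k - a" "of_int k + a"]])
  have "\<bar>\<phi> (x - of_int k) * \<phi> (x - of_int l)\<bar> \<le> \<bar>\<Phi>\<^sup>2 * indicator {of_int k - a..of_int k + a} x\<bar>" for x
  proof (cases "a < \<bar>x - of_int k\<bar>")
    case False
    have "\<bar>\<phi> (x - of_int k)\<bar> * \<bar>\<phi> (x - of_int l)\<bar> \<le> \<Phi> * \<Phi>"
      by (intro mult_mono phi_le) (use Phi_pos in auto)
    then show ?thesis using False by (auto simp: abs_mult power2_eq_square indicator_def)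
  qed (simp add: phi_supp)
  then show "AE x in lborel. norm (\<phi> (x - of_int k) * \<phi> (x - of_int l)) \<le> norm (\<Phi>\<^sup>2 * indicator {of_int k - a..of_int k + a} x)"
    by auto
qed auto

lemma k1_phi: "(LINT z|lborel. k1 u z * \<phi> (z - of_int l)) = \<phi> (u - of_int l)"
proof -
  have "(LINT z|lborel. k1 u z * \<phi> (z - of_int l))
     = (LINT z|lborel. (\<Sum>k\<in>idx u. \<phi> (u - of_int k) * (\<phi> (z - of_int k) * \<phi> (z - of_int l))))"
    by (simp add: k1_idx sum_distrib_right mult.assoc)
  also have "\<dots> = (\<Sum>k\<in>idx u. \<phi> (u - of_int k) * (if k = l then 1 else 0))"
    using phi_prod_int by (simp add: Bochner_Integration.integral_sum orth)
  also have "\<dots> = (\<Sum>k\<in>idx u. if k = l then \<phi> (u - of_int l) else 0)"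
    by (intro sum.cong) auto
  also have "\<dots> = \<phi> (u - of_int l)" by (simp add: notin_idx)
  finally show ?thesis .
qed

lemma k1_repro: "(LINT z|lborel. k1 u z * k1 z v) = k1 u v"
proof -
  have i: "integrable lborel (\<lambda>z. k1 u z * \<phi> (z - of_int l))" for l
    by (rule integrable_mult_bounded[OF k1_int _ phi_le]) simp
  have "(LINT z|lborel. k1 u z * k1 z v) = (LINT z|lborel. (\<Sum>l\<in>idx v. \<phi> (v - of_int l) * (k1 u z * \<phi> (z - of_int l))))"
    unfolding k1_sym[of _ v] by (simp add: k1_idx[of v] sum_distrib_left mult_ac)
  also have "\<dots> = (\<Sum>l\<in>idx v. \<phi> (v - of_int l) * \<phi> (u - of_int l))"
    using i by (simp add: Bochner_Integration.integral_sum k1_phi)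
  also have "\<dots> = k1 u v" by (simp add: k1_sym[of u] k1_idx[of v])
  finally show ?thesis .
qed

text \<open>
  For \<open>\<delta> = D / \<sigma>\<close> this is, up to the factor \<open>\<sigma>\<close>, the projection kernel of level \<open>D\<close> evaluated
  at the standardized points \<open>(x - \<mu>) / \<sigma>\<close> and \<open>(y - \<mu>) / \<sigma>\<close>. It is again a reproducing
  kernel for Lebesgue measure, so that the sample need not be transformed.
\<close>

definition ker :: "real \<Rightarrow> real \<Rightarrow> real \<Rightarrow> real \<Rightarrow> real" where
  "ker \<delta> \<mu> x y = \<delta> * k1 (\<delta> * (x - \<mu>)) (\<delta> * (y - \<mu>))"

lemma integral_scale:
  fixes F :: "real \<Rightarrow> real"
  assumes "0 < \<delta>"
  shows "(LINT y|lborel. \<delta> * F (\<delta> * (y - \<mu>))) = (LINT y|lborel. F y)"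
  using lborel_integral_real_affine[of \<delta> F "- \<delta> * \<mu>"] assms by (simp add: algebra_simps)

lemma integrable_scale:
  fixes F :: "real \<Rightarrow> real"
  assumes "0 < \<delta>" "integrable lborel F"
  shows "integrable lborel (\<lambda>y. F (\<delta> * (y - \<mu>)))"
  using lborel_integrable_real_affine[OF assms(2), of \<delta> "- \<delta> * \<mu>"] assms(1) by (simp add: algebra_simps)

text \<open>The substitution \<open>v = \<delta> (y - \<mu>)\<close> reduces every integral to
  \<open>k1\<close>. The uniform bound picks up the factor \<open>\<delta>\<close>, whereas the L1
  bound is scale invariant.\<close>

lemma ker_repro_kernel:
  assumes "bounded_density f G" "0 < \<delta>"
  shows "repro_kernel f G (ker \<delta> \<mu>) (\<delta> * N) (4 * a * N)"
proof -
  interpret bounded_density f G by fact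
  show ?thesis
  proof
    show "(\<lambda>(x, y). ker \<delta> \<mu> x y) \<in> borel_measurable (borel \<Otimes>\<^sub>M borel)"
      unfolding ker_def case_prod_beta by measurable
    show "ker \<delta> \<mu> x y = ker \<delta> \<mu> y x" for x y by (simp add: ker_def k1_sym)
    show "0 < \<delta> * N" using assms N_pos by simp
    show "\<bar>ker \<delta> \<mu> x y\<bar> \<le> \<delta> * N" for x y
      using assms k1_abs by (simp add: ker_def abs_mult)
    show "integrable lborel (ker \<delta> \<mu> x)" for x
      unfolding ker_def[abs_def] using integrable_scale[OF assms(2) k1_int] by simp
    show "(LINT y|lborel. \<bar>ker \<delta> \<mu> x y\<bar>) \<le> 4 * a * N" for x
    proof -
      have "(LINT y|lborel. \<bar>ker \<delta> \<mu> x y\<bar>) = (LINT y|lborel. \<delta> * \<bar>k1 (\<delta> * (x - \<mu>)) (\<delta> * (y - \<mu>))\<bar>)"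
        using assms by (simp add: ker_def abs_mult)
      also have "\<dots> = (LINT v|lborel. \<bar>k1 (\<delta> * (x - \<mu>)) v\<bar>)"
        by (rule integral_scale[OF assms(2), of "\<lambda>v. \<bar>k1 (\<delta> * (x - \<mu>)) v\<bar>"])
      finally show ?thesis using k1_L1 by simp
    qed
    show "(LINT z|lborel. ker \<delta> \<mu> x z * ker \<delta> \<mu> z y) = ker \<delta> \<mu> x y" for x y
    proof -
      define F where "F v = \<delta> * (k1 (\<delta> * (x - \<mu>)) v * k1 v (\<delta> * (y - \<mu>)))" for v
      have "(LINT z|lborel. ker \<delta> \<mu> x z * ker \<delta> \<mu> z y) = (LINT z|lborel. \<delta> * F (\<delta> * (z - \<mu>)))"
        by (simp add: ker_def F_def mult_ac)
      also have "\<dots> = (LINT v|lborel. F v)" by (rule integral_scale[OF assms(2)])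
      also have "\<dots> = ker \<delta> \<mu> x y" by (simp add: F_def k1_repro ker_def)
      finally show ?thesis .
    qed
  qed
qed

lemma T_hat_wavelet:
  "T_hat \<phi> f0 n (2, D) y = 1 / (real n * (real n - 1)) *
       (\<Sum>i\<in>{1..n}. \<Sum>j\<in>{1..n} - {i}. real D * k1 (real D * y i) (real D * y j))
     + (l2_norm f0)\<^sup>2 - 2 / real n * (\<Sum>i\<in>{1..n}. f0 (y i))"
proof -
  have prod: "basis_fun \<phi> (2, D) k u * basis_fun \<phi> (2, D) k v
     = real D * (\<phi> (real D * u - of_int k) * \<phi> (real D * v - of_int k))" for k u v
    by (simp add: basis_fun_def dilate_def mult_ac)
  \<comment> \<open>The finitely many translates that some sample point can see; only on such a set
    can the sum over shifts be exchanged with the double sum.\<close>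
  define F where "F = (\<Union>i\<in>{1..n}. idx (real D * y i))"
  have F: "finite F" by (simp add: F_def)
  have nF: "\<phi> (real D * y i - of_int k) = 0" if "k \<notin> F" "i \<in> {1..n}" for k i
    using that by (intro notin_idx) (auto simp: F_def)
  have "(\<Sum>\<^sub>\<infinity>k\<in>(UNIV :: int set). \<Sum>i\<in>{1..n}. \<Sum>j\<in>{1..n} - {i}. basis_fun \<phi> (2, D) k (y i) * basis_fun \<phi> (2, D) k (y j))
    = (\<Sum>k\<in>F. \<Sum>i\<in>{1..n}. \<Sum>j\<in>{1..n} - {i}. real D * (\<phi> (real D * y i - of_int k) * \<phi> (real D * y j - of_int k)))"
    unfolding prod using F
  proof (rule infsum_finite_support)
    fix k assume "k \<notin> F"
    then show "(\<Sum>i\<in>{1..n}. \<Sum>j\<in>{1..n} - {i}. real D * (\<phi> (real D * y i - of_int k) * \<phi> (real D * y j - of_int k))) = 0"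
      by (intro sum.neutral ballI) (subst nF, auto)
  qed
  also have "\<dots> = (\<Sum>i\<in>{1..n}. \<Sum>j\<in>{1..n} - {i}. \<Sum>k\<in>F. real D * (\<phi> (real D * y i - of_int k) * \<phi> (real D * y j - of_int k)))"
    by (subst sum.swap, intro sum.cong refl, subst sum.swap, intro sum.cong refl)
  also have "\<dots> = (\<Sum>i\<in>{1..n}. \<Sum>j\<in>{1..n} - {i}. real D * k1 (real D * y i) (real D * y j))"
  proof (intro sum.cong refl)
    fix i j assume i: "i \<in> {1..n}"
    have "k1 (real D * y i) (real D * y j) = (\<Sum>k\<in>F. \<phi> (real D * y i - of_int k) * \<phi> (real D * y j - of_int k))"
      by (rule k1_eq[OF F]) (subst nF[OF _ i], auto)
    then show "(\<Sum>k\<in>F. real D * (\<phi> (real D * y i - of_int k) * \<phi> (real D * y j - of_int k)))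
       = real D * k1 (real D * y i) (real D * y j)"
      by (simp only: sum_distrib_left)
  qed
  finally show ?thesis by (simp only: T_hat_def)
qed

text \<open>With \<open>w = f0 ((y - \<mu>) / \<sigma>) / \<sigma>\<close>, each part of the
  statistic carries exactly one factor \<open>\<sigma>\<close>: the kernel by the definition of
  \<open>ker\<close>, the squared norm by substitution, and the linear term since \<open>f0\<close>
  at the standardized point is \<open>\<sigma> * w\<close>.\<close>

lemma T_hat_eq_stat:
  assumes "0 < \<sigma>" "repro_kernel f G (ker (real D / \<sigma>) \<mu>) A B"
  shows "T_hat \<phi> f0 n (2, D) (\<lambda>i. (x i - \<mu>) / \<sigma>)
    = \<sigma> * repro_kernel.stat (ker (real D / \<sigma>) \<mu>) (\<lambda>y. 1 / \<sigma> * f0 ((y - \<mu>) / \<sigma>)) n x"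
proof -
  let ?y = "\<lambda>i. (x i - \<mu>) / \<sigma>"
  have S: "(\<Sum>i\<in>{1..n}. \<Sum>j\<in>{1..n} - {i}. real D * k1 (real D * ?y i) (real D * ?y j))
     = \<sigma> * (\<Sum>i\<in>{1..n}. \<Sum>j\<in>{1..n} - {i}. ker (real D / \<sigma>) \<mu> (x i) (x j))"
    using assms by (simp add: ker_def sum_distrib_left)
  have "(l2_norm f0)\<^sup>2 = (LINT y|lborel. (f0 y)\<^sup>2)"
    by (simp add: l2_norm_def)
  also have "\<dots> = (LINT y|lborel. 1 / \<sigma> * (f0 (1 / \<sigma> * (y - \<mu>)))\<^sup>2)"
    by (rule integral_scale[symmetric]) (use assms in auto)
  also have "\<dots> = \<sigma> * (LINT y|lborel. (1 / \<sigma> * f0 ((y - \<mu>) / \<sigma>))\<^sup>2)"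
    using assms(1) by (simp add: power_divide power2_eq_square[of \<sigma>])
  finally have L: "(l2_norm f0)\<^sup>2 = \<sigma> * (LINT y|lborel. (1 / \<sigma> * f0 ((y - \<mu>) / \<sigma>))\<^sup>2)" .
  show ?thesis
    unfolding T_hat_wavelet S L repro_kernel.stat_def[OF assms(2)]
    using assms(1) by (simp add: distrib_left right_diff_distrib sum_distrib_left mult_ac)
qed

text \<open>The kernel at level \<open>D\<close> has Lipschitz constant \<open>c1 * D^2\<close> in
  each argument, and the normalization cancels the number of pairs. The condition on
  \<open>f0\<close> is stated at the sample points only, because it is available only on the support
  of \<open>f\<close>.\<close>

lemma T_hat_lipschitz:
  assumes n: "2 \<le> n" and y: "\<And>i. i \<in> {1..n} \<Longrightarrow> \<bar>y i - y' i\<bar> \<le> \<eta>"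
    and f0: "\<And>i. i \<in> {1..n} \<Longrightarrow> \<bar>f0 (y i) - f0 (y' i)\<bar> \<le> c * \<eta>"
  shows "\<bar>T_hat \<phi> f0 n (2, D) y - T_hat \<phi> f0 n (2, D) y'\<bar> \<le> 2 * c1 * (real D)\<^sup>2 * \<eta> + 2 * c * \<eta>"
proof -
  have n0: "0 < real n" "0 < real n - 1" using n by auto
  let ?K = "\<lambda>y i j. real D * k1 (real D * y i) (real D * y j)"
  have K: "\<bar>?K y i j - ?K y' i j\<bar> \<le> 2 * c1 * (real D)\<^sup>2 * \<eta>" if "i \<in> {1..n}" "j \<in> {1..n} - {i}" for i j
  proof -
    have "\<bar>?K y i j - ?K y' i j\<bar> = real D * \<bar>k1 (real D * y i) (real D * y j) - k1 (real D * y' i) (real D * y' j)\<bar>"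
      by (simp add: abs_mult flip: right_diff_distrib)
    also have "\<dots> \<le> real D * (c1 * (\<bar>real D * y i - real D * y' i\<bar> + \<bar>real D * y j - real D * y' j\<bar>))"
      by (intro mult_left_mono k1_lip) auto
    also have "\<dots> = real D * (c1 * (real D * (\<bar>y i - y' i\<bar> + \<bar>y j - y' j\<bar>)))"
      by (simp add: abs_mult distrib_left flip: right_diff_distrib)
    also have "\<dots> \<le> real D * (c1 * (real D * (\<eta> + \<eta>)))"
      using that c1_nonneg by (intro mult_left_mono add_mono y) auto
    finally show ?thesis by (simp add: power2_eq_square algebra_simps)
  qed
  define S where "S y = (\<Sum>i\<in>{1..n}. \<Sum>j\<in>{1..n} - {i}. ?K y i j)" for y
  have "\<bar>S y - S y'\<bar> \<le> (\<Sum>i\<in>{1..n}. \<Sum>j\<in>{1..n} - {i}. \<bar>?K y i j - ?K y' i j\<bar>)"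
    unfolding S_def sum_subtractf[symmetric] by (rule order_trans[OF sum_abs]) (intro sum_mono sum_abs)
  also have "\<dots> \<le> (\<Sum>i\<in>{1..n}. \<Sum>j\<in>{1..n} - {i}. 2 * c1 * (real D)\<^sup>2 * \<eta>)"
    by (intro sum_mono K)
  also have "\<dots> = real n * (real n - 1) * (2 * c1 * (real D)\<^sup>2 * \<eta>)"
    using n by (simp add: of_nat_diff)
  finally have "\<bar>S y - S y'\<bar> / (real n * (real n - 1)) \<le> 2 * c1 * (real D)\<^sup>2 * \<eta>"
    using n0 by (simp add: pos_divide_le_eq mult_ac)
  then have 1: "\<bar>1 / (real n * (real n - 1)) * S y - 1 / (real n * (real n - 1)) * S y'\<bar> \<le> 2 * c1 * (real D)\<^sup>2 * \<eta>"
    using n0 by (simp add: abs_divide abs_mult flip: diff_divide_distrib)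
  have "\<bar>(\<Sum>i\<in>{1..n}. f0 (y i)) - (\<Sum>i\<in>{1..n}. f0 (y' i))\<bar> \<le> (\<Sum>i\<in>{1..n}. \<bar>f0 (y i) - f0 (y' i)\<bar>)"
    unfolding sum_subtractf[symmetric] by (rule sum_abs)
  also have "\<dots> \<le> real (card {1..n}) * (c * \<eta>)" by (rule sum_bounded_above) (rule f0)
  finally have "2 / real n * \<bar>(\<Sum>i\<in>{1..n}. f0 (y i)) - (\<Sum>i\<in>{1..n}. f0 (y' i))\<bar> \<le> 2 / real n * (real n * (c * \<eta>))"
    using n0 by (intro mult_left_mono) auto
  then have 2: "\<bar>2 / real n * (\<Sum>i\<in>{1..n}. f0 (y i)) - 2 / real n * (\<Sum>i\<in>{1..n}. f0 (y' i))\<bar> \<le> 2 * c * \<eta>"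
  proof -
    have "\<bar>2 / real n * A - 2 / real n * B\<bar> = 2 / real n * \<bar>A - B\<bar>" for A B :: real
      unfolding right_diff_distrib[symmetric] abs_mult using n0 by simp
    then show ?thesis using \<open>_ \<le> 2 / real n * (real n * (c * \<eta>))\<close> n0 by simp
  qed
  show ?thesis using 1 2 unfolding T_hat_wavelet S_def by linarith
qed

end

section \<open>The kernel image of a density is its orthogonal projection\<close>

context repro_kernel
begin

lemma f_tail_small:
  assumes "0 < \<epsilon>"
  shows "\<exists>m::nat. (LINT x|lborel. f x * indicator {x. real m < \<bar>x\<bar>} x) < \<epsilon>"
proof -
  have "(\<lambda>m::nat. LINT x|lborel. f x * indicator {x. real m < \<bar>x\<bar>} x) \<longlonglongrightarrow> (LINT x :: real|lborel. 0 :: real)"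
  proof (rule integral_dominated_convergence[where w = f])
    show "AE x in lborel. (\<lambda>m::nat. f x * indicator {x. real m < \<bar>x\<bar>} x) \<longlonglongrightarrow> 0"
    proof (rule AE_I2, rule tendsto_eventually)
      fix x :: real
      obtain m0 :: nat where "\<bar>x\<bar> \<le> real m0" using real_arch_simple by blast
      then show "\<forall>\<^sub>F m in sequentially. f x * indicator {x. real m < \<bar>x\<bar>} x = 0"
        by (intro eventually_sequentiallyI[of m0]) (auto simp: indicator_def)
    qed
    show "AE x in lborel. norm (f x * indicator {x. real m < \<bar>x\<bar>} x) \<le> f x" for m :: nat
      by (auto simp: indicator_def f_ge)
  qed (use f_int in auto)
  then have "\<forall>\<^sub>F m in sequentially. (LINT x|lborel. f x * indicator {x. real m < \<bar>x\<bar>} x) < \<epsilon>"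
    using assms by (auto dest: order_tendstoD)
  then show ?thesis by (auto simp: eventually_sequentially)
qed

end

context scaling_fun
begin

context
  fixes g :: "real \<Rightarrow> real" and G :: real and D :: nat
  assumes g: "bounded_density g G" and D: "0 < D"
begin

interpretation repro_kernel g G "ker (real D) 0" "real D * N" "4 * a * N"
  by (rule ker_repro_kernel[OF g]) (use D in auto)

lemma dilate_meas [measurable]: "dilate \<phi> D k \<in> borel_measurable borel"
  unfolding dilate_def[abs_def] by measurable

lemma ker_dilate:
  assumes "finite F" "\<And>k. k \<notin> F \<Longrightarrow> dilate \<phi> D k x = 0"
  shows "ker (real D) 0 x y = (\<Sum>k\<in>F. dilate \<phi> D k x * dilate \<phi> D k y)"
proof -
  have "\<phi> (real D * x - of_int k) = 0" if "k \<notin> F" for k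
    using assms(2)[OF that] D by (simp add: dilate_def)
  then have "k1 (real D * x) (real D * y) = (\<Sum>k\<in>F. \<phi> (real D * x - of_int k) * \<phi> (real D * y - of_int k))"
    by (intro k1_eq assms(1)) auto
  then have "ker (real D) 0 x y = (\<Sum>k\<in>F. (sqrt (real D) * sqrt (real D)) * (\<phi> (real D * x - of_int k) * \<phi> (real D * y - of_int k)))"
    by (simp add: ker_def sum_distrib_left)
  then show ?thesis by (simp only: dilate_def mult_ac)
qed

lemma dilate_abs: "\<bar>dilate \<phi> D k x\<bar> \<le> sqrt (real D) * \<Phi>"
  using phi_le by (simp add: dilate_def abs_mult mult_left_mono)

lemma dilate_int: "integrable lborel (dilate \<phi> D k)"
proof -
  have "integrable lborel (\<lambda>x. \<phi> (x - of_int k))"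
  proof (rule Bochner_Integration.integrable_bound[OF interval_int[of \<Phi> "of_int k - a" "of_int k + a"]])
    have "\<bar>\<phi> (x - of_int k)\<bar> \<le> \<bar>\<Phi> * indicator {of_int k - a..of_int k + a} x\<bar>" for x
      using phi_le[of "x - of_int k"] phi_supp[of "x - of_int k"] Phi_pos
      by (cases "a < \<bar>x - of_int k\<bar>") (auto simp: indicator_def)
    then show "AE x in lborel. norm (\<phi> (x - of_int k)) \<le> norm (\<Phi> * indicator {of_int k - a..of_int k + a} x)"
      by auto
  qed simp
  from integrable_scale[OF _ this, of "real D" 0] show ?thesis
    using D by (simp add: dilate_def[abs_def])
qed

lemma dilate_L2: "dilate \<phi> D k \<in> L2"
  unfolding L2_iff power2_eq_square using integrable_mult_bounded[OF dilate_int _ dilate_abs] by simp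

lemma ker_dilate_repro: "(LINT y|lborel. ker (real D) 0 x y * dilate \<phi> D k y) = dilate \<phi> D k x"
proof -
  define F where "F v = sqrt (real D) * (k1 (real D * x) v * \<phi> (v - of_int k))" for v
  have "(LINT y|lborel. ker (real D) 0 x y * dilate \<phi> D k y) = (LINT y|lborel. real D * F (real D * (y - 0)))"
    by (simp add: ker_def F_def dilate_def mult_ac)
  also have "\<dots> = (LINT v|lborel. F v)" by (rule integral_scale) (use D in auto)
  also have "\<dots> = dilate \<phi> D k x" by (simp add: F_def k1_phi dilate_def)
  finally show ?thesis .
qed

lemma q_dilate: "(LINT y|lborel. q y * dilate \<phi> D k y) = (LINT x|lborel. g x * dilate \<phi> D k x)"
  using q_adjoint[OF dilate_int] by (simp add: ker_dilate_repro mult.commute[of "q _"])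

text \<open>By self-adjointness and the reproducing property, \<open>q\<close> and \<open>g\<close>
  have the same inner product with every basis function; closedness of the orthogonal complement
  does the rest.\<close>

lemma residual_orthogonal:
  assumes "u \<in> S2 \<phi> D"
  shows "(LINT x|lborel. (g x - q x) * u x) = 0"
proof (rule inner_closed_span_eq_0[OF L2_diff[OF f_L2 q_L2] _ _ assms[unfolded S2_def]])
  show "dilate \<phi> D k \<in> L2" for k by (rule dilate_L2)
  show "(LINT x|lborel. (g x - q x) * dilate \<phi> D k x) = 0" for k
    using L2_mult_integrable[OF f_L2 dilate_L2] L2_mult_integrable[OF q_L2 dilate_L2]
    by (simp add: left_diff_distrib q_dilate)
qed

text \<open>The expansion of \<open>q\<close> is infinite. Cut \<open>g\<close> at
  \<open>\<bar>x\<bar> = m\<close>: the inner part involves finitely many translates and gives a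
  finite combination, while the image \<open>r\<close> of the tail is small in sup norm and in L1,
  hence in L2.\<close>

lemma q_in_S2: "q \<in> S2 \<phi> D"
  unfolding S2_def L2_closed_span_def
proof (intro CollectI conjI allI impI q_L2)
  fix \<epsilon> :: real assume \<epsilon>: "0 < \<epsilon>"
  define c where "c = real D * N * (4 * a * N)"
  have c: "0 < c" using D N_pos a_pos by (simp add: c_def)
  \<comment> \<open>The constant \<open>c\<close> is the product of the sup and L1 bounds of the
    kernel, so the squared error is at most \<open>c * \<tau>^2\<close>; the 1 in the minimum turns
    \<open>\<tau>^2\<close> into \<open>\<tau>\<close>.\<close>
  obtain m :: nat where m: "(LINT x|lborel. g x * indicator {x. real m < \<bar>x\<bar>} x) < min 1 (\<epsilon>\<^sup>2 / c)"
    using f_tail_small[of "min 1 (\<epsilon>\<^sup>2 / c)"] \<epsilon> c by auto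
  define t where "t x = g x * indicator {x. real m < \<bar>x\<bar>} x" for x
  define b where "b x = g x * indicator {x. \<bar>x\<bar> \<le> real m} x" for x
  have t0: "0 \<le> t x" for x by (simp add: t_def f_ge)
  have ti: "integrable lborel t" unfolding t_def by (rule integrable_mult_bounded[OF f_int(1), of _ 1]) (auto simp: indicator_def)
  have bi: "integrable lborel b" unfolding b_def by (rule integrable_mult_bounded[OF f_int(1), of _ 1]) (auto simp: indicator_def)
  define \<tau> where "\<tau> = (LINT x|lborel. t x)"
  have \<tau>: "0 \<le> \<tau>" "\<tau> < 1" "\<tau> < \<epsilon>\<^sup>2 / c" using m t0 by (auto simp: \<tau>_def t_def)
  \<comment> \<open>For \<open>\<bar>x\<bar> \<le> m\<close> a translate with index beyond
    \<open>J\<close> in absolute value vanishes at \<open>x\<close>.\<close>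
  define J where "J = real D * real m + a"
  define F where "F = {\<lceil>-J\<rceil>..\<lfloor>J\<rfloor>}"
  have e0: "dilate \<phi> D k x = 0" if "k \<notin> F" "\<bar>x\<bar> \<le> real m" for k x
  proof -
    have "\<bar>real D * x\<bar> \<le> real D * real m" using that(2) by (simp add: abs_mult mult_left_mono)
    moreover have "J < \<bar>real_of_int k\<bar>" using that(1) by (auto simp: F_def le_floor_iff ceiling_le_iff)
    ultimately have "a < \<bar>real D * x - real_of_int k\<bar>" by (simp add: J_def)
    then show ?thesis by (simp add: dilate_def phi_supp)
  qed
  define co where "co k = (LINT x|lborel. b x * dilate \<phi> D k x)" for k
  have bk: "integrable lborel (\<lambda>x. b x * dilate \<phi> D k x)" for k
    by (rule integrable_mult_bounded[OF bi _ dilate_abs]) simp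
  have kb: "\<bar>ker (real D) 0 x y\<bar> \<le> real D * N" for x y by (rule k_le)
  have ki: "integrable lborel (\<lambda>x. t x * ker (real D) 0 x y)" "integrable lborel (\<lambda>x. b x * ker (real D) 0 x y)" for y
    by (rule integrable_mult_bounded[OF ti _ kb], simp) (rule integrable_mult_bounded[OF bi _ kb], simp)
  have split: "q y - (\<Sum>k\<in>F. co k * dilate \<phi> D k y) = (LINT x|lborel. t x * ker (real D) 0 x y)" for y
  proof -
    have "(LINT x|lborel. b x * ker (real D) 0 x y) = (LINT x|lborel. (\<Sum>k\<in>F. (b x * dilate \<phi> D k x) * dilate \<phi> D k y))"
    proof (rule Bochner_Integration.integral_cong)
      fix x
      show "b x * ker (real D) 0 x y = (\<Sum>k\<in>F. (b x * dilate \<phi> D k x) * dilate \<phi> D k y)"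
      proof (cases "\<bar>x\<bar> \<le> real m")
        case True
        have "ker (real D) 0 x y = (\<Sum>k\<in>F. dilate \<phi> D k x * dilate \<phi> D k y)"
          by (rule ker_dilate) (use e0 True in \<open>auto simp: F_def\<close>)
        then show ?thesis by (simp add: sum_distrib_left mult_ac)
      qed (simp add: b_def)
    qed simp
    also have "\<dots> = (\<Sum>k\<in>F. co k * dilate \<phi> D k y)"
      using bk by (subst Bochner_Integration.integral_sum) (auto simp: co_def)
    finally have "(\<Sum>k\<in>F. co k * dilate \<phi> D k y) = (LINT x|lborel. b x * ker (real D) 0 x y)" ..
    moreover have "q y = (LINT x|lborel. t x * ker (real D) 0 x y + b x * ker (real D) 0 x y)"
      unfolding q_def by (intro Bochner_Integration.integral_cong) (auto simp: t_def b_def indicator_def)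
    ultimately show ?thesis using ki by simp
  qed
  define r where "r y = (LINT x|lborel. t x * ker (real D) 0 x y)" for y
  have rb: "\<bar>r y\<bar> \<le> real D * N * \<tau>" for y
  proof -
    have "\<bar>r y\<bar> \<le> (LINT x|lborel. \<bar>t x * ker (real D) 0 x y\<bar>)" unfolding r_def by (rule integral_abs_bound)
    also have "\<dots> \<le> (LINT x|lborel. t x * (real D * N))"
      by (rule integral_mono) (use integrable_abs[OF ki(1)] ti kb t0 in \<open>auto simp: abs_mult intro: mult_left_mono\<close>)
    finally show ?thesis by (simp add: \<tau>_def mult_ac)
  qed
  have ri: "integrable lborel r" and r1: "(LINT y|lborel. \<bar>r y\<bar>) \<le> 4 * a * N * \<tau>"
    using kernel_operator_L1[OF ti t0] by (simp_all add: r_def[abs_def] \<tau>_def)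
  have [measurable]: "r \<in> borel_measurable borel" using borel_measurable_integrable[OF ri] by simp
  have "(LINT y|lborel. (r y)\<^sup>2) \<le> (LINT y|lborel. \<bar>r y\<bar> * (real D * N * \<tau>))"
  proof (rule integral_mono)
    show "integrable lborel (\<lambda>y. (r y)\<^sup>2)"
      unfolding power2_eq_square by (rule integrable_mult_bounded[OF ri _ rb]) simp
    show "(r y)\<^sup>2 \<le> \<bar>r y\<bar> * (real D * N * \<tau>)" for y
      using mult_left_mono[OF rb, of "\<bar>r y\<bar>" y] by (simp add: power2_eq_square)
  qed (use ri in auto)
  also have "\<dots> \<le> (4 * a * N * \<tau>) * (real D * N * \<tau>)"
    using r1 \<tau> D N_pos by (simp add: mult_right_mono)
  also have "\<dots> = c * \<tau>\<^sup>2" by (simp add: c_def power2_eq_square)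
  finally have r2: "(LINT y|lborel. (r y)\<^sup>2) \<le> c * \<tau>\<^sup>2" .
  show "\<exists>F c. finite F \<and> F \<subseteq> UNIV \<and> l2_norm (\<lambda>x. q x - (\<Sum>i\<in>F. c i * dilate \<phi> D i x)) < \<epsilon>"
  proof (intro exI conjI)
    show "finite F" by (simp add: F_def)
    have "c * \<tau>\<^sup>2 \<le> c * (\<tau> * 1)"
      unfolding power2_eq_square using \<tau> c by (intro mult_left_mono) auto
    also have "\<dots> < \<epsilon>\<^sup>2" using \<tau> c by (simp add: field_simps)
    finally have "(LINT y|lborel. (r y)\<^sup>2) < \<epsilon>\<^sup>2" using r2 by linarith
    then have "sqrt (LINT y|lborel. (r y)\<^sup>2) < sqrt (\<epsilon>\<^sup>2)" by (rule real_sqrt_less_mono)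
    then show "l2_norm (\<lambda>x. q x - (\<Sum>i\<in>F. co i * dilate \<phi> D i x)) < \<epsilon>"
      using \<epsilon> by (simp add: split l2_norm_def flip: r_def)
  qed simp
qed

text \<open>\<open>orth_proj\<close> is chosen by \<open>SOME\<close>; \<open>q\<close> witnesses
  that a choice exists. Once the chosen \<open>p\<close> is known to lie in the space, Pythagoras
  shows that \<open>q\<close> approximates \<open>g\<close> at least as well as
  \<open>p\<close>.\<close>

lemma bias_le_orth_proj: "bias \<le> (l2_norm (\<lambda>x. g x - orth_proj (S2 \<phi> D) g x))\<^sup>2"
proof -
  define p where "p = orth_proj (S2 \<phi> D) g"
  have "\<exists>p. p \<in> S2 \<phi> D \<and> (\<forall>h\<in>S2 \<phi> D. l2_inner (\<lambda>x. g x - p x) h = 0)"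
    using q_in_S2 residual_orthogonal by (auto simp: l2_inner_def)
  then have p: "p \<in> S2 \<phi> D" unfolding p_def orth_proj_def by (rule someI2_ex) auto
  then have pL: "p \<in> L2" by (simp add: S2_def L2_closed_span_def)
  note rL = L2_diff[OF f_L2 q_L2]
  have o: "(LINT x|lborel. (g x - q x) * (q x - p x)) = 0"
    using residual_orthogonal[OF p] residual_orthogonal[OF q_in_S2]
      L2_mult_integrable[OF rL q_L2] L2_mult_integrable[OF rL pL]
    by (simp add: right_diff_distrib)
  have "(l2_norm (\<lambda>x. g x - p x))\<^sup>2
     = (LINT x|lborel. (g x - q x)\<^sup>2 + 2 * ((g x - q x) * (q x - p x)) + (q x - p x)\<^sup>2)"
    unfolding l2_norm_sq by (intro Bochner_Integration.integral_cong) (auto simp: power2_eq_square algebra_simps)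
  also have "\<dots> = bias + (LINT x|lborel. (q x - p x)\<^sup>2)"
    using rL L2_diff[OF q_L2 pL] L2_mult_integrable[OF rL L2_diff[OF q_L2 pL]] o
    by (simp add: bias_def L2_iff)
  finally show ?thesis by (simp add: p_def)
qed

end

end

section \<open>Location-scale changes, and measurability of the statistics\<close>

lemma bounded_density_affine:
  assumes "bounded_density f G" "0 < \<sigma>"
  shows "bounded_density (\<lambda>x. \<sigma> * f (\<sigma> * x + \<mu>)) (\<sigma> * G)"
proof -
  interpret bounded_density f G by fact
  have "(\<integral>\<^sup>+x. ennreal (\<sigma> * f (\<sigma> * x + \<mu>)) \<partial>lborel) = ennreal \<bar>\<sigma>\<bar> * (\<integral>\<^sup>+x. ennreal (f (\<mu> + \<sigma> * x)) \<partial>lborel)"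
    using assms(2) by (subst nn_integral_cmult[symmetric]) (auto simp: ennreal_mult f_ge add.commute)
  also have "\<dots> = (\<integral>\<^sup>+x. ennreal (f x) \<partial>lborel)"
    by (rule nn_integral_real_affine[symmetric]) (use assms(2) in auto)
  also have "\<dots> = 1" using dens by (simp add: is_density_def)
  finally show ?thesis
    using assms(2) by unfold_locales (auto simp: is_density_def f_ge f_le)
qed

context scaling_fun
begin

text \<open>The class \<open>B_class\<close> speaks of the standardized density and the unshifted
  level \<open>D\<close>, the statistic of \<open>f\<close> and the kernel of scale
  \<open>D / \<sigma>\<close>; the substitution \<open>v = (y - \<mu>) / \<sigma>\<close> translates
  between them and costs one factor \<open>\<sigma>\<close>.\<close>

lemma bias_affine:
  assumes f: "bounded_density f G" and D: "0 < D" and \<sigma>: "0 < \<sigma>"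
  shows "repro_kernel.bias (\<lambda>x. \<sigma> * f (\<sigma> * x + \<mu>)) (ker (real D) 0)
    = \<sigma> * repro_kernel.bias f (ker (real D / \<sigma>) \<mu>)"
proof -
  define g where "g x = \<sigma> * f (\<sigma> * x + \<mu>)" for x
  interpret F: repro_kernel f G "ker (real D / \<sigma>) \<mu>" "real D / \<sigma> * N" "4 * a * N"
    by (rule ker_repro_kernel[OF f]) (use D \<sigma> in auto)
  interpret R: repro_kernel g "\<sigma> * G" "ker (real D) 0" "real D * N" "4 * a * N"
    unfolding g_def by (rule ker_repro_kernel[OF bounded_density_affine[OF f \<sigma>]]) (use D in auto)
  have g_aff: "g (1 / \<sigma> * (x - \<mu>)) = \<sigma> * f x" for x
    using \<sigma> by (simp add: g_def field_simps)
  have q: "R.q (1 / \<sigma> * (y - \<mu>)) = \<sigma> * F.q y" for y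
  proof -
    define H where "H t = g t * ker (real D) 0 t (1 / \<sigma> * (y - \<mu>))" for t
    have "R.q (1 / \<sigma> * (y - \<mu>)) = (LINT t|lborel. H t)" by (simp add: R.q_def H_def)
    also have "\<dots> = (LINT x|lborel. 1 / \<sigma> * H (1 / \<sigma> * (x - \<mu>)))"
      by (rule integral_scale[symmetric]) (use \<sigma> in auto)
    also have "\<dots> = (LINT x|lborel. \<sigma> * (f x * ker (real D / \<sigma>) \<mu> x y))"
      using \<sigma> unfolding H_def g_aff by (intro Bochner_Integration.integral_cong) (auto simp: ker_def)
    finally show ?thesis by (simp add: F.q_def)
  qed
  have "R.bias = (LINT v|lborel. (g v - R.q v)\<^sup>2)" by (rule R.bias_def)
  also have "\<dots> = (LINT y|lborel. 1 / \<sigma> * (g (1 / \<sigma> * (y - \<mu>)) - R.q (1 / \<sigma> * (y - \<mu>)))\<^sup>2)"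
    by (rule integral_scale[symmetric]) (use \<sigma> in auto)
  also have "\<dots> = (LINT y|lborel. \<sigma> * (f y - F.q y)\<^sup>2)"
    using \<sigma> unfolding g_aff q right_diff_distrib[symmetric] power_mult_distrib
    by (intro Bochner_Integration.integral_cong) (auto simp: power2_eq_square)
  also have "\<dots> = \<sigma> * F.bias" by (simp add: F.bias_def)
  finally show ?thesis by (simp add: g_def[abs_def])
qed

lemma bias_B_class:
  assumes f: "bounded_density f G" and B: "f \<in> B_class \<phi> K s R M" and K: "(\<mu>, \<sigma>) \<in> K" and \<sigma>: "0 < \<sigma>"
  shows "repro_kernel.bias f (ker (real (2 ^ J) / \<sigma>) \<mu>) \<le> R\<^sup>2 * \<sigma> powr (2 * s) * real (2 ^ J) powr (- 2 * s)"
proof -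
  let ?g = "\<lambda>x. \<sigma> * f (\<sigma> * x + \<mu>)"
  have D: "0 < (2 :: nat) ^ J" by simp
  have "\<sigma> * repro_kernel.bias f (ker (real (2 ^ J) / \<sigma>) \<mu>) = repro_kernel.bias ?g (ker (real (2 ^ J)) 0)"
    by (rule bias_affine[OF f D \<sigma>, symmetric])
  also have "\<dots> \<le> (l2_norm (\<lambda>x. ?g x - orth_proj (S2 \<phi> (2 ^ J)) ?g x))\<^sup>2"
    by (rule bias_le_orth_proj[OF bounded_density_affine[OF f \<sigma>] D])
  also have "\<dots> \<le> R\<^sup>2 * \<sigma> powr (1 + 2 * s) * real (2 ^ J) powr (- 2 * s)"
    using B K by (auto simp: B_class_def Let_def)
  also have "\<dots> = \<sigma> * (R\<^sup>2 * \<sigma> powr (2 * s) * real (2 ^ J) powr (- 2 * s))"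
    using \<sigma> by (simp add: powr_add)
  finally show ?thesis using \<sigma> by simp
qed

text \<open>The margin \<open>a + 1\<close> covers both families: histograms have support of width
  1, the scaling function has radius \<open>a\<close>.\<close>

lemma basis_fun_eq_0:
  assumes "0 < snd m" "real (snd m) * \<bar>x\<bar> + a + 1 < real_of_int \<bar>k\<bar>"
  shows "basis_fun \<phi> m k x = 0"
proof -
  have "\<bar>real (snd m) * x\<bar> + a + 1 < real_of_int \<bar>k\<bar>" using assms(2) by (simp add: abs_mult)
  then have *: "a + 1 < \<bar>real (snd m) * x - real_of_int k\<bar>" by linarith
  show ?thesis
  proof (cases "fst m = 1")
    case True
    have "\<not> (real_of_int k / real (snd m) \<le> x \<and> x < (real_of_int k + 1) / real (snd m))"
      using * assms(1) a_pos by (auto simp: field_simps)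
    then show ?thesis using True by (simp add: basis_fun_def hist_def indicator_def)
  next
    case False
    then show ?thesis using * phi_supp[of "real (snd m) * x - real_of_int k"] by (simp add: basis_fun_def dilate_def)
  qed
qed

lemma basis_fun_meas [measurable]: "basis_fun \<phi> m k \<in> borel_measurable borel"
  by (cases "fst m = 1") (simp_all add: basis_fun_def[abs_def] hist_def[abs_def] dilate_def[abs_def])

text \<open>Needed for every model, histograms included, since all of them enter the event that
  defines \<open>u_alpha\<close>. The sum over shifts is a pointwise limit of symmetric partial
  sums, eventually constant at each sample.\<close>

lemma T_hat_measurable:
  assumes m: "0 < snd m" and [measurable]: "f0 \<in> borel_measurable borel"
  shows "T_hat \<phi> f0 n m \<in> borel_measurable (sample_law n g)"
proof -
  let ?S = "sample_law n g"
  define Q where "Q k x = (\<Sum>i\<in>{1..n}. \<Sum>j\<in>{1..n} - {i}. basis_fun \<phi> m k (x i) * basis_fun \<phi> m k (x j))" for k x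
  have comp: "(\<lambda>x. u (x i)) \<in> borel_measurable ?S" if "i \<in> {1..n}" and [measurable]: "u \<in> borel_measurable borel" for i and u :: "real \<Rightarrow> real"
  proof -
    have 1: "(\<lambda>x. x i) \<in> ?S \<rightarrow>\<^sub>M dens_measure g"
      unfolding sample_law_def by (rule measurable_component_singleton) (use that in auto)
    have 2: "u \<in> borel_measurable (dens_measure g)" by (simp add: dens_measure_def)
    show ?thesis using measurable_compose[OF 1 2] .
  qed
  have Qm: "Q k \<in> borel_measurable ?S" for k
    unfolding Q_def by (intro borel_measurable_sum borel_measurable_times comp) auto
  have lim: "(\<lambda>N. \<Sum>k\<in>{-int N..int N}. Q k x) \<longlonglongrightarrow> (\<Sum>\<^sub>\<infinity>k\<in>UNIV. Q k x)" for x
  proof -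
    define b where "b = real (snd m) * (\<Sum>i\<in>{1..n}. \<bar>x i\<bar>) + a + 1"
    have z: "Q k x = 0" if "b < real_of_int \<bar>k\<bar>" for k
    proof -
      have "basis_fun \<phi> m k (x i) = 0" if i: "i \<in> {1..n}" for i
      proof (rule basis_fun_eq_0[OF m])
        have "\<bar>x i\<bar> \<le> (\<Sum>i\<in>{1..n}. \<bar>x i\<bar>)" using i by (intro member_le_sum) auto
        then have "real (snd m) * \<bar>x i\<bar> \<le> real (snd m) * (\<Sum>i\<in>{1..n}. \<bar>x i\<bar>)" by (intro mult_left_mono) auto
        then show "real (snd m) * \<bar>x i\<bar> + a + 1 < real_of_int \<bar>k\<bar>"
          using \<open>b < real_of_int \<bar>k\<bar>\<close> by (simp add: b_def)
      qed
      then show ?thesis by (simp add: Q_def)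
    qed
    obtain N0 :: nat where N0: "b \<le> real N0" using real_arch_simple by blast
    have "(\<Sum>\<^sub>\<infinity>k\<in>UNIV. Q k x) = (\<Sum>k\<in>{-int N..int N}. Q k x)" if "N0 \<le> N" for N
    proof (rule infsum_finite_support)
      fix k assume "k \<notin> {- int N..int N}"
      then have "real N < real_of_int \<bar>k\<bar>" by auto
      moreover have "real N0 \<le> real N" using that by simp
      ultimately have "b < real_of_int \<bar>k\<bar>" using N0 by linarith
      then show "Q k x = 0" by (rule z)
    qed simp
    then show ?thesis
      by (intro tendsto_eventually eventually_sequentiallyI[of N0]) auto
  qed
  have "(\<lambda>x. \<Sum>\<^sub>\<infinity>k\<in>UNIV. Q k x) \<in> borel_measurable ?S"
    by (rule borel_measurable_LIMSEQ_real[OF lim]) (use Qm in auto)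
  moreover have "(\<lambda>x. \<Sum>i\<in>{1..n}. f0 (x i)) \<in> borel_measurable ?S"
    by (intro borel_measurable_sum comp) auto
  ultimately show ?thesis unfolding T_hat_def[abs_def] Q_def[symmetric]
    by (intro borel_measurable_diff borel_measurable_add borel_measurable_times) auto
qed

end

lemma wavelet_pair_scaling_fun:
  assumes "wavelet_pair \<phi> \<psi>"
  shows "\<exists>a \<Phi> \<Lambda>. scaling_fun \<phi> a \<Phi> \<Lambda>"
proof -
  have comp: "compact (supp \<phi>)" and lip: "\<exists>C. C-lipschitz_on UNIV \<phi>"
    and basis: "orthonormal_basis_L2 ((UNIV :: int set) <+> ({J..} \<times> (UNIV :: int set)))
        (case_sum (\<lambda>k. dilate \<phi> (2 ^ J) k) (\<lambda>(j, k). dilate \<psi> (2 ^ j) k))" for J :: nat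
    using assms unfolding wavelet_pair_def by blast+
  obtain \<Lambda> where L: "\<Lambda>-lipschitz_on UNIV \<phi>" using lip by blast
  then have L0: "0 \<le> \<Lambda>" and Lle: "\<bar>\<phi> x - \<phi> y\<bar> \<le> \<Lambda> * \<bar>x - y\<bar>" for x y
    using lipschitz_on_nonneg[OF L] lipschitz_onD[OF L, of x y] by (auto simp: dist_real_def)
  obtain b where b: "0 < b" "\<forall>x\<in>supp \<phi>. norm x \<le> b"
    using compact_imp_bounded[OF comp] bounded_pos[of "supp \<phi>"] by blast
  have z: "\<phi> x = 0" if "b < \<bar>x\<bar>" for x
  proof (rule ccontr)
    assume "\<phi> x \<noteq> 0"
    then have "x \<in> supp \<phi>" unfolding supp_def support_on_def by (intro subsetD[OF closure_subset]) auto
    then show False using b that by auto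
  qed
  \<comment> \<open>The bound is read off the Lipschitz condition against the zero at
    \<open>b + 1\<close>; the final 1 keeps it positive.\<close>
  have "\<bar>\<phi> x\<bar> \<le> \<Lambda> * (2 * b + 1) + 1" for x
  proof (cases "b < \<bar>x\<bar>")
    case True
    then show ?thesis using z[OF True] L0 b by (auto intro!: add_nonneg_nonneg mult_nonneg_nonneg)
  next
    case False
    have "\<bar>\<phi> x\<bar> \<le> \<Lambda> * \<bar>x - (b + 1)\<bar>" using Lle[of x "b + 1"] z[of "b + 1"] b by auto
    also have "\<dots> \<le> \<Lambda> * (2 * b + 1)" using False L0 by (intro mult_left_mono) auto
    finally show ?thesis by simp
  qed
  moreover have "0 < \<Lambda> * (2 * b + 1) + 1" using L0 b by (intro add_nonneg_pos mult_nonneg_nonneg) auto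
  moreover have "(LINT x|lborel. \<phi> (x - of_int k) * \<phi> (x - of_int l)) = (if k = l then 1 else 0)" for k l
  proof -
    \<comment> \<open>Left injections index the scaling functions, and level \<open>J = 0\<close>
      gives the integer translates.\<close>
    have "Inl k \<in> (UNIV :: int set) <+> ({0::nat..} \<times> (UNIV :: int set))"
      "Inl l \<in> (UNIV :: int set) <+> ({0::nat..} \<times> (UNIV :: int set))" by auto
    then have "l2_inner (dilate \<phi> (2 ^ 0) k) (dilate \<phi> (2 ^ 0) l) = (if k = l then 1 else 0)"
      using basis[of 0, unfolded orthonormal_basis_L2_def orthonormal_family_def,
          THEN conjunct1, THEN conjunct2, rule_format, of "Inl k" "Inl l"] by simp
    then show ?thesis by (simp add: l2_inner_def dilate_def)
  qed
  ultimately have "scaling_fun \<phi> b (\<Lambda> * (2 * b + 1) + 1) \<Lambda>"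
    using b L0 Lle z by unfold_locales auto
  then show ?thesis by blast
qed

section \<open>Quantiles and the level of the test\<close>

text \<open>For a finite quantile, right continuity carries \<open>1 - u \<le> cdf\<close> down to
  the quantile itself. At \<open>\<infinity>\<close> the event is empty, and
  \<open>-\<infinity>\<close> is impossible because the cdf tends to 0 there while
  \<open>1 - u\<close> is positive.\<close>

lemma measure_gt_quantile_le:
  assumes "prob_space S" and T [measurable]: "T \<in> borel_measurable S" and u: "0 < u" "u < 1"
  shows "measure S {x \<in> space S. ereal (T x) - quantile (distr S borel T) (1 - u) > 0} \<le> u"
proof -
  interpret prob_space S by fact
  let ?N = "distr S borel T"
  interpret N: real_distribution ?N by (rule real_distribution_distr) simp
  define q where "q = quantile ?N (1 - u)"
  have gt: "1 - u \<le> cdf ?N t" if less: "q < ereal t" for t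
  proof -
    obtain t' where "1 - u \<le> cdf ?N t'" "t' < t"
      using less unfolding q_def quantile_def INF_less_iff by auto
    then show ?thesis using N.cdf_nondecreasing[of t' t] by linarith
  qed
  show ?thesis
  proof (cases q)
    case (real r)
    have "1 - u \<le> cdf ?N r"
    proof (rule tendsto_lowerbound)
      show "(cdf ?N \<longlongrightarrow> cdf ?N r) (at_right r)"
        using N.cdf_is_right_cont[of r] by (simp add: continuous_within)
      show "\<forall>\<^sub>F t in at_right r. 1 - u \<le> cdf ?N t"
        unfolding eventually_at_right_field using gt real by (intro exI[of _ "r + 1"]) auto
    qed simp
    also have "cdf ?N r = measure S {x \<in> space S. T x \<le> r}"
      unfolding cdf_def by (subst measure_distr) (auto intro!: arg_cong[where f="measure S"])
    also have "\<dots> = 1 - measure S {x \<in> space S. \<not> T x \<le> r}"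
      using prob_neg[of "\<lambda>x. T x \<le> r"] by simp
    finally show ?thesis
      using real by (simp add: q_def[symmetric] not_le)
  next
    case PInf
    then show ?thesis using u by (simp add: q_def[symmetric])
  next
    case MInf
    have "1 - u \<le> 0"
    proof (rule tendsto_lowerbound)
      show "(cdf ?N \<longlongrightarrow> 0) at_bot" by (rule N.cdf_lim_at_bot)
      show "\<forall>\<^sub>F t in at_bot. 1 - u \<le> cdf ?N t" using gt MInf by simp
    qed simp
    then show ?thesis using u by simp
  qed
qed

text \<open>Bonferroni: with \<open>u = \<alpha> / card Ms\<close> each model exceeds its quantile
  with probability at most \<open>u\<close>, so this \<open>u\<close> belongs to the set whose
  supremum is taken.\<close>

lemma u_alpha_ge:
  assumes "prob_space (sample_law n f0)" "finite Ms" "Ms \<noteq> {}" and \<alpha>: "0 < \<alpha>" "\<alpha> < 1"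
    and T: "\<And>m. m \<in> Ms \<Longrightarrow> T_hat \<phi> f0 n m \<in> borel_measurable (sample_law n f0)"
  shows "\<alpha> / real (card Ms) \<le> u_alpha \<phi> f0 n Ms \<alpha>"
proof -
  let ?S = "sample_law n f0"
  interpret prob_space ?S by fact
  define u where "u = \<alpha> / real (card Ms)"
  have card: "1 \<le> real (card Ms)" using assms(2,3) by (simp add: card_gt_0_iff Suc_leI)
  have u: "0 < u" "u < 1" using \<alpha> card by (auto simp: u_def divide_less_eq)
  let ?E = "\<lambda>m. {x \<in> space ?S. ereal (T_hat \<phi> f0 n m x) - t_quant \<phi> f0 n m u > 0}"
  have E: "{x \<in> space ?S. (SUP m\<in>Ms. ereal (T_hat \<phi> f0 n m x) - t_quant \<phi> f0 n m u) > 0} = (\<Union>m\<in>Ms. ?E m)"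
    by (auto simp: less_SUP_iff)
  have "measure ?S (\<Union>m\<in>Ms. ?E m) \<le> (\<Sum>m\<in>Ms. measure ?S (?E m))"
  proof (rule finite_measure_subadditive_finite[OF assms(2)])
    show "?E ` Ms \<subseteq> sets ?S"
    proof (rule image_subsetI)
      fix m assume "m \<in> Ms"
      show "?E m \<in> sets ?S"
        by (rule borel_measurable_less[OF borel_measurable_const
            borel_measurable_ereal_diff[OF borel_measurable_ereal[OF T[OF \<open>m \<in> Ms\<close>]] borel_measurable_const]])
    qed
  qed
  also have "\<dots> \<le> (\<Sum>m\<in>Ms. u)"
  proof (rule sum_mono)
    fix m assume "m \<in> Ms"
    from measure_gt_quantile_le[OF assms(1) T[OF this] u]
    show "measure ?S (?E m) \<le> u" by (simp only: t_quant_def)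
  qed
  also have "\<dots> = \<alpha>" using card by (simp add: u_def)
  finally show ?thesis
    unfolding u_alpha_def u_def[symmetric] E[symmetric] using u
    by (intro cSup_upper bdd_aboveI[of _ 1]) auto
qed

text \<open>The cdf at \<open>t\<close> is at least \<open>1 - \<alpha> / card Ms\<close>, hence at
  least \<open>1 - u_alpha\<close>, so \<open>t\<close> takes part in the infimum that defines the
  quantile.\<close>

lemma t_quant_u_alpha_le:
  assumes S: "prob_space (sample_law n f0)" and Ms: "finite Ms" "m \<in> Ms" and \<alpha>: "0 < \<alpha>" "\<alpha> < 1"
    and T: "\<And>m. m \<in> Ms \<Longrightarrow> T_hat \<phi> f0 n m \<in> borel_measurable (sample_law n f0)"
    and t: "whp (sample_law n f0) (\<alpha> / real (card Ms)) (\<lambda>x. T_hat \<phi> f0 n m x \<le> t)"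
  shows "t_quant \<phi> f0 n m (u_alpha \<phi> f0 n Ms \<alpha>) \<le> ereal t"
proof -
  let ?S = "sample_law n f0" and ?T = "T_hat \<phi> f0 n m"
  interpret prob_space ?S by fact
  note [measurable] = T[OF Ms(2)]
  obtain N where N: "N \<in> sets ?S" "emeasure ?S N \<le> ennreal (\<alpha> / real (card Ms))" "\<forall>x\<in>space ?S - N. ?T x \<le> t"
    using t by (auto simp: whp_def)
  have "measure ?S N \<le> \<alpha> / real (card Ms)"
    using N(2) \<alpha> by (simp add: emeasure_eq_measure)
  then have "1 - \<alpha> / real (card Ms) \<le> measure ?S (space ?S - N)"
    using prob_compl[OF N(1)] by simp
  also have "\<dots> \<le> measure ?S {x \<in> space ?S. ?T x \<le> t}"
    by (rule finite_measure_mono) (use N in auto)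
  also have "\<dots> = cdf (distr ?S borel ?T) t"
    unfolding cdf_def by (subst measure_distr) (auto intro!: arg_cong[where f="measure ?S"])
  finally have "1 - u_alpha \<phi> f0 n Ms \<alpha> \<le> cdf (distr ?S borel ?T) t"
    using u_alpha_ge[OF S Ms(1) _ \<alpha> T] Ms(2) by fastforce
  then show ?thesis unfolding t_quant_def quantile_def by (intro INF_lower) auto
qed

text \<open>The case distinction is about extended values: against a finite \<open>T_tilde\<close>,
  a quantile of \<open>-\<infinity>\<close> would make the difference infinite.\<close>

lemma T_alpha_le_0_imp:
  assumes "T_alpha \<phi> f0 K n Ms \<alpha> x \<le> 0" "m \<in> Ms" "t_quant \<phi> f0 n m (u_alpha \<phi> f0 n Ms \<alpha>) \<le> ereal t"
  shows "T_tilde \<phi> f0 K n m x \<le> ereal t"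
proof -
  have "T_tilde \<phi> f0 K n m x - t_quant \<phi> f0 n m (u_alpha \<phi> f0 n Ms \<alpha>) \<le> 0"
    using assms(1,2) unfolding T_alpha_def SUP_le_iff by blast
  then show ?thesis using assms(3)
    by (cases "T_tilde \<phi> f0 K n m x"; cases "t_quant \<phi> f0 n m (u_alpha \<phi> f0 n Ms \<alpha>)") auto
qed

section \<open>Dyadic levels, logarithms, grids and the bias-variance balance\<close>

lemma finite_dyadic_upto: "0 < b \<Longrightarrow> finite (dyadic_upto b)"
  and card_dyadic_upto: "1 \<le> b \<Longrightarrow> real (card (dyadic_upto b)) \<le> log 2 b + 1"
  and dyadic_upto_pos: "D \<in> dyadic_upto b \<Longrightarrow> 0 < D"
proof -
  have sub: "dyadic_upto b \<subseteq> (\<lambda>J. 2 ^ J) ` {..nat \<lfloor>log 2 b\<rfloor>}" if "1 \<le> b"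
  proof
    fix D assume "D \<in> dyadic_upto b"
    then obtain J where J: "D = 2 ^ J" "real J \<le> log 2 b" by (auto simp: dyadic_upto_def)
    then have "J \<le> nat \<lfloor>log 2 b\<rfloor>" by (simp add: le_nat_floor)
    then show "D \<in> (\<lambda>J. 2 ^ J) ` {..nat \<lfloor>log 2 b\<rfloor>}" using J by auto
  qed
  show "finite (dyadic_upto b)" if b: "0 < b"
  proof (cases "1 \<le> b")
    case True
    then show ?thesis using finite_subset[OF sub] by auto
  next
    case False
    then have "log 2 b < 0" using b by simp
    then have "dyadic_upto b = {}" by (auto simp: dyadic_upto_def)
    then show ?thesis by simp
  qed
  show "real (card (dyadic_upto b)) \<le> log 2 b + 1" if b: "1 \<le> b"
  proof -
    have "card (dyadic_upto b) \<le> card {..nat \<lfloor>log 2 b\<rfloor>}"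
      by (rule order_trans[OF card_mono[OF _ sub[OF b]] card_image_le]) auto
    then have "card (dyadic_upto b) \<le> nat \<lfloor>log 2 b\<rfloor> + 1" by simp
    moreover have "0 \<le> log 2 b" using b by simp
    ultimately show ?thesis by linarith
  qed
  show "0 < D" if "D \<in> dyadic_upto b" using that by (auto simp: dyadic_upto_def)
qed

lemma ln_le_half: "0 < (y :: real) \<Longrightarrow> ln y \<le> y / 2"
proof -
  assume y: "0 < y"
  have "ln (y / 2) \<le> y / 2 - 1" using y by (intro ln_le_minus_one) auto
  moreover have "ln (2 :: real) \<le> 1" using ln_le_minus_one[of "2 :: real"] by simp
  ultimately show ?thesis using y by (simp add: ln_div)
qed

lemma ln_le_sqrt: "0 < (y :: real) \<Longrightarrow> ln y \<le> sqrt y"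
  using ln_le_half[of "sqrt y"] by (simp add: ln_sqrt)

text \<open>Ensures \<open>n^2 / (ln n)^3 \<ge> 1\<close>, so that level \<open>D = 1\<close> is
  always available. With \<open>z = y powr (2/3)\<close> the claim reduces to
  \<open>ln y \<le> z\<close>.\<close>

lemma ln_cube_le_square:
  assumes "1 \<le> (y :: real)" shows "(ln y) ^ 3 \<le> y\<^sup>2"
proof -
  define z where "z = y powr (2/3)"
  have z: "0 < z" using assms by (simp add: z_def)
  have "ln y = 3/2 * ln z" using assms by (simp add: z_def ln_powr)
  also have "\<dots> \<le> z" using ln_le_half[OF z] z by simp
  finally have "(ln y) ^ 3 \<le> z ^ 3" using assms by (intro power_mono) auto
  also have "z ^ 3 = y\<^sup>2"
    using assms by (simp add: z_def powr_power powr_numeral)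
  finally show ?thesis .
qed

lemma ln_ge_1_of_ge_3: "3 \<le> (y :: real) \<Longrightarrow> 1 \<le> ln y"
proof -
  assume y: "3 \<le> y"
  have "exp 1 \<le> y" using exp_le y by simp
  then show ?thesis using y by (subst ln_ge_iff) auto
qed

lemma interval_net:
  fixes u v \<delta> :: real
  assumes "u \<le> v" "0 < \<delta>"
  shows "\<exists>F. finite F \<and> F \<subseteq> {u..v} \<and> real (card F) \<le> (v - u) / \<delta> + 1 \<and> (\<forall>x\<in>{u..v}. \<exists>y\<in>F. \<bar>x - y\<bar> \<le> \<delta>)"
proof -
  define p where "p = nat \<lfloor>(v - u) / \<delta>\<rfloor>"
  define F where "F = (\<lambda>i. u + real i * \<delta>) ` {..p}"
  have 0: "0 \<le> (v - u) / \<delta>" using assms by simp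
  have p: "real p \<le> (v - u) / \<delta>" using 0 by (simp add: p_def)
  have "card F \<le> p + 1" unfolding F_def using card_image_le[of "{..p}"] by fastforce
  then have "real (card F) \<le> (v - u) / \<delta> + 1" using p by linarith
  moreover have "F \<subseteq> {u..v}"
  proof
    fix y assume "y \<in> F"
    then obtain i where i: "i \<le> p" "y = u + real i * \<delta>" by (auto simp: F_def)
    then have "real i \<le> (v - u) / \<delta>" using p by linarith
    then have "real i * \<delta> \<le> v - u" using assms by (simp add: pos_le_divide_eq)
    then show "y \<in> {u..v}" using i assms by auto
  qed
  moreover have "\<exists>y\<in>F. \<bar>x - y\<bar> \<le> \<delta>" if x: "x \<in> {u..v}" for x
  proof -
    define i where "i = nat \<lfloor>(x - u) / \<delta>\<rfloor>"
    have "0 \<le> (x - u) / \<delta>" using x assms by simp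
    then have i: "real i \<le> (x - u) / \<delta>" "(x - u) / \<delta> < real i + 1"
      unfolding i_def by linarith+
    have "\<lfloor>(x - u) / \<delta>\<rfloor> \<le> \<lfloor>(v - u) / \<delta>\<rfloor>"
      using x assms by (intro floor_mono divide_right_mono) auto
    then have "i \<le> p" by (simp add: i_def p_def nat_mono)
    moreover have "real i * \<delta> \<le> x - u" "x - u < (real i + 1) * \<delta>"
      using i assms by (simp_all add: pos_le_divide_eq pos_divide_less_eq)
    then have "\<bar>x - (u + real i * \<delta>)\<bar> \<le> \<delta>" by (simp add: abs_le_iff algebra_simps)
    ultimately show ?thesis by (auto simp: F_def)
  qed
  moreover have "finite F" by (simp add: F_def)
  ultimately show ?thesis by blast
qed

text \<open>The real level \<open>E\<close> at which squared bias and deviation agree is rounded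
  down to a power of 2, after capping at \<open>b\<close>. Rounding costs
  \<open>2 powr (2 s)\<close>, and the cap produces the term with \<open>b\<close>.\<close>

lemma optimal_level:
  fixes R r s b :: real
  assumes R: "0 < R" and r: "0 < r" and s: "0 < s" and b: "1 \<le> b"
  defines "opt \<equiv> R powr (2 / (4 * s + 1)) * r powr (4 * s / (4 * s + 1))"
  shows "\<exists>J::nat. real J \<le> log 2 b
     \<and> R\<^sup>2 * real (2 ^ J) powr (- 2 * s) \<le> 2 powr (2 * s) * (opt + R\<^sup>2 * b powr (- 2 * s))
     \<and> sqrt (real (2 ^ J)) * r \<le> opt + r"
proof -
  define t where "t = 4 * s + 1"
  have t: "0 < t" using s by (simp add: t_def)
  \<comment> \<open>The solution of \<open>R^2 E powr (- 2 s) = sqrt E * r\<close>; both sides then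
    equal \<open>opt\<close>.\<close>
  define E where "E = (R\<^sup>2 / r) powr (2 / t)"
  have E0: "0 < E" using R r by (simp add: E_def)
  have lnE: "ln E = 2 / t * (2 * ln R - ln r)"
    using R r by (simp add: E_def ln_powr ln_div ln_realpow)
  have opt0: "0 < opt" using R r by (simp add: opt_def)
  have lnopt: "ln opt = 2 / t * ln R + 4 * s / t * ln r"
    using R r by (simp add: opt_def ln_mult ln_powr t_def)
  have 1: "R\<^sup>2 * E powr (- 2 * s) = opt"
  proof -
    have "ln (R\<^sup>2 * E powr (- 2 * s)) = 2 * ln R - 2 * s * ln E"
      using R E0 by (simp add: ln_mult ln_realpow ln_powr)
    also have "\<dots> = ln opt"
      unfolding lnE lnopt using t by (simp add: field_simps) (simp add: t_def algebra_simps)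
    finally show ?thesis using R E0 opt0 by (subst (asm) ln_inj_iff) auto
  qed
  have 2: "sqrt E * r = opt"
  proof -
    have "ln (sqrt E * r) = ln E / 2 + ln r"
      using r E0 by (simp add: ln_mult ln_sqrt)
    also have "\<dots> = ln opt"
      unfolding lnE lnopt using t by (simp add: field_simps) (simp add: t_def algebra_simps)
    finally show ?thesis using r E0 opt0 by (subst (asm) ln_inj_iff) auto
  qed
  show ?thesis
  proof (cases "1 \<le> E")
    case True
    define x where "x = min E b"
    have x: "1 \<le> x" "x \<le> E" "x \<le> b" using True b by (auto simp: x_def)
    define J where "J = nat \<lfloor>log 2 x\<rfloor>"
    have l0: "0 \<le> log 2 x" using x by simp
    then have J: "real J \<le> log 2 x" "log 2 x < real J + 1" unfolding J_def by linarith+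
    have D: "real (2 ^ J) = 2 powr real J" by (simp add: powr_realpow)
    have Dx: "real (2 ^ J) \<le> x"
    proof -
      have "2 powr real J \<le> 2 powr (log 2 x)" using J by (intro powr_mono) auto
      then show ?thesis using x unfolding D by simp
    qed
    have xD: "x / 2 \<le> real (2 ^ J)"
    proof -
      have "2 powr (log 2 x) \<le> 2 powr (real J + 1)" using J by (intro powr_mono) auto
      then show ?thesis using x unfolding D by (simp add: powr_add)
    qed
    have "real J \<le> log 2 b" using J x by (smt (verit) log_le_cancel_iff)
    moreover have "R\<^sup>2 * real (2 ^ J) powr (- 2 * s) \<le> 2 powr (2 * s) * (opt + R\<^sup>2 * b powr (- 2 * s))"
    proof -
      have "real (2 ^ J) powr (- 2 * s) \<le> (x / 2) powr (- 2 * s)"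
        using xD x s by (intro powr_mono2') auto
      also have "\<dots> = 2 powr (2 * s) * x powr (- 2 * s)"
        using x by (simp add: powr_divide powr_minus field_simps)
      also have "x powr (- 2 * s) \<le> E powr (- 2 * s) + b powr (- 2 * s)"
        by (simp add: x_def min_def)
      finally have "real (2 ^ J) powr (- 2 * s) \<le> 2 powr (2 * s) * (E powr (- 2 * s) + b powr (- 2 * s))" by simp
      then have "R\<^sup>2 * real (2 ^ J) powr (- 2 * s) \<le> R\<^sup>2 * (2 powr (2 * s) * (E powr (- 2 * s) + b powr (- 2 * s)))"
        by (intro mult_left_mono) auto
      also have "\<dots> = 2 powr (2 * s) * (R\<^sup>2 * E powr (- 2 * s) + R\<^sup>2 * b powr (- 2 * s))"
        by (simp add: algebra_simps)
      finally show ?thesis unfolding 1 .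
    qed
    moreover have "sqrt (real (2 ^ J)) * r \<le> opt + r"
    proof -
      have "sqrt (real (2 ^ J)) * r \<le> sqrt E * r"
        using Dx x r by (intro mult_right_mono real_sqrt_le_mono) auto
      then show ?thesis using 2 r by simp
    qed
    ultimately show ?thesis by blast
  next
    case False
    \<comment> \<open>The ideal level lies below 1, so \<open>J = 0\<close> is taken: the squared
      bias \<open>R^2\<close> is already at most \<open>opt\<close>, and the deviation is just
      \<open>r\<close>.\<close>
    have "1 powr (- 2 * s) \<le> E powr (- 2 * s)"
      by (rule powr_mono2') (use False E0 s in auto)
    then have "1 \<le> E powr (- 2 * s)" by simp
    then have "R\<^sup>2 * 1 \<le> R\<^sup>2 * E powr (- 2 * s)" by (intro mult_left_mono) auto
    then have "R\<^sup>2 \<le> opt" using 1 by simp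
    also have "\<dots> \<le> 1 * (opt + R\<^sup>2 * b powr (- 2 * s))" by simp
    also have "\<dots> \<le> 2 powr (2 * s) * (opt + R\<^sup>2 * b powr (- 2 * s))"
      using opt0 s by (intro mult_right_mono ge_one_powr_ge_zero) auto
    finally have "R\<^sup>2 \<le> 2 powr (2 * s) * (opt + R\<^sup>2 * b powr (- 2 * s))" .
    then show ?thesis using b opt0 by (intro exI[of _ 0]) auto
  qed
qed

text \<open>Here \<open>X\<close> stands for \<open>ln n\<close>. The restriction
  \<open>D X^3 \<le> n^2\<close> is exactly what makes the term with \<open>l^2 H\<close> comparable
  to \<open>n sqrt (D X)\<close>, the order of the Gaussian term; the second term needs
  \<open>X \<le> sqrt n\<close>.\<close>

lemma U_bound_rate:
  fixes n D X a0 :: real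
  assumes n: "3 \<le> n" and X: "1 \<le> X" "X \<le> sqrt n" and D: "1 \<le> D" "D * X ^ 3 \<le> n\<^sup>2"
    and a0: "0 < a0" and G: "0 < G" and H: "0 \<le> H" "H \<le> h0 * D" and l: "l = a0 * X"
  shows "2 * (6 * n * sqrt (G * H * l) + 6 * l * sqrt (n * G * H * l) + 2 * l\<^sup>2 * H + 16 * G * n * l) / (n * (n - 1))
    \<le> ((24 + 24 * a0) * sqrt (G * h0 * a0) + 8 * a0\<^sup>2 * h0) * (sqrt D * (sqrt X / n)) + 64 * G * a0 * (X / n)"
proof -
  define k where "k = sqrt (G * h0 * a0)"
  have "0 \<le> h0 * D" using H by linarith
  then have h0: "0 \<le> h0" using D by (simp add: zero_le_mult_iff)
  have k0: "0 \<le> k" by (simp add: k_def h0 G less_imp_le a0)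
  have l0: "0 < l" using a0 X l by simp
  have sn: "0 < sqrt n" "sqrt n * sqrt n = n" using n by auto
  have s1: "sqrt (G * H * l) \<le> k * (sqrt D * sqrt X)"
  proof -
    have "G * H * l \<le> G * (h0 * D) * l" using H G l0 by (intro mult_right_mono mult_left_mono) auto
    also have "\<dots> = (G * h0 * a0) * (D * X)" by (simp add: l)
    finally have "sqrt (G * H * l) \<le> sqrt ((G * h0 * a0) * (D * X))" by (rule real_sqrt_le_mono)
    then show ?thesis by (simp add: k_def real_sqrt_mult)
  qed
  define Y where "Y = sqrt D * sqrt X"
  have Y0: "0 \<le> Y" using D X by (simp add: Y_def)
  have t1: "6 * n * sqrt (G * H * l) \<le> 6 * k * n * Y"
    using mult_left_mono[OF s1, of "6 * n"] n by (simp add: Y_def mult_ac)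
  have t2: "6 * l * sqrt (n * G * H * l) \<le> 6 * a0 * k * n * Y"
  proof -
    have "sqrt (n * G * H * l) = sqrt n * sqrt (G * H * l)" by (simp add: real_sqrt_mult)
    also have "\<dots> \<le> sqrt n * (k * Y)" using s1 sn by (intro mult_left_mono) (auto simp: Y_def)
    finally have "6 * l * sqrt (n * G * H * l) \<le> 6 * l * (sqrt n * (k * Y))"
      using l0 by (intro mult_left_mono) auto
    also have "\<dots> = 6 * a0 * k * Y * (X * sqrt n)" by (simp add: l)
    also have "\<dots> \<le> 6 * a0 * k * Y * (sqrt n * sqrt n)"
      using X a0 k0 Y0 sn by (intro mult_left_mono mult_right_mono) auto
    finally show ?thesis by (simp only: sn mult_ac)
  qed
  have t3: "2 * l\<^sup>2 * H \<le> 2 * a0\<^sup>2 * h0 * n * Y"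
  proof -
    have "X\<^sup>2 * D \<le> n * Y"
    proof (rule power2_le_imp_le)
      have "(X\<^sup>2 * D)\<^sup>2 = (D * X ^ 3) * (D * X)" by (simp add: power2_eq_square power3_eq_cube)
      also have "\<dots> \<le> n\<^sup>2 * (D * X)" using D X by (intro mult_right_mono) auto
      also have "\<dots> = (n * Y)\<^sup>2" using D X by (simp add: Y_def power_mult_distrib)
      finally show "(X\<^sup>2 * D)\<^sup>2 \<le> (n * Y)\<^sup>2" .
    qed (use n Y0 in auto)
    then have "2 * a0\<^sup>2 * h0 * (X\<^sup>2 * D) \<le> 2 * a0\<^sup>2 * h0 * (n * Y)"
      using h0 by (intro mult_left_mono) auto
    moreover have "2 * l\<^sup>2 * H \<le> 2 * l\<^sup>2 * (h0 * D)" using H by (intro mult_left_mono) auto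
    ultimately show ?thesis by (simp add: l power_mult_distrib mult_ac)
  qed
  define Q where "Q = (6 * k + 6 * a0 * k + 2 * a0\<^sup>2 * h0) * (n * Y) + 16 * G * a0 * (n * X)"
  have Q0: "0 \<le> Q" using k0 a0 h0 n Y0 G X by (simp add: Q_def)
  have "2 * (6 * n * sqrt (G * H * l) + 6 * l * sqrt (n * G * H * l) + 2 * l\<^sup>2 * H + 16 * G * n * l) / (n * (n - 1))
      \<le> 2 * Q / (n * (n - 1))"
  proof (intro divide_right_mono mult_left_mono)
    have "Q = 6 * k * n * Y + 6 * a0 * k * n * Y + 2 * a0\<^sup>2 * h0 * n * Y + 16 * G * n * l"
      by (simp add: Q_def l algebra_simps)
    then show "6 * n * sqrt (G * H * l) + 6 * l * sqrt (n * G * H * l) + 2 * l\<^sup>2 * H + 16 * G * n * l \<le> Q"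
      using t1 t2 t3 by linarith
  qed (use n in auto)
  also have "\<dots> \<le> 2 * Q / (n * (n / 2))"
    \<comment> \<open>The denominator uses \<open>n - 1 \<ge> n / 2\<close>.\<close>
    using n Q0 by (intro divide_left_mono mult_left_mono mult_pos_pos) auto
  also have "\<dots> = 4 * Q / n\<^sup>2" by (simp add: power2_eq_square)
  also have "\<dots> = ((24 + 24 * a0) * k + 8 * a0\<^sup>2 * h0) * (Y / n) + 64 * G * a0 * (X / n)"
    using n by (simp add: Q_def field_simps power2_eq_square)
  finally show ?thesis by (simp add: k_def Y_def)
qed

section \<open>Support and size of the sample\<close>

context bounded_density
begin

lemma sample_marginal:
  assumes "i \<in> {1..n}"
  shows "distr (sample_law n f) (dens_measure f) (\<lambda>x. x i) = dens_measure f"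
  unfolding sample_law_def using distr_PiM_component[of "{1..n}" "\<lambda>_. dens_measure f" i, OF prob_space_axioms assms] .

lemma sample_prob_space: "prob_space (sample_law n f)"
  unfolding sample_law_def by (intro prob_space_PiM prob_space_axioms)

lemma sample_in_supp: "AE x in sample_law n f. \<forall>i\<in>{1..n}. x i \<in> supp f"
proof -
  have "AE y in dens_measure f. y \<in> supp f"
    unfolding dens_measure_def
  proof (subst AE_density)
    show "AE x in lborel. 0 < ennreal (f x) \<longrightarrow> x \<in> supp f"
    proof (rule AE_I2, rule impI)
      fix x assume "0 < ennreal (f x)"
      then have "x \<in> support_on UNIV f" by (auto simp: support_on_def)
      then show "x \<in> supp f" unfolding supp_def using closure_subset by blast
    qed
  qed simp
  then have "AE x in sample_law n f. x i \<in> supp f" if "i \<in> {1..n}" for i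
    unfolding sample_law_def using that by (intro AE_PiM_component prob_space_axioms) auto
  then show ?thesis by (intro AE_finite_allI) auto
qed

text \<open>Markov's inequality for the second moment and a union over the sample. A radius of order
  \<open>sqrt n\<close> results, which a polynomially fine grid can afford.\<close>

lemma sample_max:
  assumes v: "(\<integral>\<^sup>+x. ennreal (\<bar>x\<bar> ^ 2) \<partial>dens_measure f) \<le> ennreal v" and r: "0 < r" and v0: "0 \<le> v"
  shows "whp (sample_law n f) (real n * (v / r\<^sup>2)) (\<lambda>x. \<forall>i\<in>{1..n}. \<bar>x i\<bar> \<le> r)"
proof -
  have "whp (sample_law n f) (v / r\<^sup>2) (\<lambda>x. \<bar>x i\<bar> \<le> r)" if i: "i \<in> {1..n}" for i
  proof -
    have comp: "(\<lambda>x. x i) \<in> sample_law n f \<rightarrow>\<^sub>M dens_measure f"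
      unfolding sample_law_def by (rule measurable_component_singleton[OF i])
    let ?A = "{y \<in> space (dens_measure f). 1 \<le> ennreal (1 / r\<^sup>2) * ennreal (\<bar>y\<bar> ^ 2)}"
    have A: "?A \<in> sets (dens_measure f)" by measurable
    let ?N = "(\<lambda>x. x i) -` ?A \<inter> space (sample_law n f)"
    have "emeasure (sample_law n f) ?N = emeasure (distr (sample_law n f) (dens_measure f) (\<lambda>x. x i)) ?A"
      by (rule emeasure_distr[OF comp A, symmetric])
    also have "\<dots> = emeasure (dens_measure f) ?A" by (simp only: sample_marginal[OF i])
    also have "\<dots> \<le> ennreal (1 / r\<^sup>2) * (\<integral>\<^sup>+y. ennreal (\<bar>y\<bar> ^ 2) * indicator (space (dens_measure f)) y \<partial>dens_measure f)"
      by (rule nn_integral_Markov_inequality) measurable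
    also have "\<dots> = ennreal (1 / r\<^sup>2) * (\<integral>\<^sup>+y. ennreal (\<bar>y\<bar> ^ 2) \<partial>dens_measure f)" by simp
    also have "\<dots> \<le> ennreal (1 / r\<^sup>2) * ennreal v" by (intro mult_left_mono v) auto
    also have "\<dots> = ennreal (v / r\<^sup>2)" using v0 by (simp flip: ennreal_mult)
    finally have "emeasure (sample_law n f) ?N \<le> ennreal (v / r\<^sup>2)" .
    moreover have "?N \<in> sets (sample_law n f)" by (rule measurable_sets[OF comp A])
    moreover have "\<bar>x i\<bar> \<le> r" if "x \<in> space (sample_law n f) - ?N" for x
    proof (rule ccontr)
      assume "\<not> \<bar>x i\<bar> \<le> r"
      then have "r\<^sup>2 \<le> \<bar>x i\<bar> ^ 2" using r by (intro power_mono) auto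
      then have "1 \<le> 1 / r\<^sup>2 * \<bar>x i\<bar> ^ 2" using r by (simp add: field_simps)
      then have "1 \<le> ennreal (1 / r\<^sup>2) * ennreal (\<bar>x i\<bar> ^ 2)"
        by (simp flip: ennreal_mult ennreal_1 del: power2_abs)
      then show False using that by auto
    qed
    ultimately show ?thesis unfolding whp_def by blast
  qed
  then have "whp (sample_law n f) (real (card {1..n}) * (v / r\<^sup>2)) (\<lambda>x. \<forall>i\<in>{1..n}. \<bar>x i\<bar> \<le> r)"
    using v0 by (intro whp_Ball) auto
  then show ?thesis by simp
qed

end

section \<open>Deviation of the statistic and power of the test\<close>

lemma whp_imp_outer_measure_le:
  assumes "whp M \<epsilon> (\<lambda>x. \<not> Q x)"
  shows "outer_measure_of M {x \<in> space M. Q x} \<le> ennreal \<epsilon>"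
proof -
  obtain N where N: "N \<in> sets M" "emeasure M N \<le> ennreal \<epsilon>" "\<forall>x\<in>space M - N. \<not> Q x"
    using assms by (auto simp: whp_def)
  have "outer_measure_of M {x \<in> space M. Q x} \<le> emeasure M N"
    unfolding outer_measure_of_def by (rule INF_lower) (use N in auto)
  then show ?thesis using N(2) by (rule order_trans)
qed

lemma sup_normD: "sup_norm g \<le> ereal c \<Longrightarrow> \<bar>g x\<bar> \<le> c"
  unfolding sup_norm_def SUP_le_iff by simp

text \<open>The quarter of \<open>d + b\<close> left by the linear term turns \<open>d - b\<close>
  into \<open>3/4 d - 5/4 b\<close>.\<close>

lemma abs_diff_imp_lower:
  fixes t d b c :: real
  shows "\<bar>t - (d - b)\<bar> \<le> (d + b) / 4 + c \<Longrightarrow> 3 / 4 * d - 5 / 4 * b - c \<le> t"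
  by (drule abs_le_D2) (simp add: field_simps)

lemma abs_diff_imp_upper:
  fixes t b c :: real
  shows "\<bar>t - (0 - b)\<bar> \<le> (0 + b) / 4 + c \<Longrightarrow> 0 \<le> b \<Longrightarrow> t \<le> c"
  by (drule abs_le_D1) (simp add: field_simps)

definition rate :: "nat \<Rightarrow> nat \<Rightarrow> real" where
  "rate n D = sqrt (real D) * (sqrt (ln (real n)) / real n) + ln (real n) / real n"

lemma rate_pos: "3 \<le> n \<Longrightarrow> 0 < rate n D"
  using ln_ge_1_of_ge_3[of "real n"] by (auto simp: rate_def intro!: add_nonneg_pos mult_nonneg_nonneg)

context scaling_fun
begin

text \<open>Collects the constants of \<open>U_bound_rate\<close> and of the linear term. The
  repeated sum \<open>N / \<sigma>l + 3 * (G * (4 * a * N))\<close> bounds \<open>H / D\<close> for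
  all scales \<open>\<sigma> \<ge> \<sigma>l\<close>, so the constant is free of \<open>n\<close>,
  \<open>D\<close>, \<open>\<mu>\<close> and \<open>\<sigma>\<close>.\<close>

definition dev_const :: "real \<Rightarrow> real \<Rightarrow> real \<Rightarrow> real \<Rightarrow> real" where
  "dev_const G \<sigma>l a0 W =
     (24 + 24 * a0) * sqrt (G * (N / \<sigma>l + 3 * (G * (4 * a * N))) * a0)
     + 8 * a0\<^sup>2 * (N / \<sigma>l + 3 * (G * (4 * a * N))) + 64 * G * a0 + (4 * (G * (4 * a * N) + W) + 64 * G) * a0"

lemma stat_dev_rate:
  assumes f: "bounded_density f G" and \<sigma>: "0 < \<sigma>l" "\<sigma>l \<le> \<sigma>" and n: "3 \<le> n"
    and D: "1 \<le> D" "real D * (ln (real n)) ^ 3 \<le> (real n)\<^sup>2" and a0: "0 < a0"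
    and w: "w \<in> borel_measurable borel" "\<And>y. \<bar>w y\<bar> \<le> W" "integrable lborel (\<lambda>y. (w y)\<^sup>2)"
    and dd: "dd = (LINT y|lborel. (f y - w y)\<^sup>2)"
    and b: "b = repro_kernel.bias f (ker (real D / \<sigma>) \<mu>)"
  shows "whp (sample_law n f) (6 * real n * exp (- (a0 * ln (real n))))
     (\<lambda>x. \<bar>repro_kernel.stat (ker (real D / \<sigma>) \<mu>) w n x - (dd - b)\<bar>
         \<le> (dd + b) / 4 + dev_const G \<sigma>l a0 W * rate n D)"
proof -
  have s0: "0 < \<sigma>" using \<sigma> by linarith
  interpret F: repro_kernel f G "ker (real D / \<sigma>) \<mu>" "real D / \<sigma> * N" "4 * a * N"
    by (rule ker_repro_kernel[OF f]) (use D s0 in auto)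
  define X where "X = ln (real n)"
  have n3: "3 \<le> real n" using n by simp
  have X: "1 \<le> X" "X \<le> sqrt (real n)" using ln_ge_1_of_ge_3[OF n3] ln_le_sqrt[of "real n"] n by (auto simp: X_def)
  define l where "l = a0 * X"
  have l: "0 < l" using a0 X by (simp add: l_def)
  define h0 where "h0 = N / \<sigma>l + 3 * (G * (4 * a * N))"
  have h0: "F.H \<le> h0 * real D"
  proof -
    have "real D / \<sigma> * N \<le> real D / \<sigma>l * N"
      using \<sigma> N_pos by (intro mult_right_mono divide_left_mono) auto
    moreover have "3 * (G * (4 * a * N)) * 1 \<le> 3 * (G * (4 * a * N)) * real D"
      using F.GB_nonneg D by (intro mult_left_mono) auto
    ultimately show ?thesis unfolding F.H_def h0_def by (simp add: algebra_simps)
  qed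
  have U: "2 * F.U_bound n l / (real n * (real n - 1))
    \<le> ((24 + 24 * a0) * sqrt (G * h0 * a0) + 8 * a0\<^sup>2 * h0) * (sqrt (real D) * (sqrt X / real n)) + 64 * G * a0 * (X / real n)"
    unfolding F.U_bound_def
    by (rule U_bound_rate[OF n3 X _ _ a0 F.G_pos less_imp_le[OF F.H_pos] h0 l_def])
      (use D in \<open>auto simp: X_def\<close>)
  define A where "A = (24 + 24 * a0) * sqrt (G * h0 * a0) + 8 * a0\<^sup>2 * h0"
  define E where "E = (4 * (G * (4 * a * N) + W) + 64 * G) * a0"
  have W0: "0 \<le> W" using w(2)[of 0] by linarith
  have h00: "0 \<le> h0" using F.GB_nonneg N_pos \<sigma> by (simp add: h0_def)
  have A0: "0 \<le> A" using h00 a0 F.G_pos by (simp add: A_def)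
  have E0: "0 \<le> E" using F.GB_nonneg W0 F.G_pos a0 by (simp add: E_def)
  have G0: "0 < G" by (rule F.G_pos)
  have fin: "2 * F.U_bound n l / (real n * (real n - 1)) + (4 * (G * (4 * a * N) + W) + 64 * G) * l / real n
      \<le> dev_const G \<sigma>l a0 W * rate n D"
  proof -
    define Y where "Y = sqrt (real D) * (sqrt X / real n)"
    define Z where "Z = X / real n"
    have YZ: "0 \<le> Y" "0 \<le> Z" using X by (auto simp: Y_def Z_def)
    have "(4 * (G * (4 * a * N) + W) + 64 * G) * l / real n = E * Z" by (simp add: E_def l_def Z_def)
    moreover have "dev_const G \<sigma>l a0 W * rate n D = (A + 64 * G * a0 + E) * (Y + Z)"
      by (simp add: dev_const_def rate_def A_def E_def Y_def Z_def X_def h0_def)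
    moreover have "A * Y + 64 * G * a0 * Z + E * Z \<le> (A + 64 * G * a0 + E) * (Y + Z)"
    proof -
      have "0 \<le> A * Z" "0 \<le> 64 * G * a0 * Y" "0 \<le> E * Y" using A0 E0 YZ G0 a0 by simp_all
      then show ?thesis by (simp add: algebra_simps)
    qed
    ultimately show ?thesis using U unfolding A_def[symmetric] Y_def[symmetric] Z_def[symmetric] by linarith
  qed
  have "whp (sample_law n f) ((4 * real n + 2) * exp (- l))
     (\<lambda>x. \<bar>F.stat w n x - (dd - F.bias)\<bar>
         \<le> 2 * F.U_bound n l / (real n * (real n - 1)) + (dd + F.bias) / 4 + (4 * (G * (4 * a * N) + W) + 64 * G) * l / real n)"
    by (rule F.stat_dev[OF l _ w dd]) (use n in auto)
  then show ?thesis
  proof (rule whp_mono)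
    show "(4 * real n + 2) * exp (- l) \<le> 6 * real n * exp (- (a0 * ln (real n)))"
      unfolding l_def X_def using n by (intro mult_right_mono) auto
  qed (use fin in \<open>simp add: b\<close>)
qed

text \<open>The case \<open>f = w = f0\<close>, \<open>\<mu> = 0\<close>,
  \<open>\<sigma> = 1\<close>: the distance is zero, and the bias can only lower the
  statistic.\<close>

lemma T_hat_null_upper:
  assumes f0: "bounded_density f0 G" and n: "3 \<le> n"
    and D: "1 \<le> D" "real D * (ln (real n)) ^ 3 \<le> (real n)\<^sup>2" and a0: "0 < a0"
  shows "whp (sample_law n f0) (6 * real n * exp (- (a0 * ln (real n))))
     (\<lambda>x. T_hat \<phi> f0 n (2, D) x \<le> dev_const G 1 a0 G * rate n D)"
proof -
  interpret F: repro_kernel f0 G "ker (real D / 1) 0" "real D / 1 * N" "4 * a * N"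
    by (rule ker_repro_kernel[OF f0]) (use D in auto)
  have "whp (sample_law n f0) (6 * real n * exp (- (a0 * ln (real n))))
     (\<lambda>x. \<bar>F.stat f0 n x - (0 - F.bias)\<bar> \<le> (0 + F.bias) / 4 + dev_const G 1 a0 G * rate n D)"
    by (rule stat_dev_rate[OF f0 _ _ n D a0]) (use F.f_abs F.f_sq_int in auto)
  then show ?thesis
  proof (rule whp_mono)
    fix x assume *: "\<bar>F.stat f0 n x - (0 - F.bias)\<bar> \<le> (0 + F.bias) / 4 + dev_const G 1 a0 G * rate n D"
    have "0 \<le> F.bias" unfolding F.bias_def by simp
    moreover have "T_hat \<phi> f0 n (2, D) x = F.stat f0 n x"
      using T_hat_eq_stat[OF _ F.repro_kernel_axioms, of f0 n x] by simp
    ultimately show "T_hat \<phi> f0 n (2, D) x \<le> dev_const G 1 a0 G * rate n D" using abs_diff_imp_upper[OF *] by simp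
  qed simp
qed

lemma T_hat_alt_lower:
  assumes f: "bounded_density f G" and f0: "bounded_density f0 L" and \<sigma>: "0 < \<sigma>l" "\<sigma>l \<le> \<sigma>" and n: "3 \<le> n"
    and D: "1 \<le> D" "real D * (ln (real n)) ^ 3 \<le> (real n)\<^sup>2" and a0: "0 < a0"
  shows "whp (sample_law n f) (6 * real n * exp (- (a0 * ln (real n))))
     (\<lambda>x. \<sigma> * (3 / 4 * (l2_norm (\<lambda>y. f y - 1 / \<sigma> * f0 ((y - \<mu>) / \<sigma>)))\<^sup>2
          - 5 / 4 * repro_kernel.bias f (ker (real D / \<sigma>) \<mu>) - dev_const G \<sigma>l a0 (L / \<sigma>l) * rate n D)
        \<le> T_hat \<phi> f0 n (2, D) (\<lambda>i. (x i - \<mu>) / \<sigma>))"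
proof -
  have s0: "0 < \<sigma>" using \<sigma> by linarith
  interpret F: repro_kernel f G "ker (real D / \<sigma>) \<mu>" "real D / \<sigma> * N" "4 * a * N"
    by (rule ker_repro_kernel[OF f]) (use D s0 in auto)
  interpret F0: bounded_density f0 L by fact
  let ?w = "\<lambda>y. 1 / \<sigma> * f0 ((y - \<mu>) / \<sigma>)"
  define dd where "dd = (l2_norm (\<lambda>y. f y - ?w y))\<^sup>2"
  have w1: "?w \<in> borel_measurable borel" by measurable
  have w2: "\<bar>?w y\<bar> \<le> L / \<sigma>l" for y
  proof -
    have "\<bar>?w y\<bar> = \<bar>f0 ((y - \<mu>) / \<sigma>)\<bar> / \<sigma>" using s0 by (simp add: abs_mult)
    also have "\<dots> \<le> L / \<sigma>l" using \<sigma> F0.f_abs F0.G_pos by (intro frac_le) auto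
    finally show ?thesis .
  qed
  have w3: "integrable lborel (\<lambda>y. (?w y)\<^sup>2)"
    using integrable_scale[of "1 / \<sigma>" "\<lambda>v. (f0 v)\<^sup>2" \<mu>] F0.f_sq_int s0 by (simp add: power_divide)
  have dd: "dd = (LINT y|lborel. (f y - ?w y)\<^sup>2)" by (simp add: dd_def l2_norm_sq)
  have "whp (sample_law n f) (6 * real n * exp (- (a0 * ln (real n))))
     (\<lambda>x. \<bar>F.stat ?w n x - (dd - F.bias)\<bar> \<le> (dd + F.bias) / 4 + dev_const G \<sigma>l a0 (L / \<sigma>l) * rate n D)"
    by (rule stat_dev_rate[OF f \<sigma> n D a0 w1 w2 w3 dd refl])
  then show ?thesis
  proof (rule whp_mono)
    fix x assume "\<bar>F.stat ?w n x - (dd - F.bias)\<bar> \<le> (dd + F.bias) / 4 + dev_const G \<sigma>l a0 (L / \<sigma>l) * rate n D"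
    then have "3 / 4 * dd - 5 / 4 * F.bias - dev_const G \<sigma>l a0 (L / \<sigma>l) * rate n D \<le> F.stat ?w n x"
      by (rule abs_diff_imp_lower)
    then have "\<sigma> * (3 / 4 * dd - 5 / 4 * F.bias - dev_const G \<sigma>l a0 (L / \<sigma>l) * rate n D) \<le> \<sigma> * F.stat ?w n x"
      using s0 by (intro mult_left_mono) auto
    then show "\<sigma> * (3 / 4 * (l2_norm (\<lambda>y. f y - ?w y))\<^sup>2 - 5 / 4 * F.bias - dev_const G \<sigma>l a0 (L / \<sigma>l) * rate n D)
        \<le> T_hat \<phi> f0 n (2, D) (\<lambda>i. (x i - \<mu>) / \<sigma>)"
      unfolding T_hat_eq_stat[OF s0 F.repro_kernel_axioms] dd_def .
  qed simp
qed

end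

section \<open>Grid perturbation, choice of the level, number of models\<close>

lemma abs_standardize_diff_le:
  fixes x \<mu> \<mu>' \<sigma> \<sigma>' \<sigma>0 \<delta> r m :: real
  assumes "0 < \<sigma>0" "\<sigma>0 \<le> \<sigma>" "\<sigma>0 \<le> \<sigma>'" "\<bar>\<mu> - \<mu>'\<bar> \<le> \<delta>" "\<bar>\<sigma> - \<sigma>'\<bar> \<le> \<delta>" "\<bar>x\<bar> \<le> r" "\<bar>\<mu>'\<bar> \<le> m"
  shows "\<bar>(x - \<mu>) / \<sigma> - (x - \<mu>') / \<sigma>'\<bar> \<le> \<delta> * (1 / \<sigma>0 + (r + m) / \<sigma>0\<^sup>2)"
proof -
  have s: "0 < \<sigma>" "0 < \<sigma>'" and d: "0 \<le> \<delta>" using assms by linarith+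
  have "(x - \<mu>) / \<sigma> - (x - \<mu>') / \<sigma>' = (\<mu>' - \<mu>) / \<sigma> + (x - \<mu>') * (\<sigma>' - \<sigma>) / (\<sigma> * \<sigma>')"
    using s by (simp add: field_simps)
  then have "\<bar>(x - \<mu>) / \<sigma> - (x - \<mu>') / \<sigma>'\<bar> \<le> \<bar>(\<mu>' - \<mu>) / \<sigma>\<bar> + \<bar>(x - \<mu>') * (\<sigma>' - \<sigma>) / (\<sigma> * \<sigma>')\<bar>"
    using abs_triangle_ineq by metis
  also have "\<bar>(\<mu>' - \<mu>) / \<sigma>\<bar> = \<bar>\<mu> - \<mu>'\<bar> / \<sigma>" using s by (simp add: abs_minus_commute)
  also have "\<dots> \<le> \<delta> / \<sigma>0" using assms d by (intro frac_le) auto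
  also have "\<bar>(x - \<mu>') * (\<sigma>' - \<sigma>) / (\<sigma> * \<sigma>')\<bar> = \<bar>x - \<mu>'\<bar> * \<bar>\<sigma> - \<sigma>'\<bar> / (\<sigma> * \<sigma>')"
    using s by (simp add: abs_mult abs_minus_commute)
  also have "\<dots> \<le> (r + m) * \<delta> / (\<sigma>0 * \<sigma>0)"
    using assms s d by (intro frac_le mult_mono mult_pos_pos) auto
  finally show ?thesis by (simp add: power2_eq_square distrib_left mult.commute)
qed

definition total_rate :: "real \<Rightarrow> real \<Rightarrow> nat \<Rightarrow> real" where
  "total_rate s R n = R powr (2 / (4 * s + 1)) * (sqrt (ln (real n)) / real n) powr (4 * s / (4 * s + 1))
             + R\<^sup>2 * ((ln (real n)) ^ 3 / (real n)\<^sup>2) powr (2 * s)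
             + ln (real n) / real n"

text \<open>The balance with \<open>b = n^2 / (ln n)^3\<close> and
  \<open>r = sqrt (ln n) / n\<close>. The surplus \<open>r\<close> is at most
  \<open>ln n / n\<close> because \<open>ln n \<ge> 1\<close>, which explains the factor 2.\<close>

lemma total_rate_level:
  assumes n: "3 \<le> n" and R: "0 < R" and s: "0 < s"
  shows "\<exists>J::nat. 2 ^ J \<in> dyadic_upto ((real n)\<^sup>2 / (ln (real n)) ^ 3)
     \<and> real (2 ^ J) * (ln (real n)) ^ 3 \<le> (real n)\<^sup>2
     \<and> R\<^sup>2 * real (2 ^ J) powr (- 2 * s) \<le> 2 powr (2 * s) * total_rate s R n
     \<and> rate n (2 ^ J) \<le> 2 * total_rate s R n"
proof -
  define X where "X = ln (real n)"
  have n3: "3 \<le> real n" using n by simp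
  have X: "1 \<le> X" "X ^ 3 \<le> (real n)\<^sup>2"
    using ln_ge_1_of_ge_3[OF n3] ln_cube_le_square[of "real n"] n by (auto simp: X_def)
  define b where "b = (real n)\<^sup>2 / X ^ 3"
  have b: "1 \<le> b" using X by (simp add: b_def)
  define r where "r = sqrt X / real n"
  have r: "0 < r" using X n by (simp add: r_def)
  define opt where "opt = R powr (2 / (4 * s + 1)) * r powr (4 * s / (4 * s + 1))"
  obtain J :: nat where J: "real J \<le> log 2 b"
     "R\<^sup>2 * real (2 ^ J) powr (- 2 * s) \<le> 2 powr (2 * s) * (opt + R\<^sup>2 * b powr (- 2 * s))"
     "sqrt (real (2 ^ J)) * r \<le> opt + r"
    using optimal_level[OF R r s b] unfolding opt_def by blast
  have bp: "b powr (- 2 * s) = (X ^ 3 / (real n)\<^sup>2) powr (2 * s)"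
  proof -
    have "X ^ 3 / (real n)\<^sup>2 = inverse b" by (simp add: b_def)
    then show ?thesis using b by (simp add: inverse_powr powr_minus)
  qed
  have tot: "total_rate s R n = opt + R\<^sup>2 * b powr (- 2 * s) + X / real n"
    unfolding bp by (simp add: total_rate_def opt_def r_def X_def)
  have o0: "0 \<le> opt" by (simp add: opt_def)
  have b0: "0 \<le> R\<^sup>2 * b powr (- 2 * s)" by simp
  have XN: "0 \<le> X / real n" using X by simp
  have rX: "r \<le> X / real n"
  proof -
    have "sqrt X \<le> X" using X by (intro real_le_lsqrt) (auto simp: power2_eq_square)
    then show ?thesis by (simp add: r_def divide_right_mono)
  qed
  have "2 ^ J \<in> dyadic_upto b" using J(1) by (auto simp: dyadic_upto_def)
  moreover have "real (2 ^ J) * X ^ 3 \<le> (real n)\<^sup>2"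
  proof -
    have "2 powr real J \<le> 2 powr (log 2 b)" using J(1) by (intro powr_mono) auto
    then have "real (2 ^ J) \<le> b" using b by (simp add: powr_realpow)
    then show ?thesis using X by (simp add: b_def pos_le_divide_eq)
  qed
  moreover have "R\<^sup>2 * real (2 ^ J) powr (- 2 * s) \<le> 2 powr (2 * s) * total_rate s R n"
  proof (rule order_trans[OF J(2)])
    show "2 powr (2 * s) * (opt + R\<^sup>2 * b powr (- 2 * s)) \<le> 2 powr (2 * s) * total_rate s R n"
      unfolding tot using XN by (intro mult_left_mono) auto
  qed
  moreover have "rate n (2 ^ J) \<le> 2 * total_rate s R n"
  proof -
    have "rate n (2 ^ J) \<le> opt + r + X / real n" using J(3) by (simp add: rate_def r_def X_def)
    also have "\<dots> \<le> 2 * total_rate s R n"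
      unfolding tot distrib_left using rX add_nonneg_nonneg[OF o0 b0] b0 by linarith
    finally show ?thesis .
  qed
  ultimately show ?thesis unfolding b_def X_def by blast
qed

text \<open>The bound is crude on purpose: a polynomial number of models is paid for by the multiple
  \<open>a0\<close> of \<open>ln n\<close>.\<close>

lemma card_models_le:
  assumes n: "3 \<le> n" and D1: "D1 \<subseteq> dyadic_upto ((real n)\<^sup>2)"
  defines "Ms \<equiv> models D1 (dyadic_upto ((real n)\<^sup>2 / (ln (real n)) ^ 3))"
  shows "finite Ms" and "real (card Ms) \<le> 4 * (real n)\<^sup>2" and "\<And>m. m \<in> Ms \<Longrightarrow> 0 < snd m"
proof -
  define X where "X = ln (real n)"
  have n3: "3 \<le> real n" using n by simp
  have X: "1 \<le> X" "X ^ 3 \<le> (real n)\<^sup>2"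
    using ln_ge_1_of_ge_3[OF n3] ln_cube_le_square[of "real n"] n by (auto simp: X_def)
  have X3: "1 \<le> X ^ 3" using X by simp
  define b where "b = (real n)\<^sup>2 / X ^ 3"
  have b: "1 \<le> b" using X by (simp add: b_def)
  have n2: "1 \<le> (real n)\<^sup>2" using n by simp
  have bn: "b \<le> (real n)\<^sup>2"
    unfolding b_def using X3 n2 by (subst pos_divide_le_eq) (use X in \<open>auto simp: mult_le_cancel_left1\<close>)
  have f0: "finite (dyadic_upto ((real n)\<^sup>2))" by (rule finite_dyadic_upto) (use n2 in linarith)
  have f1: "finite D1" by (rule finite_subset[OF D1 f0])
  have f2: "finite (dyadic_upto b)" using finite_dyadic_upto[of b] b by simp
  have Ms: "Ms = {1} \<times> D1 \<union> {2} \<times> dyadic_upto b" by (simp add: Ms_def models_def b_def X_def)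
  show "finite Ms" unfolding Ms using f1 f2 by simp
  show "0 < snd m" if "m \<in> Ms" for m
    using that D1 dyadic_upto_pos unfolding Ms by auto
  have log: "log 2 ((real n)\<^sup>2) \<le> 2 * real n"
  proof -
    have "ln (real n) \<le> real n / 2" using n by (intro ln_le_half) auto
    moreover have l2: "1 / 2 \<le> ln (2 :: real)" using ln2_ge_two_thirds by linarith
    ultimately have "ln (real n) \<le> real n * ln 2"
      using mult_left_mono[OF l2, of "real n"] by linarith
    then have "log 2 (real n) \<le> real n" using l2 by (simp add: log_def divide_le_eq)
    then show ?thesis using n by (simp add: log_nat_power)
  qed
  have logb: "log 2 b \<le> log 2 ((real n)\<^sup>2)" using b bn by (subst log_le_cancel_iff) linarith+
  have "card Ms \<le> card ({1 :: nat} \<times> D1) + card ({2 :: nat} \<times> dyadic_upto b)"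
    unfolding Ms by (rule card_Un_le)
  then have "real (card Ms) \<le> real (card D1) + real (card (dyadic_upto b))"
    by (simp add: card_cartesian_product flip: of_nat_add)
  also have "real (card D1) \<le> real (card (dyadic_upto ((real n)\<^sup>2)))"
    by (intro of_nat_mono card_mono f0 D1)
  also have "\<dots> \<le> log 2 ((real n)\<^sup>2) + 1" by (rule card_dyadic_upto[OF n2])
  also have "real (card (dyadic_upto b)) \<le> log 2 b + 1" by (rule card_dyadic_upto[OF b])
  finally have "real (card Ms) \<le> 4 * real n + 2" using log logb by linarith
  also have "\<dots> \<le> 4 * (real n)\<^sup>2"
  proof -
    have "3 * real n \<le> real n * real n" using n3 by (intro mult_right_mono) auto
    then show ?thesis unfolding power2_eq_square using n3 by linarith
  qed
  finally show "real (card Ms) \<le> 4 * (real n)\<^sup>2" .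
qed

text \<open>
  The exponent 13 pays for a grid of mesh \<open>n\<^sup>-\<^sup>6\<close> in both parameters, that is \<open>O(n\<^sup>1\<^sup>2)\<close> points,
  and for the factor \<open>O(n)\<close> in front of the exponential in the deviation inequality at one point.
\<close>

lemma exp_ln_budget:
  assumes n: "3 \<le> n" and u: "1 \<le> u" and v: "1 \<le> v"
  shows "exp (- ((13 + ln u + ln v) * ln (real n))) \<le> 1 / (real n ^ 13 * u)"
proof -
  have n3: "3 \<le> real n" using n by simp
  have X: "1 \<le> ln (real n)" by (rule ln_ge_1_of_ge_3[OF n3])
  have lu: "0 \<le> ln u" and lv: "0 \<le> ln v" using u v by auto
  have "13 * ln (real n) + ln u \<le> (13 + ln u + ln v) * ln (real n)"
  proof -
    have "ln u * 1 \<le> ln u * ln (real n)" using X lu by (intro mult_left_mono) auto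
    moreover have "0 \<le> ln v * ln (real n)" using X lv by simp
    ultimately show ?thesis by (simp add: distrib_right)
  qed
  then have "exp (- ((13 + ln u + ln v) * ln (real n))) \<le> exp (- (13 * ln (real n) + ln u))" by simp
  also have "\<dots> = 1 / (exp (13 * ln (real n)) * exp (ln u))"
    by (simp only: exp_minus exp_add inverse_eq_divide)
  also have "exp (13 * ln (real n)) = real n ^ 13"
  proof -
    have "exp (real 13 * ln (real n)) = exp (ln (real n)) ^ 13" by (rule exp_of_nat_mult)
    then show ?thesis using n by simp
  qed
  also have "exp (ln u) = u" using u by simp
  finally show ?thesis .
qed

section \<open>Power of the test, uniformly over the alternative\<close>

context scaling_fun
begin

text \<open>The constant is fixed before \<open>n\<close>, \<open>f0\<close>, \<open>f\<close>,
  \<open>R\<close> and \<open>D1\<close>. The Lipschitz condition compares two parameters at one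
  observation, as in passing from a grid point to its neighbours.\<close>

lemma alternative_rejected:
  fixes \<mu>0 \<mu>1 \<sigma>0 \<sigma>1 L Cf0 M \<nu> c \<alpha> \<beta> s :: real
  assumes \<sigma>0: "0 < \<sigma>0" and K: "K = {\<mu>0..\<mu>1} \<times> {\<sigma>0..\<sigma>1}"
    and pos: "0 < Cf0" "0 < \<nu>" "0 < s"
    and \<alpha>: "0 < \<alpha>" "\<alpha> < 1" and \<beta>: "0 < \<beta>" "\<beta> < 1"
  shows "\<exists>C>0. \<forall>(n::nat) (f0 :: real \<Rightarrow> real) (f :: real \<Rightarrow> real) (R::real) (D1 :: nat set).
    n \<ge> 3 \<longrightarrow> \<mu>0 \<le> \<mu>1 \<longrightarrow> \<sigma>0 \<le> \<sigma>1 \<longrightarrow>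
    bounded_density f0 L \<longrightarrow> bounded_density f M \<longrightarrow>
    (\<forall>x\<in>supp f. \<forall>(\<mu>, \<sigma>)\<in>K. \<forall>(\<mu>', \<sigma>')\<in>K.
       \<bar>f0 ((x - \<mu>) / \<sigma>) - f0 ((x - \<mu>') / \<sigma>')\<bar> \<le> Cf0 * \<bar>(x - \<mu>) / \<sigma> - (x - \<mu>') / \<sigma>'\<bar>) \<longrightarrow>
    (\<integral>\<^sup>+x. ennreal (\<bar>x\<bar> ^ 2) \<partial>dens_measure f) \<le> ennreal \<nu> \<longrightarrow>
    D1 \<subseteq> dyadic_upto ((real n)\<^sup>2) \<longrightarrow>
    R > 0 \<longrightarrow>
    f \<in> B_class \<phi> K s R M \<longrightarrow>
    (INF (\<mu>, \<sigma>)\<in>K. (l2_norm (\<lambda>x. f x - 1 / \<sigma> * f0 ((x - \<mu>) / \<sigma>)))\<^sup>2) > C * total_rate s R n \<longrightarrow>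
    whp (sample_law n f) \<beta>
      (\<lambda>x. \<not> T_alpha \<phi> f0 K n (models D1 (dyadic_upto ((real n)\<^sup>2 / (ln (real n)) ^ 3))) \<alpha> x \<le> 0)"
proof -
  define ck where "ck = (\<bar>\<mu>1 - \<mu>0\<bar> + 1) * (\<bar>\<sigma>1 - \<sigma>0\<bar> + 1)"
  have ck: "1 \<le> ck" unfolding ck_def using mult_mono[of 1 "\<bar>\<mu>1 - \<mu>0\<bar> + 1" 1 "\<bar>\<sigma>1 - \<sigma>0\<bar> + 1"] by simp
  \<comment> \<open>The budgets: \<open>6 n\<close> times the \<open>ck n^12\<close> grid points
    must cost at most \<open>\<beta> / 2\<close>, and \<open>6 n\<close> times the
    \<open>4 n^2\<close> models at most \<open>\<alpha>\<close>. The single \<open>a0\<close> meets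
    both, with \<open>u\<close> and \<open>v\<close> interchanged in
    \<open>exp_ln_budget\<close>.\<close>
  define u where "u = 12 * ck / \<beta>"
  define v where "v = 24 / \<alpha>"
  have u: "1 \<le> u" using ck \<beta> by (simp add: u_def le_divide_eq)
  have v: "1 \<le> v" using \<alpha> by (simp add: v_def le_divide_eq)
  define a0 where "a0 = 13 + ln u + ln v"
  have a0: "0 < a0" using u v by (simp add: a0_def add_pos_nonneg)
  define m where "m = max \<bar>\<mu>0\<bar> \<bar>\<mu>1\<bar>"
  define r0 where "r0 = sqrt (2 * \<nu> / \<beta>)"
  define c2 where "c2 = 1 / \<sigma>0 + (r0 + m) / \<sigma>0\<^sup>2"
  have c2: "0 \<le> c2" using \<sigma>0 pos \<beta> by (simp add: c2_def r0_def m_def)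
  define C0 where "C0 = dev_const L 1 a0 L"
  define C1 where "C1 = dev_const M \<sigma>0 a0 (L / \<sigma>0)"
  define C3 where "C3 = 2 * c1 * c2 + 2 * Cf0 * c2"
  have C3: "0 \<le> C3" using c1_nonneg c2 pos by (simp add: C3_def)
  \<comment> \<open>The margin the statistic needs, in units of \<open>rate n D\<close>:
    \<open>\<bar>C0\<bar>\<close> for the quantile, \<open>C3\<close> for leaving the grid, 1 for
    strictness. Division by \<open>\<sigma>0\<close> compensates the factor \<open>\<sigma>\<close>
    in \<open>T_hat\<close>.\<close>
  define P where "P = (\<bar>C0\<bar> + C3 + 1) / \<sigma>0"
  have P: "0 < P" using C3 \<sigma>0 by (auto simp: P_def intro!: divide_pos_pos)
  define S where "S = \<sigma>1 powr (2 * s)"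
  \<comment> \<open>Three quarters of the separation must outweigh 5/4 of the bias and
    \<open>\<bar>C1\<bar> + P\<close> rates, where one rate is at most twice
    \<open>total_rate\<close>.\<close>
  define C where "C = 4 / 3 * (5 / 4 * S * 2 powr (2 * s) + 2 * (\<bar>C1\<bar> + P)) + 1"
  have C: "0 < C" using P by (simp add: C_def S_def add_nonneg_pos)
  show ?thesis
  proof (intro exI[of _ C] conjI C allI impI)
    fix n :: nat and f0 f :: "real \<Rightarrow> real" and R :: real and D1 :: "nat set"
    assume n: "3 \<le> n" and \<mu>01: "\<mu>0 \<le> \<mu>1" and \<sigma>01: "\<sigma>0 \<le> \<sigma>1"
      and f0: "bounded_density f0 L" and f: "bounded_density f M"
      and lip: "\<forall>x\<in>supp f. \<forall>(\<mu>, \<sigma>)\<in>K. \<forall>(\<mu>', \<sigma>')\<in>K.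
       \<bar>f0 ((x - \<mu>) / \<sigma>) - f0 ((x - \<mu>') / \<sigma>')\<bar> \<le> Cf0 * \<bar>(x - \<mu>) / \<sigma> - (x - \<mu>') / \<sigma>'\<bar>"
      and mom: "(\<integral>\<^sup>+x. ennreal (\<bar>x\<bar> ^ 2) \<partial>dens_measure f) \<le> ennreal \<nu>"
      and D1: "D1 \<subseteq> dyadic_upto ((real n)\<^sup>2)" and R: "0 < R" and B: "f \<in> B_class \<phi> K s R M"
      and sep: "C * total_rate s R n < (INF (\<mu>, \<sigma>)\<in>K. (l2_norm (\<lambda>x. f x - 1 / \<sigma> * f0 ((x - \<mu>) / \<sigma>)))\<^sup>2)"
    interpret f0: bounded_density f0 L by fact
    interpret f: bounded_density f M by fact
    let ?Ms = "models D1 (dyadic_upto ((real n)\<^sup>2 / (ln (real n)) ^ 3))"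
    have n3: "3 \<le> real n" using n by simp
    define tot where "tot = total_rate s R n"
    obtain J :: nat where J: "2 ^ J \<in> dyadic_upto ((real n)\<^sup>2 / (ln (real n)) ^ 3)"
      "real (2 ^ J) * (ln (real n)) ^ 3 \<le> (real n)\<^sup>2"
      "R\<^sup>2 * real (2 ^ J) powr (- 2 * s) \<le> 2 powr (2 * s) * tot"
      "rate n (2 ^ J) \<le> 2 * tot"
      using total_rate_level[OF n R pos(3)] unfolding tot_def by blast
    define D :: nat where "D = 2 ^ J"
    have D: "1 \<le> D" "0 < D" by (auto simp: D_def)
    note J = J[folded D_def]
    define \<rho> where "\<rho> = rate n D"
    have \<rho>: "0 < \<rho>" unfolding \<rho>_def by (rule rate_pos[OF n])
    have tot: "0 < tot" using \<rho> J(4) by (simp add: \<rho>_def)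
    have m2: "(2, D) \<in> ?Ms" using J(1) by (simp add: models_def)
    note Ms = card_models_le[OF n D1]
    have cardMs: "0 < real (card ?Ms)" using Ms(1) m2 by (auto simp: card_gt_0_iff)
    have tq: "t_quant \<phi> f0 n (2, D) (u_alpha \<phi> f0 n ?Ms \<alpha>) \<le> ereal (C0 * \<rho>)"
    proof (rule t_quant_u_alpha_le[OF f0.sample_prob_space Ms(1) m2 \<alpha>])
      show "T_hat \<phi> f0 n m \<in> borel_measurable (sample_law n f0)" if "m \<in> ?Ms" for m
        by (rule T_hat_measurable[OF Ms(3)[OF that]]) simp
      show "whp (sample_law n f0) (\<alpha> / real (card ?Ms)) (\<lambda>x. T_hat \<phi> f0 n (2, D) x \<le> C0 * \<rho>)"
      proof (rule whp_mono[OF T_hat_null_upper[OF f0 n D(1) J(2) a0]])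
        have "6 * real n * exp (- (a0 * ln (real n))) * real (card ?Ms)
            \<le> 6 * real n * (1 / (real n ^ 13 * v)) * (4 * (real n)\<^sup>2)"
          using exp_ln_budget[OF n v u] Ms(2) n v
          by (intro mult_mono mult_nonneg_nonneg) (auto simp: a0_def add_ac)
        also have "\<dots> = \<alpha> * (1 / real n ^ 10)"
          using n \<alpha> by (simp add: v_def field_simps power2_eq_square flip: power_Suc power_add)
        also have "\<dots> \<le> \<alpha> * 1" using n \<alpha> by (intro mult_left_mono) auto
        finally show "6 * real n * exp (- (a0 * ln (real n))) \<le> \<alpha> / real (card ?Ms)"
          using cardMs by (simp add: pos_le_divide_eq)
      qed (simp add: C0_def \<rho>_def)
    qed
    \<comment> \<open>The standardized points then move by at most \<open>c2 / n^5\<close>; since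
      \<open>D^2 \<le> n^4\<close>, the statistic moves by at most \<open>C3 / n\<close>, which is
      below \<open>C3 * \<rho>\<close>.\<close>
    define \<delta> where "\<delta> = 1 / real n ^ 6"
    have \<delta>: "0 < \<delta>" using n by (simp add: \<delta>_def)
    obtain F1 where F1: "finite F1" "F1 \<subseteq> {\<mu>0..\<mu>1}" "real (card F1) \<le> (\<mu>1 - \<mu>0) / \<delta> + 1"
      "\<forall>x\<in>{\<mu>0..\<mu>1}. \<exists>y\<in>F1. \<bar>x - y\<bar> \<le> \<delta>"
      using interval_net[OF \<mu>01 \<delta>] by blast
    obtain F2 where F2: "finite F2" "F2 \<subseteq> {\<sigma>0..\<sigma>1}" "real (card F2) \<le> (\<sigma>1 - \<sigma>0) / \<delta> + 1"
      "\<forall>x\<in>{\<sigma>0..\<sigma>1}. \<exists>y\<in>F2. \<bar>x - y\<bar> \<le> \<delta>"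
      using interval_net[OF \<sigma>01 \<delta>] by blast
    have n6: "1 \<le> real n ^ 6" using n by simp
    have cF: "real (card (F1 \<times> F2)) \<le> ck * real n ^ 12"
    proof -
      have "real (card F1) \<le> (\<bar>\<mu>1 - \<mu>0\<bar> + 1) * real n ^ 6"
        using F1(3) \<mu>01 n6 by (simp add: \<delta>_def distrib_right)
      moreover have "real (card F2) \<le> (\<bar>\<sigma>1 - \<sigma>0\<bar> + 1) * real n ^ 6"
        using F2(3) \<sigma>01 n6 by (simp add: \<delta>_def distrib_right)
      ultimately have "real (card F1) * real (card F2) \<le> ((\<bar>\<mu>1 - \<mu>0\<bar> + 1) * real n ^ 6) * ((\<bar>\<sigma>1 - \<sigma>0\<bar> + 1) * real n ^ 6)"
        by (intro mult_mono) auto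
      also have "\<dots> = ck * (real n ^ 6 * real n ^ 6)" by (simp add: ck_def)
      also have "real n ^ 6 * real n ^ 6 = real n ^ 12" by (simp flip: power_add)
      finally show ?thesis by (simp add: card_cartesian_product)
    qed
    let ?dd = "\<lambda>\<mu> \<sigma>. (l2_norm (\<lambda>y. f y - 1 / \<sigma> * f0 ((y - \<mu>) / \<sigma>)))\<^sup>2"
    let ?low = "\<lambda>\<mu> \<sigma>. \<sigma> * (3 / 4 * ?dd \<mu> \<sigma> - 5 / 4 * repro_kernel.bias f (ker (real D / \<sigma>) \<mu>) - C1 * \<rho>)"
    have w1: "whp (sample_law n f) (\<beta> / 2) (\<lambda>x. \<forall>p\<in>F1 \<times> F2. ?low (fst p) (snd p) \<le> T_hat \<phi> f0 n (2, D) (\<lambda>i. (x i - fst p) / snd p))"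
    proof -
      have "whp (sample_law n f) (real (card (F1 \<times> F2)) * (6 * real n * exp (- (a0 * ln (real n)))))
        (\<lambda>x. \<forall>p\<in>F1 \<times> F2. ?low (fst p) (snd p) \<le> T_hat \<phi> f0 n (2, D) (\<lambda>i. (x i - fst p) / snd p))"
      proof (rule whp_Ball)
        fix p assume "p \<in> F1 \<times> F2"
        then have "\<sigma>0 \<le> snd p" using F2(2) by auto
        from T_hat_alt_lower[OF f f0 \<sigma>0 this n D(1) J(2) a0, of "fst p"]
        show "whp (sample_law n f) (6 * real n * exp (- (a0 * ln (real n))))
           (\<lambda>x. ?low (fst p) (snd p) \<le> T_hat \<phi> f0 n (2, D) (\<lambda>i. (x i - fst p) / snd p))"
          unfolding C1_def \<rho>_def .
      qed (use F1 F2 in auto)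
      then show ?thesis
      proof (rule whp_mono)
        have "real (card (F1 \<times> F2)) * (6 * real n * exp (- (a0 * ln (real n))))
            \<le> (ck * real n ^ 12) * (6 * real n * (1 / (real n ^ 13 * u)))"
          using exp_ln_budget[OF n u v] cF n ck
          by (intro mult_mono mult_nonneg_nonneg) (auto simp: a0_def)
        also have "\<dots> = \<beta> / 2"
        proof -
          have "real n ^ 13 = real n ^ 12 * real n" by (simp flip: power_Suc2)
          then show ?thesis using n ck \<beta> by (simp add: u_def field_simps)
        qed
        finally show "real (card (F1 \<times> F2)) * (6 * real n * exp (- (a0 * ln (real n)))) \<le> \<beta> / 2" .
      qed
    qed
    \<comment> \<open>Chosen so that the bound \<open>n \<nu> / r^2\<close> for a larger observation
      equals \<open>\<beta> / 2\<close>.\<close>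
    define r where "r = sqrt (2 * real n * \<nu> / \<beta>)"
    have r2: "r\<^sup>2 = 2 * real n * \<nu> / \<beta>" using n pos \<beta> by (simp add: r_def)
    have r: "0 < r" using n pos \<beta> by (simp add: r_def)
    have rr0: "r \<le> real n * r0"
    proof -
      have "r = sqrt (real n) * r0" by (simp add: r_def r0_def flip: real_sqrt_mult)
      also have "\<dots> \<le> real n * r0"
        using n pos \<beta> by (intro mult_right_mono real_le_lsqrt) (auto simp: r0_def power2_eq_square)
      finally show ?thesis .
    qed
    have w2: "whp (sample_law n f) (\<beta> / 2) (\<lambda>x. \<forall>i\<in>{1..n}. \<bar>x i\<bar> \<le> r)"
    proof (rule whp_mono[OF f.sample_max[OF mom r]])
      show "real n * (\<nu> / r\<^sup>2) \<le> \<beta> / 2" unfolding r2 using n pos \<beta> by (simp add: field_simps)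
    qed (use pos in auto)
    have w3: "whp (sample_law n f) 0 (\<lambda>x. \<forall>i\<in>{1..n}. x i \<in> supp f)"
      by (rule whp_AE[OF f.sample_in_supp]) simp
    have "whp (sample_law n f) (\<beta> / 2 + (\<beta> / 2 + 0))
      (\<lambda>x. (\<forall>p\<in>F1 \<times> F2. ?low (fst p) (snd p) \<le> T_hat \<phi> f0 n (2, D) (\<lambda>i. (x i - fst p) / snd p))
        \<and> (\<forall>i\<in>{1..n}. \<bar>x i\<bar> \<le> r) \<and> (\<forall>i\<in>{1..n}. x i \<in> supp f))"
      by (intro whp_conj w1 w2 w3) (use \<beta> in auto)
    then show "whp (sample_law n f) \<beta> (\<lambda>x. \<not> T_alpha \<phi> f0 K n ?Ms \<alpha> x \<le> 0)"
    proof (rule whp_mono)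
      fix x
      assume x: "(\<forall>p\<in>F1 \<times> F2. ?low (fst p) (snd p) \<le> T_hat \<phi> f0 n (2, D) (\<lambda>i. (x i - fst p) / snd p))
        \<and> (\<forall>i\<in>{1..n}. \<bar>x i\<bar> \<le> r) \<and> (\<forall>i\<in>{1..n}. x i \<in> supp f)"
      have low: "(\<bar>C0\<bar> + C3 + 1) * \<rho> \<le> ?low \<mu> \<sigma>" if \<mu>\<sigma>: "(\<mu>, \<sigma>) \<in> K" for \<mu> \<sigma>
      proof -
        have s: "\<sigma>0 \<le> \<sigma>" "\<sigma> \<le> \<sigma>1" "0 < \<sigma>" using \<mu>\<sigma> K \<sigma>0 by auto
        have "(INF (\<mu>, \<sigma>)\<in>K. ?dd \<mu> \<sigma>) \<le> (case (\<mu>, \<sigma>) of (\<mu>, \<sigma>) \<Rightarrow> ?dd \<mu> \<sigma>)"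
          by (rule cINF_lower[OF _ \<mu>\<sigma>]) (auto intro!: bdd_belowI[of _ 0])
        then have dd: "C * tot \<le> ?dd \<mu> \<sigma>" using sep by (simp add: tot_def)
        define bi where "bi = repro_kernel.bias f (ker (real D / \<sigma>) \<mu>)"
        have "bi \<le> R\<^sup>2 * \<sigma> powr (2 * s) * real D powr (- 2 * s)"
          unfolding bi_def D_def by (rule bias_B_class[OF f B \<mu>\<sigma> s(3)])
        also have "\<dots> = \<sigma> powr (2 * s) * (R\<^sup>2 * real D powr (- 2 * s))" by simp
        also have "\<dots> \<le> S * (2 powr (2 * s) * tot)"
          unfolding S_def using s pos by (intro mult_mono powr_mono2 J(3)) auto
        finally have bi: "bi \<le> S * 2 powr (2 * s) * tot" by simp
        have c1r: "C1 * \<rho> \<le> \<bar>C1\<bar> * \<rho>" using \<rho> by (intro mult_right_mono) auto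
        have c1P: "(\<bar>C1\<bar> + P) * \<rho> \<le> (\<bar>C1\<bar> + P) * (2 * tot)"
          using J(4) P by (intro mult_left_mono) (auto simp: \<rho>_def)
        have Ctot: "3 / 4 * (C * tot) = 5 / 4 * (S * 2 powr (2 * s) * tot) + (\<bar>C1\<bar> + P) * (2 * tot) + 3 / 4 * tot"
          by (simp add: C_def field_simps)
        have v: "P * \<rho> \<le> 3 / 4 * ?dd \<mu> \<sigma> - 5 / 4 * bi - C1 * \<rho>"
        proof -
          have "P * \<rho> \<le> 3 / 4 * d - 5 / 4 * bi - C1 * \<rho>"
            if "C * tot \<le> d" "bi \<le> e2" "\<bar>C1\<bar> * \<rho> + P * \<rho> \<le> e1" "3 / 4 * (C * tot) = 5 / 4 * e2 + e1 + 3 / 4 * tot"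
            for d e1 e2
            using that c1r tot by linarith
          from this[OF dd bi c1P[unfolded distrib_right[of _ _ \<rho>]] Ctot] show ?thesis .
        qed
        have "(\<bar>C0\<bar> + C3 + 1) * \<rho> = \<sigma>0 * (P * \<rho>)" using \<sigma>0 by (simp add: P_def)
        also have "\<dots> \<le> \<sigma> * (P * \<rho>)" using s P \<rho> by (intro mult_right_mono) auto
        also have "\<dots> \<le> \<sigma> * (3 / 4 * ?dd \<mu> \<sigma> - 5 / 4 * bi - C1 * \<rho>)" using s v by (intro mult_left_mono) auto
        finally show ?thesis by (simp add: bi_def)
      qed
      \<comment> \<open>From the grid to all of \<open>K\<close>: compare with a grid point at
        distance at most \<open>\<delta>\<close> in both parameters, itself in \<open>K\<close>, so
        that the separation applies there.\<close>
      have T: "(C0 + 1) * \<rho> \<le> T_hat \<phi> f0 n (2, D) (\<lambda>i. (x i - \<mu>) / \<sigma>)" if \<mu>\<sigma>: "(\<mu>, \<sigma>) \<in> K" for \<mu> \<sigma>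
      proof -
        have s: "\<sigma>0 \<le> \<sigma>" "\<mu> \<in> {\<mu>0..\<mu>1}" "\<sigma> \<in> {\<sigma>0..\<sigma>1}" using \<mu>\<sigma> K by auto
        obtain \<mu>' where m': "\<mu>' \<in> F1" "\<bar>\<mu> - \<mu>'\<bar> \<le> \<delta>" using F1(4) s by blast
        obtain \<sigma>' where s': "\<sigma>' \<in> F2" "\<bar>\<sigma> - \<sigma>'\<bar> \<le> \<delta>" using F2(4) s by blast
        have K': "(\<mu>', \<sigma>') \<in> K" using m' s' F1(2) F2(2) K by auto
        then have s0': "\<sigma>0 \<le> \<sigma>'" "\<bar>\<mu>'\<bar> \<le> m" using K by (auto simp: m_def)
        define \<eta> where "\<eta> = \<delta> * real n * c2"
        have y: "\<bar>(x i - \<mu>) / \<sigma> - (x i - \<mu>') / \<sigma>'\<bar> \<le> \<eta>" if i: "i \<in> {1..n}" for i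
        proof -
          have "\<bar>x i\<bar> \<le> r" using x i by blast
          then have "\<bar>(x i - \<mu>) / \<sigma> - (x i - \<mu>') / \<sigma>'\<bar> \<le> \<delta> * (1 / \<sigma>0 + (r + m) / \<sigma>0\<^sup>2)"
            by (intro abs_standardize_diff_le \<sigma>0 s s0' m' s')
          also have "\<dots> \<le> \<delta> * (real n * c2)"
          proof (intro mult_left_mono)
            have m0: "0 \<le> m" by (simp add: m_def)
            have "1 * (1 / \<sigma>0) \<le> real n * (1 / \<sigma>0)" using n \<sigma>0 by (intro mult_right_mono) auto
            moreover have "1 * m \<le> real n * m" using n m0 by (intro mult_right_mono) auto
            then have "(r + m) / \<sigma>0\<^sup>2 \<le> (real n * (r0 + m)) / \<sigma>0\<^sup>2"
              using rr0 by (intro divide_right_mono) (auto simp: distrib_left)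
            ultimately show "1 / \<sigma>0 + (r + m) / \<sigma>0\<^sup>2 \<le> real n * c2"
              by (simp add: c2_def distrib_left)
          qed (use \<delta> in auto)
          finally show ?thesis by (simp add: \<eta>_def mult.assoc)
        qed
        have fl: "\<bar>f0 ((x i - \<mu>) / \<sigma>) - f0 ((x i - \<mu>') / \<sigma>')\<bar> \<le> Cf0 * \<eta>" if i: "i \<in> {1..n}" for i
        proof -
          have "x i \<in> supp f" using x i by blast
          with lip \<mu>\<sigma> K' have "\<bar>f0 ((x i - \<mu>) / \<sigma>) - f0 ((x i - \<mu>') / \<sigma>')\<bar> \<le> Cf0 * \<bar>(x i - \<mu>) / \<sigma> - (x i - \<mu>') / \<sigma>'\<bar>"
            by fastforce
          also have "\<dots> \<le> Cf0 * \<eta>" using y[OF i] pos by (intro mult_left_mono) auto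
          finally show ?thesis .
        qed
        have "\<bar>T_hat \<phi> f0 n (2, D) (\<lambda>i. (x i - \<mu>) / \<sigma>) - T_hat \<phi> f0 n (2, D) (\<lambda>i. (x i - \<mu>') / \<sigma>')\<bar>
           \<le> 2 * c1 * (real D)\<^sup>2 * \<eta> + 2 * Cf0 * \<eta>"
          by (rule T_hat_lipschitz[OF _ y fl]) (use n in auto)
        also have "\<dots> \<le> C3 * \<rho>"
        proof -
          have X: "1 \<le> ln (real n)" by (rule ln_ge_1_of_ge_3[OF n3])
          have "real D * 1 \<le> real D * (ln (real n)) ^ 3" using X by (intro mult_left_mono) auto
          then have Dn: "real D \<le> (real n)\<^sup>2" using J(2) by linarith
          have Dn2: "(real D)\<^sup>2 \<le> real n ^ 4"
            using power_mono[OF Dn, of 2] by (simp flip: power_mult)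
          have \<eta>e: "\<eta> = c2 / real n ^ 5"
          proof -
            have "real n ^ 6 = real n ^ 5 * real n" by (simp flip: power_Suc2)
            then show ?thesis using n by (simp add: \<eta>_def \<delta>_def)
          qed
          have n5: "real n ^ 5 = real n ^ 4 * real n" by (simp flip: power_Suc2)
          have n4: "1 \<le> real n ^ 4" using n by simp
          have e1: "real n ^ 4 * \<eta> = c2 / real n" unfolding \<eta>e n5 using n by simp
          have \<eta>0: "0 \<le> \<eta>" using c2 by (simp add: \<eta>e)
          have "(real D)\<^sup>2 * \<eta> \<le> c2 / real n" using mult_right_mono[OF Dn2 \<eta>0] e1 by simp
          moreover have "\<eta> \<le> c2 / real n" using mult_right_mono[OF n4 \<eta>0] e1 by simp
          ultimately have "2 * c1 * ((real D)\<^sup>2 * \<eta>) + 2 * Cf0 * \<eta> \<le> 2 * c1 * (c2 / real n) + 2 * Cf0 * (c2 / real n)"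
            using c1_nonneg pos by (intro add_mono mult_left_mono) auto
          also have "\<dots> = C3 * (1 / real n)" by (simp add: C3_def add_divide_distrib)
          also have "\<dots> \<le> C3 * \<rho>"
          proof (intro mult_left_mono C3)
            have "1 / real n \<le> ln (real n) / real n" using X by (intro divide_right_mono) auto
            also have "\<dots> \<le> \<rho>" using X by (simp add: \<rho>_def rate_def)
            finally show "1 / real n \<le> \<rho>" .
          qed
          finally show ?thesis by (simp add: mult.assoc)
        qed
        finally have "T_hat \<phi> f0 n (2, D) (\<lambda>i. (x i - \<mu>') / \<sigma>') - C3 * \<rho> \<le> T_hat \<phi> f0 n (2, D) (\<lambda>i. (x i - \<mu>) / \<sigma>)"
          by linarith
        moreover have "?low \<mu>' \<sigma>' \<le> T_hat \<phi> f0 n (2, D) (\<lambda>i. (x i - \<mu>') / \<sigma>')"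
          using x m' s' by fastforce
        moreover have "C0 * \<rho> \<le> \<bar>C0\<bar> * \<rho>" using \<rho> by (intro mult_right_mono) auto
        ultimately show ?thesis using low[OF K'] by (simp only: distrib_right mult_1)
      qed
      show "\<not> T_alpha \<phi> f0 K n ?Ms \<alpha> x \<le> 0"
      proof
        assume "T_alpha \<phi> f0 K n ?Ms \<alpha> x \<le> 0"
        from T_alpha_le_0_imp[OF this m2 tq] have "T_tilde \<phi> f0 K n (2, D) x \<le> ereal (C0 * \<rho>)" .
        \<comment> \<open>The spare \<open>\<rho>\<close> survives the infimum over \<open>K\<close>
          and separates \<open>T_tilde\<close> strictly from the bound on the quantile.\<close>
        moreover have "ereal ((C0 + 1) * \<rho>) \<le> T_tilde \<phi> f0 K n (2, D) x"
          unfolding T_tilde_def by (rule INF_greatest) (use T in auto)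
        ultimately have "ereal ((C0 + 1) * \<rho>) \<le> ereal (C0 * \<rho>)" by (rule order_trans[rotated])
        then show False using \<rho> by (simp add: distrib_right)
      qed
    qed simp
  qed
qed

end

theorem corollary3:
  fixes \<phi> \<psi> :: "real \<Rightarrow> real"
    and \<mu>0 \<mu>1 \<sigma>0 \<sigma>1 :: real
    and K :: "(real \<times> real) set"
    and L Cf0 M \<nu> c \<alpha> \<beta> s :: real
  assumes "wavelet_pair \<phi> \<psi>"
    and "0 < \<sigma>0"
    and "K = {\<mu>0..\<mu>1} \<times> {\<sigma>0..\<sigma>1}"
    and "0 < Cf0" and "0 < \<nu>" and "0 < c" and "0 < M" and "0 < s"
    and "0 < \<alpha>" and "\<alpha> < 1" and "0 < \<beta>" and "\<beta> < 1"
  shows "\<exists>C>0. \<forall>(n::nat) (f0 :: real \<Rightarrow> real) (f :: real \<Rightarrow> real) (R::real) (D1 :: nat set).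
    n \<ge> 3 \<longrightarrow>
    (real n)\<^sup>2 * min (\<mu>1 - \<mu>0) (\<sigma>1 - \<sigma>0) \<ge> 2 \<longrightarrow>
    is_density f0 \<longrightarrow> sup_norm f0 = ereal L \<longrightarrow>
    is_density f \<longrightarrow> sup_norm f < \<infinity> \<longrightarrow>
    (\<forall>x\<in>supp f. \<forall>y\<in>supp f. \<forall>(\<mu>, \<sigma>)\<in>K. \<forall>(\<mu>', \<sigma>')\<in>K.
       \<bar>f0 ((x - \<mu>) / \<sigma>) - f0 ((y - \<mu>') / \<sigma>')\<bar> \<le> Cf0 * \<bar>(x - \<mu>) / \<sigma> - (y - \<mu>') / \<sigma>'\<bar>) \<longrightarrow>
    (\<forall>k\<ge>2. (\<integral>\<^sup>+x. ennreal (\<bar>x\<bar> ^ k) \<partial>dens_measure f) \<le> ennreal (fact k / 2 * \<nu> * c ^ (k - 2))) \<longrightarrow>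
    D1 \<subseteq> dyadic_upto ((real n)\<^sup>2) \<longrightarrow>
    R > 0 \<longrightarrow>
    f \<in> B_class \<phi> K s R M \<longrightarrow>
    (INF (\<mu>, \<sigma>)\<in>K. (l2_norm (\<lambda>x. f x - 1 / \<sigma> * f0 ((x - \<mu>) / \<sigma>)))\<^sup>2)
      > C * (R powr (2 / (4 * s + 1)) * (sqrt (ln (real n)) / real n) powr (4 * s / (4 * s + 1))
             + R\<^sup>2 * ((ln (real n)) ^ 3 / (real n)\<^sup>2) powr (2 * s)
             + ln (real n) / real n) \<longrightarrow>
    outer_measure_of (sample_law n f)
      {x \<in> space (sample_law n f).
         T_alpha \<phi> f0 K n (models D1 (dyadic_upto ((real n)\<^sup>2 / (ln (real n)) ^ 3))) \<alpha> x \<le> 0}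
      \<le> ennreal \<beta>"
proof -
  obtain a \<Phi> \<Lambda> where "scaling_fun \<phi> a \<Phi> \<Lambda>"
    using wavelet_pair_scaling_fun[OF assms(1)] by blast
  then interpret scaling_fun \<phi> a \<Phi> \<Lambda> .
  from alternative_rejected[OF assms(2,3,4,5,8,9,10,11,12), of L M] show ?thesis
  proof (elim exE conjE, goal_cases)
    case (1 C)
    note test = 1(2)[rule_format]
    show ?case
    proof (intro exI[of _ C] conjI 1(1) allI impI, goal_cases)
      case (1 n f0 f R D1)
      note n = 1(1) and K2 = 1(2) and f0 = 1(3,4) and f = 1(5) and lip = 1(7) and mom = 1(8)
        and rest = 1(9-11) and sep = 1(12)
      \<comment> \<open>The size condition forces both parameter intervals to be
        nondegenerate.\<close>
      have "0 < (real n)\<^sup>2 * min (\<mu>1 - \<mu>0) (\<sigma>1 - \<sigma>0)" using K2 by linarith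
      then have le: "\<mu>0 \<le> \<mu>1" "\<sigma>0 \<le> \<sigma>1" by (auto simp: zero_less_mult_iff)
      have "bounded_density f0 L"
        using f0 sup_normD[of f0 L] by unfold_locales (auto simp: abs_le_iff)
      moreover have "bounded_density f M"
        using f rest(3) sup_normD[of f M] by unfold_locales (auto simp: B_class_def abs_le_iff)
      \<comment> \<open>For \<open>k = 2\<close> the factor \<open>fact k / 2\<close> and the power
        of \<open>c\<close> are both 1.\<close>
      moreover have "(\<integral>\<^sup>+x. ennreal (\<bar>x\<bar> ^ 2) \<partial>dens_measure f) \<le> ennreal \<nu>"
        using mom[rule_format, of 2] by simp
      ultimately show ?case
        using lip rest sep
        by (intro whp_imp_outer_measure_le test n le) (auto simp: total_rate_def)
    qed
  qed
qed

end
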